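(* Assume Schinzel's hypothesis H (stated in the context). Then for every $n\geq 2$ there exists a Galois extension $L/\mathbb{Q}$ with $\mathrm{Gal}(L/\mathbb{Q})\cong S_n$ in which exactly one prime of $\mathbb{Q}$ ramifies; in particular such $L$ can be taken to be totally real and ramified at a single prime number. That is, $r_{\mathbb{Q}}(S_n)=1$ for every $n\geq 2$.
   Context: Primes of $\mathbb{Q}$ are the prime numbers together with the infinite prime (the usual absolute value); the infinite prime is said to ramify in a finite Galois extension $L/\mathbb{Q}$ iff $L$ is not totally real. $r_{\mathbb{Q}}(G)$ is the minimal number of primes of $\mathbb{Q}$ ramified in a Galois extension $L/\mathbb{Q}$ with Galois group $G$. Schinzel's hypothesis H: if $f_1,\dots,f_r\in\mathbb{Z}[X]$ are irreducible and $f_1\cdots f_r$ is not the zero function modulo any prime number, then there exist infinitely many $n\in\mathbb{Z}$ such that $f_1(n),\dots,f_r(n)$ are simultaneously prime. *)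

theory Defs
  imports Complex_Main "HOL-Computational_Algebra.Computational_Algebra" "HOL-Algebra.Sym_Groups"
begin

text \<open>Schinzel's hypothesis H. A value of an integer polynomial is "prime" when it is a prime
  element of the integers, i.e. plus or minus a prime number.\<close>
definition schinzel_H :: bool where
  "schinzel_H \<longleftrightarrow>
     (\<forall>fs :: int poly list.
        (\<forall>f\<in>set fs. irreducible f) \<and>
        (\<forall>p::int. prime p \<longrightarrow> (\<exists>n::int. \<not> p dvd poly (prod_list fs) n))
        \<longrightarrow> infinite {n::int. \<forall>f\<in>set fs. prime_elem (poly f n)})"

text \<open>Number fields are realised as subfields of the complex numbers.\<close>
definition subfield_C :: "complex set \<Rightarrow> bool" where
  "subfield_C L \<longleftrightarrow> 0 \<in> L \<and> 1 \<in> L \<and>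
     (\<forall>x\<in>L. \<forall>y\<in>L. x + y \<in> L \<and> x * y \<in> L) \<and>
     (\<forall>x\<in>L. - x \<in> L \<and> inverse x \<in> L)"

definition number_field :: "complex set \<Rightarrow> bool" where
  "number_field L \<longleftrightarrow> subfield_C L \<and>
     (\<exists>B. finite B \<and> B \<subseteq> L \<and>
        (\<forall>x\<in>L. \<exists>c. (\<forall>b\<in>B. c b \<in> \<rat>) \<and> x = (\<Sum>b\<in>B. c b * b)))"

definition field_emb :: "complex set \<Rightarrow> (complex \<Rightarrow> complex) \<Rightarrow> bool" where
  "field_emb L \<sigma> \<longleftrightarrow> \<sigma> 1 = 1 \<and>
     (\<forall>x\<in>L. \<forall>y\<in>L. \<sigma> (x + y) = \<sigma> x + \<sigma> y \<and> \<sigma> (x * y) = \<sigma> x * \<sigma> y)"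

definition Aut :: "complex set \<Rightarrow> (complex \<Rightarrow> complex) set" where
  "Aut L = {\<sigma>. field_emb L \<sigma> \<and> bij_betw \<sigma> L L \<and> (\<forall>x. x \<notin> L \<longrightarrow> \<sigma> x = x)}"

definition galois_group :: "complex set \<Rightarrow> (complex \<Rightarrow> complex) monoid" where
  "galois_group L = \<lparr> carrier = Aut L, mult = (\<circ>), one = id \<rparr>"

definition galois_over_Q :: "complex set \<Rightarrow> bool" where
  "galois_over_Q L \<longleftrightarrow> number_field L \<and> {x \<in> L. \<forall>\<sigma>\<in>Aut L. \<sigma> x = x} = \<rat>"

definition totally_real :: "complex set \<Rightarrow> bool" where
  "totally_real L \<longleftrightarrow> (\<forall>\<sigma>. field_emb L \<sigma> \<longrightarrow> \<sigma> ` L \<subseteq> \<real>)"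

definition ring_of_integers :: "complex set \<Rightarrow> complex set" where
  "ring_of_integers L = {x \<in> L. algebraic_int x}"

definition ideal_of :: "complex set \<Rightarrow> complex set \<Rightarrow> bool" where
  "ideal_of R I \<longleftrightarrow> I \<subseteq> R \<and> 0 \<in> I \<and> (\<forall>x\<in>I. \<forall>y\<in>I. x + y \<in> I) \<and>
     (\<forall>r\<in>R. \<forall>x\<in>I. r * x \<in> I)"

definition prime_ideal_of :: "complex set \<Rightarrow> complex set \<Rightarrow> bool" where
  "prime_ideal_of R P \<longleftrightarrow> ideal_of R P \<and> P \<noteq> R \<and> P \<noteq> {0} \<and>
     (\<forall>x\<in>R. \<forall>y\<in>R. x * y \<in> P \<longrightarrow> x \<in> P \<or> y \<in> P)"

definition ideal_prod :: "complex set \<Rightarrow> complex set \<Rightarrow> complex set" where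
  "ideal_prod I J = {(\<Sum>i<k. a i * b i) | (k::nat) a b. \<forall>i<k. a i \<in> I \<and> b i \<in> J}"

text \<open>The prime number p ramifies in L iff some prime ideal P of O_L has e(P|p) \<ge> 2,
  i.e. p O_L \<subseteq> P^2.\<close>
definition ramified_at :: "nat \<Rightarrow> complex set \<Rightarrow> bool" where
  "ramified_at p L \<longleftrightarrow>
     (\<exists>P. prime_ideal_of (ring_of_integers L) P \<and>
        {of_nat p * x | x. x \<in> ring_of_integers L} \<subseteq> ideal_prod P P)"

text \<open>Number of primes of \<rat> (prime numbers plus the infinite prime) ramified in L.\<close>
definition num_ramified :: "complex set \<Rightarrow> nat" where
  "num_ramified L = card {p::nat. prime p \<and> ramified_at p L} + (if totally_real L then 0 else 1)"

definition r_Q :: "'g monoid \<Rightarrow> nat" where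
  "r_Q G = (LEAST k. \<exists>L. galois_over_Q L \<and> galois_group L \<cong> G \<and> num_ramified L = k)"

end

(*
  Let F_s = h + s k with k the product of X - i over 0 < i < n, up to an integer multiple and a
  perturbation. For large |s| the real zeros of k force F_s to be totally real. The discriminant of F_s
  is a polynomial D(s) whose zeros are the critical values -h(w)/k(w), where w runs through the zeros of
  the Wronskian h k' - h' k. Congruence conditions make the Wronskian Eisenstein, make some prime r
  divide D(0) exactly once, and exclude fixed prime divisors of D. Hence D is irreducible, and
  Schinzel's hypothesis gives an s with |s| large and D(s) prime up to sign. Further congruences modulo
  three primes at which Frobenius elements are explicit put an n-cycle, an (n-1)-cycle and a
  transposition into the Galois group, which is therefore the full symmetric group. Inertia is trivial
  at every prime not dividing D(s). The lower bound comes from the quadratic subfield cut out by the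
  sign character: a totally real quadratic field is ramified at some prime number.
*)
theory Submission
  imports Defs "Jordan_Normal_Form.Char_Poly" "HOL-Number_Theory.Residue_Primitive_Roots"
begin

text \<open>Schinzel's hypothesis yields infinitely many s but no control of their sign, so F_s must
  be totally real for large |s| of either sign. A constant k would not do for n > 2. Here k changes
  sign between n sample points, which traps n - 1 zeros of F_s; the last one is real because nonreal
  zeros come in conjugate pairs.

  Irreducibility of D is transferred from the Wronskian. For X^n + p X and X^(n-1) + 1 with p
  dividing n, the Wronskian is -X^(2n-2) modulo p with constant term -p. This alone would allow D to
  be a proper power of an irreducible polynomial up to sign; a simple factor r of D(0) forbids it.

  The order of choice matters: the primes dividing the discriminant of h are known only once h is
  fixed, so k is prescribed modulo them afterwards.

  The Galois group is unknown until Frobenius elements have been found in it. Hence the roots are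
  studied through functions on all permutations; the splitting field and its automorphisms are built
  only when the group is known to be full.\<close>

hide_const (open) up_ring.coeff up_ring.monom module.smult

section \<open>Algebraic integers\<close>

text \<open>The characteristic polynomial of an integer matrix is monic with integer coefficients,
  and \<open>x\<close> is one of its zeros. All closure properties of algebraic integers below rest
  on this.\<close>

lemma algebraic_int_if_integer_eigenvector:
  fixes x :: complex and v :: "'i \<Rightarrow> complex" and A :: "'i \<Rightarrow> 'i \<Rightarrow> int"
  assumes fin: "finite I"
    and ev: "\<And>i. i \<in> I \<Longrightarrow> x * v i = (\<Sum>j\<in>I. of_int (A i j) * v j)"
    and nz: "\<exists>i\<in>I. v i \<noteq> 0"
  shows "algebraic_int x"
proof -
  define N where "N = card I"
  obtain f where f: "bij_betw f {0..<N} I"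
    using ex_bij_betw_nat_finite[OF fin] unfolding N_def by blast
  define M where "M = mat N N (\<lambda>(i,j). A (f i) (f j))"
  have M: "M \<in> carrier_mat N N" by (simp add: M_def)
  let ?MC = "map_mat (of_int :: int \<Rightarrow> complex) M"
  have MC: "?MC \<in> carrier_mat N N" using M by simp
  define w where "w = vec N (\<lambda>i. v (f i))"
  have fI: "f i \<in> I" if "i < N" for i using f that by (auto simp: bij_betw_def)
  have "?MC *\<^sub>v w = x \<cdot>\<^sub>v w"
  proof (rule eq_vecI)
    fix i assume "i < dim_vec (x \<cdot>\<^sub>v w)"
    then have i: "i < N" by (simp add: w_def)
    have "x * v (f i) = (\<Sum>j\<in>I. of_int (A (f i) j) * v j)"
      using ev[OF fI[OF i]] .
    also have "\<dots> = (\<Sum>j\<in>{0..<N}. of_int (A (f i) (f j)) * v (f j))"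
      using sum.reindex_bij_betw[OF f, of "\<lambda>j. of_int (A (f i) j) * v j"] by simp
    finally show "(?MC *\<^sub>v w) $ i = (x \<cdot>\<^sub>v w) $ i"
      using i M by (simp add: M_def w_def scalar_prod_def)
  qed (simp add: M_def w_def)
  moreover have "w \<noteq> 0\<^sub>v N"
  proof
    assume w0: "w = 0\<^sub>v N"
    obtain i where i: "i \<in> I" "v i \<noteq> 0" using nz by blast
    then obtain k where "k < N" "f k = i" using f unfolding bij_betw_def by (metis atLeastLessThan_iff imageE)
    moreover have "vec_index w k = vec_index (0\<^sub>v N) k" by (simp only: w0)
    ultimately show False using i by (simp add: w_def)
  qed
  moreover have "w \<in> carrier_vec N" by (simp add: w_def)
  ultimately have "eigenvalue ?MC x"
    using M unfolding eigenvalue_def eigenvector_def by auto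
  then have "poly (char_poly ?MC) x = 0"
    using eigenvalue_root_char_poly[OF MC] by simp
  then have "poly (map_poly of_int (char_poly M)) x = 0"
    by (simp add: of_int_hom.char_poly_hom[OF M])
  moreover have "lead_coeff (char_poly M) = 1"
    using degree_monic_char_poly[OF M] by simp
  ultimately show ?thesis
    unfolding algebraic_int_altdef_ipoly by blast
qed

lemma algebraic_int_power_relation:
  fixes x :: complex
  assumes "algebraic_int x"
  obtains m c where "m > 0" "x ^ m = (\<Sum>i<m. of_int (c i) * x ^ i)"
proof -
  from assms obtain p where p: "poly (map_poly of_int p) x = 0" "lead_coeff p = 1"
    unfolding algebraic_int_altdef_ipoly by blast
  define m where "m = degree p"
  have m0: "m > 0"
  proof (rule ccontr)
    assume "\<not> m > 0"
    then have "degree p = 0" by (simp add: m_def)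
    then obtain a where "p = [:a:]" by (rule degree_eq_zeroE)
    with p show False by (simp add: map_poly_pCons)
  qed
  have "0 = (\<Sum>i\<le>m. of_int (coeff p i) * x ^ i)"
    using p(1) by (simp add: poly_altdef m_def degree_map_poly coeff_map_poly)
  also have "\<dots> = (\<Sum>i<m. of_int (coeff p i) * x ^ i) + x ^ m"
    using p(2) by (simp add: lessThan_Suc_atMost[symmetric] m_def)
  finally have "x ^ m = (\<Sum>i<m. of_int (- coeff p i) * x ^ i)"
    by (simp add: sum_negf eq_neg_iff_add_eq_0 add.commute)
  with m0 show ?thesis by (rule that)
qed

text \<open>Multiplication by \<open>x\<close> and by \<open>y\<close> both act through integer
  matrices on the monomials \<open>x ^ a * y ^ b\<close> with exponents below the degrees of the two
  monic relations. The sum and the product of \<open>x\<close> and \<open>y\<close> are then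
  eigenvalues of the sum and the product of the matrices.\<close>

lemma algebraic_int_common_eigenvector:
  fixes x y :: complex
  assumes "algebraic_int x" "algebraic_int y"
  obtains I :: "(nat \<times> nat) set" and v :: "nat \<times> nat \<Rightarrow> complex" and A B :: "nat \<times> nat \<Rightarrow> nat \<times> nat \<Rightarrow> int"
  where "finite I" "\<exists>i\<in>I. v i \<noteq> 0"
    "\<And>i. i \<in> I \<Longrightarrow> x * v i = (\<Sum>j\<in>I. of_int (A i j) * v j)"
    "\<And>i. i \<in> I \<Longrightarrow> y * v i = (\<Sum>j\<in>I. of_int (B i j) * v j)"
proof -
  obtain m c where m: "m > 0" "x ^ m = (\<Sum>i<m. of_int (c i) * x ^ i)"
    using algebraic_int_power_relation[OF assms(1)] by blast
  obtain n d where n: "n > 0" "y ^ n = (\<Sum>i<n. of_int (d i) * y ^ i)"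
    using algebraic_int_power_relation[OF assms(2)] by blast
  \<comment> \<open>The companion matrix: it raises the exponent by one, and in the last row it
    applies the monic relation instead.\<close>
  define S where "S = (\<lambda>(m::nat) (c::nat \<Rightarrow> int) a a'. if Suc a < m then (if a' = Suc a then 1 else 0) else c a')"
  have S: "z * z ^ a = (\<Sum>a'<m. of_int (S m c a a') * z ^ a')"
    if "a < m" "z ^ m = (\<Sum>i<m. of_int (c i) * z ^ i)" for z :: complex and m c a
  proof (cases "Suc a < m")
    case True
    have "(\<Sum>a'<m. of_int (S m c a a') * z ^ a') = (\<Sum>a'<m. if a' = Suc a then z ^ a' else 0)"
      by (intro sum.cong) (auto simp: S_def True)
    then show ?thesis using True by simp
  next
    case False
    then have "m = Suc a" using that by simp
    with that show ?thesis by (simp add: S_def)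
  qed
  define I where "I = {..<m} \<times> {..<n}"
  have sum_I: "(\<Sum>j\<in>I. g j) = (\<Sum>a<m. \<Sum>b<n. g (a, b))" for g :: "nat \<times> nat \<Rightarrow> complex"
    by (simp add: I_def sum.cartesian_product)
  define v where "v = (\<lambda>(a::nat,b::nat). x ^ a * y ^ b)"
  define A where "A = (\<lambda>(a,b::nat) (a',b'). if b' = b then S m c a a' else (0::int))"
  define B where "B = (\<lambda>(a::nat,b) (a',b'). if a' = a then S n d b b' else (0::int))"
  show ?thesis
  proof (rule that[of I v A B])
    show "finite I" by (simp add: I_def)
    show "\<exists>i\<in>I. v i \<noteq> 0"
      by (rule bexI[of _ "(0,0)"]) (use m n in \<open>auto simp: I_def v_def\<close>)
  next
    fix i assume "i \<in> I"
    then obtain a b where i: "i = (a,b)" "a < m" "b < n" by (auto simp: I_def)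
    have "(\<Sum>j\<in>I. of_int (A i j) * v j) = (\<Sum>a'<m. \<Sum>b'<n. if b' = b then of_int (S m c a a') * (x ^ a' * y ^ b') else 0)"
      unfolding sum_I by (intro sum.cong) (auto simp: i A_def v_def)
    also have "\<dots> = (\<Sum>a'<m. of_int (S m c a a') * x ^ a') * y ^ b"
      using i by (simp add: sum_distrib_right mult.assoc)
    also have "\<dots> = x * v i" using S[OF i(2) m(2)] i by (simp add: v_def)
    finally show "x * v i = (\<Sum>j\<in>I. of_int (A i j) * v j)" by simp
    have "(\<Sum>j\<in>I. of_int (B i j) * v j) = (\<Sum>a'<m. \<Sum>b'<n. if a' = a then of_int (S n d b b') * (x ^ a' * y ^ b') else 0)"
      unfolding sum_I by (intro sum.cong) (auto simp: i B_def v_def)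
    also have "\<dots> = (\<Sum>a'<m. if a' = a then (\<Sum>b'<n. of_int (S n d b b') * (x ^ a' * y ^ b')) else 0)"
      by (intro sum.cong) auto
    also have "\<dots> = x ^ a * (\<Sum>b'<n. of_int (S n d b b') * y ^ b')"
      using i by (simp add: sum_distrib_left mult_ac)
    also have "\<dots> = y * v i" using S[OF i(3) n(2)] i by (simp add: v_def)
    finally show "y * v i = (\<Sum>j\<in>I. of_int (B i j) * v j)" by simp
  qed
qed

lemma algebraic_int_add:
  fixes x y :: complex
  assumes "algebraic_int x" "algebraic_int y"
  shows "algebraic_int (x + y)"
proof -
  obtain I :: "(nat \<times> nat) set" and v :: "nat \<times> nat \<Rightarrow> complex" and A B :: "nat \<times> nat \<Rightarrow> nat \<times> nat \<Rightarrow> int"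
  where I: "finite I" "\<exists>i\<in>I. v i \<noteq> 0"
    "\<And>i. i \<in> I \<Longrightarrow> x * v i = (\<Sum>j\<in>I. of_int (A i j) * v j)"
    "\<And>i. i \<in> I \<Longrightarrow> y * v i = (\<Sum>j\<in>I. of_int (B i j) * v j)"
    using algebraic_int_common_eigenvector[OF assms] by blast
  show ?thesis
    by (rule algebraic_int_if_integer_eigenvector[OF I(1) _ I(2), where A = "\<lambda>i j. A i j + B i j"])
       (simp add: distrib_right I(3,4) sum.distrib)
qed

lemma algebraic_int_mult:
  fixes x y :: complex
  assumes "algebraic_int x" "algebraic_int y"
  shows "algebraic_int (x * y)"
proof -
  obtain I :: "(nat \<times> nat) set" and v :: "nat \<times> nat \<Rightarrow> complex" and A B :: "nat \<times> nat \<Rightarrow> nat \<times> nat \<Rightarrow> int"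
  where I: "finite I" "\<exists>i\<in>I. v i \<noteq> 0"
    "\<And>i. i \<in> I \<Longrightarrow> x * v i = (\<Sum>j\<in>I. of_int (A i j) * v j)"
    "\<And>i. i \<in> I \<Longrightarrow> y * v i = (\<Sum>j\<in>I. of_int (B i j) * v j)"
    using algebraic_int_common_eigenvector[OF assms] by blast
  have "x * y * v i = (\<Sum>k\<in>I. of_int (\<Sum>j\<in>I. B i j * A j k) * v k)" if "i \<in> I" for i
  proof -
    have "x * y * v i = (\<Sum>j\<in>I. of_int (B i j) * (x * v j))"
      using I(4)[OF that] by (simp add: mult.assoc sum_distrib_left mult.left_commute)
    also have "\<dots> = (\<Sum>j\<in>I. \<Sum>k\<in>I. of_int (B i j) * of_int (A j k) * v k)"
      by (intro sum.cong refl) (simp add: I(3) sum_distrib_left mult.assoc)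
    also have "\<dots> = (\<Sum>k\<in>I. of_int (\<Sum>j\<in>I. B i j * A j k) * v k)"
      by (subst sum.swap) (simp add: sum_distrib_right)
    finally show ?thesis .
  qed
  then show ?thesis
    by (rule algebraic_int_if_integer_eigenvector[OF I(1) _ I(2)])
qed

lemma algebraic_int_diff: "algebraic_int x \<Longrightarrow> algebraic_int y \<Longrightarrow> algebraic_int (x - y)"
  for x y :: complex
  using algebraic_int_add[of x "-y"] by auto

lemma algebraic_int_power: "algebraic_int x \<Longrightarrow> algebraic_int (x ^ k)" for x :: complex
  by (induction k) (auto intro: algebraic_int_mult)

lemma algebraic_int_sum: "(\<And>i. i \<in> A \<Longrightarrow> algebraic_int (f i)) \<Longrightarrow> algebraic_int (\<Sum>i\<in>A. f i)"
  for f :: "'a \<Rightarrow> complex"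
  by (induction A rule: infinite_finite_induct) (auto intro: algebraic_int_add)

lemma algebraic_int_prod: "(\<And>i. i \<in> A \<Longrightarrow> algebraic_int (f i)) \<Longrightarrow> algebraic_int (\<Prod>i\<in>A. f i)"
  for f :: "'a \<Rightarrow> complex"
  by (induction A rule: infinite_finite_induct) (auto intro: algebraic_int_mult)

lemma algebraic_int_poly:
  fixes x :: complex
  assumes "algebraic_int x"
  shows "algebraic_int (poly (map_poly of_int p) x)"
  unfolding poly_altdef
  by (intro algebraic_int_sum algebraic_int_mult algebraic_int_power assms) (simp add: coeff_map_poly)

section \<open>Rings of algebraic integers and their prime ideals\<close>

definition int_subring :: "complex set \<Rightarrow> bool" where
  "int_subring R \<longleftrightarrow> 1 \<in> R \<and> (\<forall>x\<in>R. algebraic_int x) \<and>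
     (\<forall>x\<in>R. \<forall>y\<in>R. x + y \<in> R \<and> x * y \<in> R \<and> - x \<in> R)"

text \<open>The roots of a monic integer polynomial lie in this ring before any splitting field is
  at hand, so Frobenius elements are taken at its prime ideals. The ring of integers of a field is
  used only for ramification.\<close>

abbreviation all_integers :: "complex set" where
  "all_integers \<equiv> {x. algebraic_int x}"

lemma int_subring_all_integers: "int_subring all_integers"
  by (auto simp: int_subring_def intro: algebraic_int_add algebraic_int_mult)

lemma int_subringD:
  assumes "int_subring R"
  shows "1 \<in> R" "0 \<in> R" "x \<in> R \<Longrightarrow> algebraic_int x" "x \<in> R \<Longrightarrow> y \<in> R \<Longrightarrow> x + y \<in> R"
    "x \<in> R \<Longrightarrow> y \<in> R \<Longrightarrow> x * y \<in> R" "x \<in> R \<Longrightarrow> - x \<in> R" "x \<in> R \<Longrightarrow> y \<in> R \<Longrightarrow> x - y \<in> R"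
proof -
  note d = assms[unfolded int_subring_def]
  show "1 \<in> R" "x \<in> R \<Longrightarrow> algebraic_int x" "x \<in> R \<Longrightarrow> y \<in> R \<Longrightarrow> x + y \<in> R"
    "x \<in> R \<Longrightarrow> y \<in> R \<Longrightarrow> x * y \<in> R" "x \<in> R \<Longrightarrow> - x \<in> R"
    using d by blast+
  have "1 + - 1 \<in> R" using d by blast
  then show "0 \<in> R" by simp
  show "x \<in> R \<Longrightarrow> y \<in> R \<Longrightarrow> x - y \<in> R"
    using d by (metis diff_conv_add_uminus)
qed

lemma int_subring_of_nat: "int_subring R \<Longrightarrow> of_nat k \<in> R"
  by (induction k) (auto dest: int_subringD)

lemma int_subring_of_int: "int_subring R \<Longrightarrow> of_int k \<in> R"
  by (cases k rule: int_diff_cases) (auto dest: int_subringD intro: int_subring_of_nat)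

lemma int_subring_power: "int_subring R \<Longrightarrow> x \<in> R \<Longrightarrow> x ^ k \<in> R"
  by (induction k) (auto dest: int_subringD)

lemma int_subring_sum: "int_subring R \<Longrightarrow> (\<And>i. i \<in> A \<Longrightarrow> f i \<in> R) \<Longrightarrow> (\<Sum>i\<in>A. f i) \<in> R"
  by (induction A rule: infinite_finite_induct) (auto dest: int_subringD)

lemma int_subring_prod: "int_subring R \<Longrightarrow> (\<And>i. i \<in> A \<Longrightarrow> f i \<in> R) \<Longrightarrow> (\<Prod>i\<in>A. f i) \<in> R"
  by (induction A rule: infinite_finite_induct) (auto dest: int_subringD)

lemma int_subring_poly:
  assumes "int_subring R" "x \<in> R"
  shows "poly (map_poly of_int p) x \<in> R"
  unfolding poly_altdef
  by (intro int_subring_sum[OF assms(1)] int_subringD(5)[OF assms(1)] int_subring_power[OF assms])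
     (simp add: coeff_map_poly int_subring_of_int[OF assms(1)])

locale prime_ideal_in =
  fixes R P :: "complex set"
  assumes R: "int_subring R" and prime_ideal: "prime_ideal_of R P"
begin

lemma P_R: "x \<in> P \<Longrightarrow> x \<in> R"
  using prime_ideal by (auto simp: prime_ideal_of_def ideal_of_def)

lemma P_zero: "0 \<in> P"
  using prime_ideal by (auto simp: prime_ideal_of_def ideal_of_def)

lemma P_add: "x \<in> P \<Longrightarrow> y \<in> P \<Longrightarrow> x + y \<in> P"
  using prime_ideal by (auto simp: prime_ideal_of_def ideal_of_def)

lemma P_mult: "r \<in> R \<Longrightarrow> x \<in> P \<Longrightarrow> r * x \<in> P"
  using prime_ideal by (auto simp: prime_ideal_of_def ideal_of_def)

lemma P_mult2: "r \<in> R \<Longrightarrow> x \<in> P \<Longrightarrow> x * r \<in> P"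
  using P_mult[of r x] by (simp add: mult.commute)

lemma P_minus: "x \<in> P \<Longrightarrow> - x \<in> P"
  using P_mult[of "-1" x] int_subringD[OF R] by simp

lemma P_diff: "x \<in> P \<Longrightarrow> y \<in> P \<Longrightarrow> x - y \<in> P"
  using P_add[of x "-y"] P_minus by simp

lemma P_sum: "(\<And>i. i \<in> A \<Longrightarrow> f i \<in> P) \<Longrightarrow> (\<Sum>i\<in>A. f i) \<in> P"
  by (induction A rule: infinite_finite_induct) (auto intro: P_add P_zero)

lemma P_prime: "x \<in> R \<Longrightarrow> y \<in> R \<Longrightarrow> x * y \<in> P \<Longrightarrow> x \<in> P \<or> y \<in> P"
  using prime_ideal by (auto simp: prime_ideal_of_def)

lemma P_one: "1 \<notin> P"
proof
  assume "1 \<in> P"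
  then have "R \<subseteq> P" using P_mult[of _ 1] by auto
  then show False using prime_ideal P_R by (auto simp: prime_ideal_of_def)
qed

lemma P_power: "x \<in> R \<Longrightarrow> x ^ k \<in> P \<Longrightarrow> x \<in> P"
  by (induction k) (auto simp: P_one dest: P_prime intro: int_subring_power[OF R])

lemma P_prod:
  assumes "finite A" "\<And>i. i \<in> A \<Longrightarrow> f i \<in> R" "(\<Prod>i\<in>A. f i) \<in> P"
  shows "\<exists>i\<in>A. f i \<in> P"
  using assms
proof (induction A rule: finite_induct)
  case (insert a A)
  then have "f a * (\<Prod>i\<in>A. f i) \<in> P" by simp
  then have "f a \<in> P \<or> (\<Prod>i\<in>A. f i) \<in> P"
    by (intro P_prime int_subring_prod[OF R]) (use insert in auto)
  then show ?case using insert by auto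
qed (use P_one in auto)

lemma P_int:
  assumes q: "prime q" "of_nat q \<in> P" and k: "of_int k \<in> P"
  shows "int q dvd k"
proof (rule ccontr)
  assume "\<not> int q dvd k"
  then have "coprime (int q) k" using q by (simp add: prime_imp_coprime)
  then obtain u v where "u * int q + v * k = 1"
    by (metis bezout_int coprime_iff_gcd_eq_1)
  then have "of_int (u * int q + v * k) = (1::complex)" by simp
  then have "of_int u * of_nat q + of_int v * of_int k = (1::complex)" by simp
  moreover have "of_int u * of_nat q + of_int v * of_int k \<in> P"
    using q k by (intro P_add P_mult int_subring_of_int[OF R])
  ultimately show False using P_one by simp
qed

lemma P_of_int_dvd:
  assumes "of_nat q \<in> P" "int q dvd k"
  shows "of_int k \<in> P"
proof -
  obtain m where "k = int q * m" using assms by blast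
  then show ?thesis using P_mult[OF int_subring_of_int[OF R, of m] assms(1)] by (simp add: mult.commute)
qed

lemma P_poly_cong:
  assumes "of_nat q \<in> P" "\<And>i. int q dvd coeff f i - coeff g i" "x \<in> R"
  shows "poly (map_poly of_int f) x - poly (map_poly of_int g) x \<in> P"
proof -
  have "poly (map_poly of_int f) x - poly (map_poly of_int g) x = poly (map_poly of_int (f - g)) x"
    by (simp add: of_int_poly_hom.hom_minus)
  also have "\<dots> \<in> P"
    unfolding poly_altdef
    by (intro P_sum P_mult2 int_subring_power[OF R] assms) (use P_of_int_dvd[OF assms(1,2)] in \<open>simp add: coeff_map_poly\<close>)
  finally show ?thesis .
qed

end

text \<open>Zorn's lemma gives an ideal maximal among those that contain \<open>q\<close> but not 1;
  such ideals exist because 1/q is not an algebraic integer. Maximality makes it prime, without any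
  finiteness property of \<open>R\<close>.\<close>

lemma prime_ideal_exists:
  assumes R: "int_subring R" and q: "prime q"
  obtains P where "prime_ideal_of R P" "of_nat q \<in> P"
proof -
  note r = int_subringD[OF R]
  have nat_R: "of_nat q \<in> R" by (rule int_subring_of_nat[OF R])
  define A where "A = {I. ideal_of R I \<and> of_nat q \<in> I \<and> 1 \<notin> I}"
  have "\<exists>M\<in>A. \<forall>X\<in>A. M \<subseteq> X \<longrightarrow> X = M"
  proof (rule subset_Zorn_nonempty)
    define I0 where "I0 = {of_nat q * x | x. x \<in> R}"
    have "1 \<notin> I0"
    proof
      assume "1 \<in> I0"
      then obtain x where x: "x \<in> R" "of_nat q * x = 1" by (auto simp: I0_def)
      then have x': "x = 1 / of_nat q" using q by (simp add: field_simps prime_gt_0_nat)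
      then have "x \<in> \<rat>" by simp
      then have "x \<in> \<int>" using rational_algebraic_int_is_int r(3)[OF x(1)] by blast
      then obtain z where "x = of_int z" by (auto simp: Ints_def)
      with x have "of_int (int q * z) = (of_int 1 :: complex)" by simp
      then have "int q * z = 1" by (simp only: of_int_eq_iff)
      then have "int q dvd 1" by (metis dvd_triv_left)
      then show False using q by (simp add: prime_nat_iff)
    qed
    moreover have "ideal_of R I0"
      unfolding ideal_of_def
    proof (intro conjI ballI)
      show "I0 \<subseteq> R" using nat_R r by (auto simp: I0_def)
      show "0 \<in> I0" unfolding I0_def using r(2) by force
      fix x y assume "x \<in> I0" "y \<in> I0"
      then show "x + y \<in> I0" using r(4) by (auto simp: I0_def distrib_left[symmetric])
    next
      fix s x assume s: "s \<in> R" "x \<in> I0"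
      then obtain y where "x = of_nat q * y" "y \<in> R" by (auto simp: I0_def)
      then have "s * x = of_nat q * (s * y)" "s * y \<in> R" using s r by auto
      then show "s * x \<in> I0" by (auto simp: I0_def)
    qed
    moreover have "of_nat q \<in> I0" unfolding I0_def using r(1) by force
    ultimately show "A \<noteq> {}" unfolding A_def by blast
  next
    fix C assume C: "C \<noteq> {}" "subset.chain A C"
    have CA: "\<And>I. I \<in> C \<Longrightarrow> I \<in> A" and ch: "\<And>I J. I \<in> C \<Longrightarrow> J \<in> C \<Longrightarrow> I \<subseteq> J \<or> J \<subseteq> I"
      using C(2) by (auto simp: subset.chain_def)
    have id: "\<And>I. I \<in> C \<Longrightarrow> ideal_of R I" using CA by (auto simp: A_def)
    have "ideal_of R (\<Union>C)"
      unfolding ideal_of_def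
    proof (intro conjI ballI)
      show "\<Union>C \<subseteq> R" using id by (intro Sup_least) (auto simp: ideal_of_def)
      show "0 \<in> \<Union>C" using id C(1) by (auto simp: ideal_of_def)
      fix x y assume "x \<in> \<Union>C" "y \<in> \<Union>C"
      then obtain I J where IJ: "I \<in> C" "J \<in> C" "x \<in> I" "y \<in> J" by blast
      then show "x + y \<in> \<Union>C"
        using ch[OF IJ(1,2)] id[OF IJ(1)] id[OF IJ(2)] unfolding ideal_of_def by blast
    next
      fix s x assume "s \<in> R" "x \<in> \<Union>C"
      then show "s * x \<in> \<Union>C" using id unfolding ideal_of_def by blast
    qed
    then show "\<Union>C \<in> A" using CA C(1) by (auto simp: A_def)
  qed
  then obtain P where P: "P \<in> A" "\<And>X. X \<in> A \<Longrightarrow> P \<subseteq> X \<Longrightarrow> X = P" by blast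
  have idP: "ideal_of R P" and qP: "of_nat q \<in> P" and oneP: "1 \<notin> P" using P(1) by (auto simp: A_def)
  have PR: "P \<subseteq> R" and P0: "0 \<in> P" and Padd: "\<And>x y. x \<in> P \<Longrightarrow> y \<in> P \<Longrightarrow> x + y \<in> P"
    and Pmult: "\<And>s x. s \<in> R \<Longrightarrow> x \<in> P \<Longrightarrow> s * x \<in> P"
    using idP by (auto simp: ideal_of_def)
  have witness: "\<exists>p\<in>P. \<exists>s\<in>R. p + s * x = 1" if x: "x \<in> R" "x \<notin> P" for x
  proof (rule ccontr)
    assume no: "\<not> ?thesis"
    define J where "J = {p + s * x | p s. p \<in> P \<and> s \<in> R}"
    have sub: "P \<subseteq> J"
    proof
      fix p assume "p \<in> P"
      then have "p = p + 0 * x" "p \<in> P" by auto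
      then show "p \<in> J" unfolding J_def using r(2) by blast
    qed
    have xJ: "x \<in> J"
    proof -
      have "x = 0 + 1 * x" by simp
      then show ?thesis unfolding J_def using r(1) P0 by blast
    qed
    have "ideal_of R J"
      unfolding ideal_of_def
    proof (intro conjI ballI)
      show "J \<subseteq> R" unfolding J_def using PR r x by auto
      show "0 \<in> J" using sub P0 by blast
      fix y z assume "y \<in> J" "z \<in> J"
      then obtain p s p' s' where *: "y = p + s * x" "z = p' + s' * x" "p \<in> P" "p' \<in> P" "s \<in> R" "s' \<in> R"
        unfolding J_def by blast
      have "y + z = (p + p') + (s + s') * x" using * by (simp add: algebra_simps)
      then show "y + z \<in> J" unfolding J_def using * Padd r(4) by blast
    next
      fix t y assume t: "t \<in> R" "y \<in> J"
      then obtain p s where *: "y = p + s * x" "p \<in> P" "s \<in> R" unfolding J_def by blast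
      have "t * y = t * p + (t * s) * x" using * by (simp add: algebra_simps)
      then show "t * y \<in> J" unfolding J_def using * t Pmult r(5) by blast
    qed
    moreover have "1 \<notin> J" using no unfolding J_def by force
    ultimately have "J \<in> A" using qP sub by (auto simp: A_def)
    then have "J = P" using P(2) sub by blast
    then show False using xJ x by simp
  qed
  have "prime_ideal_of R P"
    unfolding prime_ideal_of_def
  proof (intro conjI ballI impI)
    show "ideal_of R P" by (fact idP)
    show "P \<noteq> R" using oneP r(1) by blast
    show "P \<noteq> {0}" using qP q by (auto simp: prime_nat_iff)
    fix x y assume xy: "x \<in> R" "y \<in> R" "x * y \<in> P"
    show "x \<in> P \<or> y \<in> P"
    proof (rule ccontr)
      assume "\<not> ?thesis"
      then obtain p s where ps: "p \<in> P" "s \<in> R" "p + s * x = 1" using witness[OF xy(1)] by blast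
      have "y = y * (p + s * x)" using ps by simp
      also have "\<dots> = y * p + s * (x * y)" by (simp add: algebra_simps)
      also have "\<dots> \<in> P" by (rule Padd[OF Pmult[OF xy(2) ps(1)] Pmult[OF ps(2) xy(3)]])
      finally show False using \<open>\<not> (x \<in> P \<or> y \<in> P)\<close> by blast
    qed
  qed
  then show ?thesis using qP by (rule that)
qed

section \<open>Power sums and discriminants\<close>

text \<open>The power sums \<open>p\<^sub>k\<close> of \<open>n\<close> elements in terms of \<open>c\<^sub>i = (-1)\<^sup>i e\<^sub>i\<close>, by Newton's identities. The
  discriminant is then the Hankel determinant of the \<open>p\<^sub>i\<^sub>+\<^sub>j\<close>: this makes it a polynomial in the
  coefficients over every ring, so that it commutes with ring homomorphisms.\<close>
fun newton_psum :: "nat \<Rightarrow> (nat \<Rightarrow> 'a::comm_ring_1) \<Rightarrow> nat \<Rightarrow> 'a" where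
  "newton_psum n c 0 = of_nat n"
| "newton_psum n c (Suc k) = - (of_nat (Suc k) * c (Suc k)) - (\<Sum>j<k. c (Suc j) * newton_psum n c (k - j))"

lemma (in comm_ring_hom) hom_newton_psum:
  "hom (newton_psum n c k) = newton_psum n (\<lambda>i. hom (c i)) k"
proof (induction k rule: less_induct)
  case (less k)
  then show ?case
    by (cases k) (simp_all add: hom_distribs)
qed

text \<open>Induction on the number of elements. Adjoining \<open>b\<close> multiplies the
  polynomial by 1 - b X, so that the new coefficients are \<open>c n (Suc j) - b * c n j\<close>;
  the powers of \<open>b\<close> in the new power sums then telescope.\<close>

lemma newton_identities:
  fixes a :: "nat \<Rightarrow> 'a::comm_ring_1"
  defines "c \<equiv> \<lambda>n. coeff (\<Prod>i<n. [:1, - a i:])"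
  defines "p \<equiv> \<lambda>n k. \<Sum>i<n. a i ^ k"
  shows "(\<Sum>j<k. c n j * p n (k - j)) + of_nat k * c n k = 0"
proof (induction n arbitrary: k)
  case 0
  show ?case by (cases k) (auto simp: c_def p_def)
next
  case (Suc n)
  define b where "b = a n"
  have cS: "c (Suc n) (Suc j) = c n (Suc j) - b * c n j" for j
    by (simp add: c_def b_def mult.commute[of _ "[:1, - a n:]"])
  have c0: "c (Suc n) 0 = c n 0"
    by (simp add: c_def mult.commute[of _ "[:1, - a n:]"])
  have pS: "p (Suc n) j = p n j + b ^ j" for j by (simp add: p_def b_def)
  show ?case
  proof (cases k)
    case 0
    then show ?thesis by simp
  next
    case (Suc m)
    have IH1: "(\<Sum>j<Suc m. c n j * p n (Suc m - j)) = - (of_nat (Suc m) * c n (Suc m))"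
      using Suc.IH[of "Suc m"] by (simp add: eq_neg_iff_add_eq_0)
    have IH2: "(\<Sum>j<m. c n j * p n (m - j)) = - (of_nat m * c n m)"
      using Suc.IH[of m] by (simp add: eq_neg_iff_add_eq_0)
    have tel: "c n 0 * b ^ (Suc m) + (\<Sum>j<m. (c n (Suc j) - b * c n j) * b ^ (m - j)) = b * c n m"
    proof -
      have "c n 0 * b ^ (Suc m) + (\<Sum>j<l. (c n (Suc j) - b * c n j) * b ^ (m - j)) = b ^ Suc (m - l) * c n l"
        if "l \<le> m" for l using that
      proof (induction l)
        case (Suc l)
        then have e: "m - l = Suc (m - Suc l)" by simp
        have "c n 0 * b ^ (Suc m) + (\<Sum>j<Suc l. (c n (Suc j) - b * c n j) * b ^ (m - j))
           = b ^ Suc (m - l) * c n l + (c n (Suc l) - b * c n l) * b ^ (m - l)"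
          using Suc by (simp add: add.assoc[symmetric] del: power_Suc)
        also have "\<dots> = b ^ (m - l) * c n (Suc l)"
          by (simp add: algebra_simps)
        finally show ?case using e by simp
      qed (simp add: mult.commute)
      from this[of m] show ?thesis by simp
    qed
    have "(\<Sum>j<Suc m. c (Suc n) j * p (Suc n) (Suc m - j))
        = c n 0 * (p n (Suc m) + b ^ Suc m) + (\<Sum>j<m. (c n (Suc j) - b * c n j) * (p n (m - j) + b ^ (m - j)))"
      by (subst sum.lessThan_Suc_shift) (simp add: cS c0 pS del: power_Suc)
    also have "\<dots> = (c n 0 * p n (Suc m) + (\<Sum>j<m. c n (Suc j) * p n (m - j)))
        - b * (\<Sum>j<m. c n j * p n (m - j))
        + (c n 0 * b ^ Suc m + (\<Sum>j<m. (c n (Suc j) - b * c n j) * b ^ (m - j)))"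
      by (simp add: algebra_simps sum.distrib sum_subtractf sum_distrib_left del: power_Suc)
    also have "c n 0 * p n (Suc m) + (\<Sum>j<m. c n (Suc j) * p n (m - j)) = (\<Sum>j<Suc m. c n j * p n (Suc m - j))"
      by (subst sum.lessThan_Suc_shift) simp
    also have "\<dots> - b * (\<Sum>j<m. c n j * p n (m - j))
        + (c n 0 * b ^ Suc m + (\<Sum>j<m. (c n (Suc j) - b * c n j) * b ^ (m - j)))
        = - (of_nat (Suc m) * c n (Suc m)) - b * - (of_nat m * c n m) + b * c n m"
      unfolding IH1 IH2 tel ..
    finally show ?thesis
      unfolding Suc cS by (simp add: algebra_simps)
  qed
qed

lemma newton_psum_roots:
  fixes a :: "nat \<Rightarrow> 'a::comm_ring_1"
  shows "newton_psum n (coeff (\<Prod>i<n. [:1, - a i:])) k = (\<Sum>i<n. a i ^ k)"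
proof (induction k rule: less_induct)
  case (less k)
  let ?c = "coeff (\<Prod>i<n. [:1, - a i:])"
  have c0: "?c 0 = 1"
    by (induction n) (simp_all add: coeff_mult)
  show ?case
  proof (cases k)
    case (Suc m)
    have "(\<Sum>j<Suc m. ?c j * (\<Sum>i<n. a i ^ (Suc m - j))) + of_nat (Suc m) * ?c (Suc m) = 0"
      by (rule newton_identities)
    then have "(\<Sum>i<n. a i ^ Suc m) + (\<Sum>j<m. ?c (Suc j) * (\<Sum>i<n. a i ^ (m - j))) + of_nat (Suc m) * ?c (Suc m) = 0"
      by (subst (asm) sum.lessThan_Suc_shift) (simp add: c0 del: power_Suc)
    then have "(\<Sum>i<n. a i ^ Suc m) = - (of_nat (Suc m) * ?c (Suc m)) - (\<Sum>j<m. ?c (Suc j) * (\<Sum>i<n. a i ^ (m - j)))"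
      by (simp add: eq_neg_iff_add_eq_0 algebra_simps del: power_Suc)
    also have "\<dots> = newton_psum n ?c (Suc m)"
      using less Suc by simp
    finally show ?thesis using Suc by simp
  qed simp
qed

text \<open>As a polynomial in its last node, the determinant has degree at most \<open>n\<close>,
  vanishes at the other nodes and has the smaller determinant as its coefficient of X^n. This
  determines it when the other nodes are distinct; when two of them agree, both sides are
  zero.\<close>

lemma det_vandermonde:
  fixes a :: "nat \<Rightarrow> complex"
  shows "det (mat n n (\<lambda>(i,j). a i ^ j)) = (\<Prod>j<n. \<Prod>i<j. a j - a i)"
proof (induction n)
  case 0
  show ?case by (simp add: det_dim_zero)
next
  case (Suc n)
  let ?V = "\<lambda>r. mat (Suc n) (Suc n) (\<lambda>(i,j). (if i = n then r else a i) ^ j) :: complex mat"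
  define C where "C = (\<lambda>j. cofactor (?V 0) n j)"
  have C: "cofactor (?V r) n j = C j" for r j
    unfolding cofactor_def C_def by (intro arg_cong2[of _ _ _ _ "(*)"] arg_cong[of _ _ det] refl eq_matI) (auto simp: mat_delete_def)
  define Q where "Q = (\<Sum>j<Suc n. monom (C j) j)"
  have Q: "det (?V r) = poly Q r" for r
  proof -
    have "det (?V r) = (\<Sum>j<Suc n. ?V r $$ (n,j) * cofactor (?V r) n j)"
      by (rule laplace_expansion_row) auto
    also have "\<dots> = poly Q r" unfolding Q_def C by (simp add: poly_sum poly_monom mult.commute)
    finally show ?thesis .
  qed
  have V: "mat (Suc n) (Suc n) (\<lambda>(i,j). a i ^ j) = ?V (a n)" by (intro eq_matI) auto
  have root: "poly Q (a i) = 0" if "i < n" for i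
    unfolding Q[symmetric]
  proof (rule det_identical_rows[of _ "Suc n" i n])
    show "row (?V (a i)) i = row (?V (a i)) n"
      using that by (intro eq_vecI) auto
  qed (use that in auto)
  have "mat_delete (?V 0) n n = mat n n (\<lambda>(i,j). a i ^ j)"
    by (intro eq_matI) (auto simp: mat_delete_def)
  then have Cn: "C n = (\<Prod>j<n. \<Prod>i<j. a j - a i)"
    unfolding C_def cofactor_def Suc[symmetric] by simp
  show ?case
  proof (cases "inj_on a {..<n}")
    case True
    define p where "p = Q - smult (C n) (\<Prod>i<n. [:- a i, 1:])"
    have degQ: "degree Q \<le> n" unfolding Q_def
      by (rule degree_sum_le) (auto intro: order.trans[OF degree_monom_le])
    have dp: "degree (\<Prod>i<n. [:- a i, 1:]) = n"
      by (subst degree_prod_eq_sum_degree) auto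
    have "p = 0"
    proof (rule ccontr)
      assume p0: "p \<noteq> 0"
      have "coeff Q n = C n" unfolding Q_def by (simp add: coeff_sum)
      moreover have "coeff (\<Prod>i<n. [:- a i, 1:]) n = 1"
        using lead_coeff_prod[of "\<lambda>i. [:- a i, 1:]" "{..<n}"] dp by simp
      ultimately have "coeff p n = 0" by (simp add: p_def)
      moreover have "degree p \<le> n" unfolding p_def
        by (intro degree_diff_le degQ order.trans[OF degree_smult_le]) (simp add: dp)
      ultimately have "degree p < n \<or> n = 0"
        by (metis le_neq_implies_less leading_coeff_0_iff p0 neq0_conv)
      moreover have "n \<noteq> 0"
      proof
        assume "n = 0"
        then have "degree p = 0" "coeff p 0 = 0" using \<open>degree p \<le> n\<close> \<open>coeff p n = 0\<close> by auto
        then show False using p0 by (metis leading_coeff_0_iff)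
      qed
      ultimately have "degree p < n" by simp
      moreover have "a ` {..<n} \<subseteq> {x. poly p x = 0}"
        by (auto simp: p_def root poly_prod)
      then have "card (a ` {..<n}) \<le> card {x. poly p x = 0}"
        by (intro card_mono poly_roots_finite p0)
      ultimately show False
        using card_poly_roots_bound[OF p0] card_image[OF True] by simp
    qed
    then have "poly Q (a n) = C n * (\<Prod>i<n. a n - a i)"
      by (simp add: p_def poly_prod)
    then show ?thesis unfolding V Q by (simp add: Cn)
  next
    case False
    then obtain i j where ij: "i < j" "j < n" "a i = a j"
      by (auto simp: inj_on_def) (metis linorder_neqE_nat)
    have "det (?V (a n)) = 0"
    proof (rule det_identical_rows[of _ "Suc n" i j])
      show "row (?V (a n)) i = row (?V (a n)) j"
        using ij by (intro eq_vecI) auto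
    qed (use ij in auto)
    moreover have "(\<Prod>i<j. a j - a i) = 0" by (rule prod_zero) (use ij in \<open>auto intro!: bexI[of _ i]\<close>)
    then have "(\<Prod>j<n. \<Prod>i<j. a j - a i) = 0" using ij(2) by auto
    ultimately show ?thesis unfolding V by simp
  qed
qed

definition disc_coeffs :: "nat \<Rightarrow> (nat \<Rightarrow> 'a::comm_ring_1) \<Rightarrow> 'a" where
  "disc_coeffs n c = det (mat n n (\<lambda>(i,j). newton_psum n c (i + j)))"

lemma (in comm_ring_hom) hom_disc_coeffs:
  "hom (disc_coeffs n c) = disc_coeffs n (\<lambda>i. hom (c i))"
proof -
  have "map_mat hom (mat n n (\<lambda>(i,j). newton_psum n c (i + j)))
      = mat n n (\<lambda>(i,j). newton_psum n (\<lambda>i. hom (c i)) (i + j))"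
    by (intro eq_matI) (auto simp: hom_newton_psum)
  then show ?thesis unfolding disc_coeffs_def hom_det[symmetric] by simp
qed

definition discr :: "'a::comm_ring_1 poly \<Rightarrow> 'a" where
  "discr F = disc_coeffs (degree F) (coeff (reflect_poly F))"

text \<open>The Hankel matrix of the power sums is the transposed Vandermonde matrix times the
  Vandermonde matrix.\<close>

lemma discr_roots:
  fixes a :: "nat \<Rightarrow> complex"
  shows "discr (\<Prod>i<n. [:- a i, 1:]) = (\<Prod>j<n. \<Prod>i<j. a j - a i)\<^sup>2"
proof -
  let ?V = "mat n n (\<lambda>(i,j). a i ^ j)"
  have dp: "degree (\<Prod>i<n. [:- a i, 1:]) = n"
    by (subst degree_prod_eq_sum_degree) auto
  have refl: "reflect_poly (\<Prod>i<n. [:- a i, 1:]) = (\<Prod>i<n. [:1, - a i:])"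
    by (subst reflect_poly_prod) (intro prod.cong refl, simp add: reflect_poly_def)
  have "mat n n (\<lambda>(i,j). \<Sum>k<n. a k ^ (i + j)) = transpose_mat ?V * ?V"
    by (intro eq_matI) (auto simp: scalar_prod_def power_add atLeast0LessThan)
  then have "discr (\<Prod>i<n. [:- a i, 1:]) = det (transpose_mat ?V * ?V)"
    unfolding discr_def disc_coeffs_def dp refl newton_psum_roots by simp
  also have "\<dots> = det ?V * det ?V"
    by (subst det_mult[of _ n]) (auto simp: det_transpose[of _ n])
  finally show ?thesis by (simp add: det_vandermonde power2_eq_square)
qed

lemma discr_of_int:
  fixes F :: "int poly"
  shows "discr (map_poly of_int F :: complex poly) = of_int (discr F)"
  unfolding discr_def of_int_hom.hom_disc_coeffs
  by (auto simp: coeff_reflect_poly intro!: arg_cong[of _ _ "disc_coeffs _"])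

locale monic_split =
  fixes F :: "int poly" and n :: nat and \<alpha> :: "nat \<Rightarrow> complex"
  assumes split: "map_poly of_int F = (\<Prod>i\<in>{1..n}. [:- \<alpha> i, 1:])"
begin

lemma split': "map_poly of_int F = (\<Prod>i<n. [:- \<alpha> (Suc i), 1:])"
  unfolding split using prod.atLeast1_atMost_eq by auto

lemma monic_F: "lead_coeff F = 1"
proof -
  have "lead_coeff (map_poly of_int F :: complex poly) = 1"
    unfolding split by (subst lead_coeff_prod) auto
  then show ?thesis by simp
qed

lemma poly_F: "poly (map_poly of_int F) x = (\<Prod>i\<in>{1..n}. x - \<alpha> i)"
  unfolding split by (simp add: poly_prod)

lemma alg_int_root: "i \<in> {1..n} \<Longrightarrow> algebraic_int (\<alpha> i)"
  unfolding algebraic_int_altdef_ipoly using poly_F[of "\<alpha> i"] monic_F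
  by (intro exI[of _ F]) auto

lemma discr_F: "of_int (discr F) = (\<Prod>j<n. \<Prod>i<j. \<alpha> (Suc j) - \<alpha> (Suc i))\<^sup>2"
  using discr_roots[of "\<lambda>i. \<alpha> (Suc i)" n] by (simp add: discr_of_int[symmetric] split')

lemma poly_pderiv_root:
  assumes i: "i \<in> {1..n}"
  shows "poly (map_poly of_int (pderiv F)) (\<alpha> i) = (\<Prod>j\<in>{1..n}-{i}. \<alpha> i - \<alpha> j)"
proof -
  define G where "G = (\<Prod>j\<in>{1..n}-{i}. [:- \<alpha> j, 1:])"
  have "map_poly of_int F = [:- \<alpha> i, 1:] * G"
    unfolding split G_def using i by (simp add: prod.remove)
  then have "pderiv (map_poly of_int F) = G + [:- \<alpha> i, 1:] * pderiv G"
    by (simp only: pderiv_mult) (simp add: pderiv_pCons)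
  then have "poly (pderiv (map_poly of_int F)) (\<alpha> i) = poly G (\<alpha> i)" by simp
  moreover have "pderiv (map_poly of_int F) = (map_poly of_int (pderiv F) :: complex poly)"
    by (intro poly_eqI) (simp add: coeff_pderiv coeff_map_poly)
  ultimately show ?thesis by (simp add: G_def poly_prod)
qed

lemma discr_dvd_root_diff:
  assumes "i \<in> {1..n}" "j \<in> {1..n}" "i \<noteq> j"
  shows "\<exists>z. algebraic_int z \<and> of_int (discr F) = (\<alpha> i - \<alpha> j) * z"
proof -
  have *: "\<exists>z. algebraic_int z \<and> of_int (discr F) = (\<alpha> i - \<alpha> j) * z"
    if ij: "i \<in> {1..n}" "j \<in> {1..n}" "j < i" for i j
  proof -
    obtain i' j' where i': "i = Suc i'" "j = Suc j'" "i' < n" "j' < i'"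
      using ij by (cases i; cases j) auto
    let ?f = "\<lambda>j. \<Prod>i<j. \<alpha> (Suc j) - \<alpha> (Suc i)"
    let ?V = "\<Prod>j<n. ?f j"
    define z1 where "z1 = (\<Prod>k\<in>{..<n}-{i'}. ?f k) * (\<Prod>k\<in>{..<i'}-{j'}. \<alpha> (Suc i') - \<alpha> (Suc k))"
    have a: "algebraic_int (\<alpha> (Suc k))" if "k < n" for k using alg_int_root[of "Suc k"] that by auto
    have fi: "?f i' = (\<alpha> (Suc i') - \<alpha> (Suc j')) * (\<Prod>k\<in>{..<i'}-{j'}. \<alpha> (Suc i') - \<alpha> (Suc k))"
      by (rule prod.remove) (use i' in auto)
    have "?V = ?f i' * (\<Prod>k\<in>{..<n}-{i'}. ?f k)"
      by (rule prod.remove) (use i' in auto)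
    then have "?V = (\<alpha> i - \<alpha> j) * z1"
      unfolding z1_def fi i'(1,2) by (simp add: mult_ac)
    then have "of_int (discr F) = (\<alpha> i - \<alpha> j) * (z1 * ?V)"
      unfolding discr_F by (simp add: power2_eq_square mult_ac)
    moreover have "algebraic_int (z1 * ?V)"
      unfolding z1_def using i' by (intro algebraic_int_mult algebraic_int_prod algebraic_int_diff a) auto
    ultimately show ?thesis by blast
  qed
  show ?thesis
  proof (cases "j < i")
    case True
    then show ?thesis using * assms by blast
  next
    case False
    then have "i < j" using assms by simp
    then obtain z where "algebraic_int z" "of_int (discr F) = (\<alpha> j - \<alpha> i) * z" using * assms by blast
    then have "algebraic_int (-z)" "of_int (discr F) = (\<alpha> i - \<alpha> j) * (-z)" by (auto simp: algebra_simps)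
    then show ?thesis by blast
  qed
qed

lemma discr_eq_0_iff: "discr F = 0 \<longleftrightarrow> \<not> inj_on \<alpha> {1..n}"
proof
  assume "discr F = 0"
  then have "(\<Prod>j<n. \<Prod>i<j. \<alpha> (Suc j) - \<alpha> (Suc i)) = 0"
    using discr_F by (simp add: power2_eq_square)
  then obtain i j where "j < n" "i < j" "\<alpha> (Suc j) = \<alpha> (Suc i)" by auto
  then show "\<not> inj_on \<alpha> {1..n}" unfolding inj_on_def by (intro notI) (force dest: bspec[of _ _ "Suc i"] bspec[of _ _ "Suc j"])
next
  assume "\<not> inj_on \<alpha> {1..n}"
  then obtain i j where "i \<in> {1..n}" "j \<in> {1..n}" "i \<noteq> j" "\<alpha> i = \<alpha> j" by (auto simp: inj_on_def)
  then show "discr F = 0" using discr_dvd_root_diff[of i j] by auto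
qed

lemma roots_congruent_if_discr_in_prime:
  assumes "prime_ideal_in all_integers P" "of_int (discr F) \<in> P"
  shows "\<exists>i\<in>{1..n}. \<exists>j\<in>{1..n}. i \<noteq> j \<and> \<alpha> i - \<alpha> j \<in> P"
proof -
  interpret prime_ideal_in all_integers P by fact
  have a: "algebraic_int (\<alpha> (Suc k))" if "k < n" for k using alg_int_root[of "Suc k"] that by auto
  have "(\<Prod>j<n. \<Prod>i<j. \<alpha> (Suc j) - \<alpha> (Suc i)) \<in> P"
    using assms(2) unfolding discr_F
    by (rule P_power[of _ 2, rotated]) (auto intro!: algebraic_int_prod algebraic_int_diff a)
  moreover have alg: "algebraic_int (\<Prod>i<j. \<alpha> (Suc j) - \<alpha> (Suc i))" if "j < n" for j
    using that by (intro algebraic_int_prod algebraic_int_diff a) auto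
  ultimately obtain j where j: "j < n" "(\<Prod>i<j. \<alpha> (Suc j) - \<alpha> (Suc i)) \<in> P"
    using P_prod[of "{..<n}" "\<lambda>j. \<Prod>i<j. \<alpha> (Suc j) - \<alpha> (Suc i)"] by (force simp: alg)
  then obtain i where "i < j" "\<alpha> (Suc j) - \<alpha> (Suc i) \<in> P"
    using P_prod[of "{..<j}" "\<lambda>i. \<alpha> (Suc j) - \<alpha> (Suc i)"] j
    by (force intro!: algebraic_int_diff a)
  then show ?thesis using j by (intro bexI[of _ "Suc j"] bexI[of _ "Suc i"]) auto
qed

end

lemma monic_split_exists:
  fixes F :: "int poly"
  assumes "lead_coeff F = 1"
  obtains \<alpha> where "monic_split F (degree F) \<alpha>"
proof -
  let ?f = "map_poly of_int F :: complex poly"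
  obtain A where A: "size A = degree ?f" "?f = smult (lead_coeff ?f) (\<Prod>x\<in>#A. [:-x, 1:])"
    using alg_closed_imp_factorization[of ?f] assms by fastforce
  obtain xs where xs: "mset xs = A" using ex_mset by blast
  have len: "length xs = degree F" using A(1) xs by auto
  define \<alpha> where "\<alpha> = (\<lambda>i. xs ! (i - 1))"
  have "?f = (\<Prod>x\<leftarrow>xs. [:-x, 1:])"
    using A(2) assms unfolding xs[symmetric] by (simp add: prod_mset_prod_list[symmetric])
  also have "\<dots> = (\<Prod>i<degree F. [:- (xs ! i), 1:])"
    by (simp add: prod.list_conv_set_nth len atLeast0LessThan)
  also have "\<dots> = (\<Prod>i\<in>{1..degree F}. [:- \<alpha> i, 1:])"
    using prod.atLeast1_atMost_eq[of "\<lambda>i. [:- \<alpha> i, 1:]" "degree F"] by (simp add: \<alpha>_def)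
  finally have "monic_split F (degree F) \<alpha>" by unfold_locales
  then show ?thesis by (rule that)
qed

section \<open>The Galois group of a polynomial as a permutation group of its roots\<close>

context prime_ideal_in
begin

lemma P_freshman:
  assumes q: "prime q" "of_nat q \<in> P" and x: "x \<in> R" and y: "y \<in> R"
  shows "(x + y) ^ q - (x ^ q + y ^ q) \<in> P"
proof -
  have q0: "q > 0" using q prime_gt_0_nat by blast
  have "(x + y) ^ q = (\<Sum>k\<le>q. of_nat (q choose k) * x ^ k * y ^ (q - k))"
    by (rule binomial_ring)
  also have "{..q} = insert 0 (insert q {0<..<q})" using q0 by auto
  also have "(\<Sum>k\<in>\<dots>. of_nat (q choose k) * x ^ k * y ^ (q - k))
      = y ^ q + (x ^ q + (\<Sum>k\<in>{0<..<q}. of_nat (q choose k) * x ^ k * y ^ (q - k)))"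
    using q0 by simp
  finally have "(x + y) ^ q - (x ^ q + y ^ q) = (\<Sum>k\<in>{0<..<q}. of_nat (q choose k) * x ^ k * y ^ (q - k))"
    by simp
  also have "\<dots> \<in> P"
  proof (rule P_sum)
    fix k assume k: "k \<in> {0<..<q}"
    then have "q dvd (q choose k)" using q(1) by (intro dvd_choose_prime) auto
    then obtain m where "q choose k = q * m" by blast
    then have "of_nat (q choose k) * x ^ k * y ^ (q - k) = (of_nat m * x ^ k * y ^ (q - k)) * of_nat q"
      by (simp add: mult_ac)
    also have "\<dots> \<in> P"
      by (intro P_mult q int_subringD(5)[OF R] int_subring_power[OF R] int_subring_of_nat[OF R] x y)
    finally show "of_nat (q choose k) * x ^ k * y ^ (q - k) \<in> P" .
  qed
  finally show ?thesis .
qed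

lemma P_fermat:
  assumes q: "prime q" "of_nat q \<in> P"
  shows "of_int c ^ q - of_int c \<in> P"
proof -
  have nat: "(of_nat k :: complex) ^ q - of_nat k \<in> P" for k
  proof (induction k)
    case 0
    then show ?case using P_zero prime_gt_0_nat[OF q(1)] by (simp add: zero_power)
  next
    case (Suc k)
    have "(of_nat k + 1) ^ q - (of_nat k ^ q + 1 ^ q) \<in> P"
      by (intro P_freshman q int_subring_of_nat[OF R] int_subringD(1)[OF R])
    from P_add[OF this Suc] show ?case by (simp add: algebra_simps)
  qed
  define m where "m = nat (c mod int q)"
  have m: "int m = c mod int q" using q(1) prime_gt_0_nat by (simp add: m_def)
  have c: "[int m = c] (mod int q)" unfolding m by (simp add: cong_def)
  have "of_int (int m - c) \<in> P" "of_int (c ^ q - int m ^ q) \<in> P"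
    by (rule P_of_int_dvd[OF q(2)]; use c cong_pow[OF cong_sym[OF c], of q] in \<open>simp add: cong_iff_dvd_diff\<close>)+
  note d = this
  from P_add[OF P_add[OF d] nat[of m]] show ?thesis by simp
qed

lemma P_poly_frobenius:
  assumes q: "prime q" "of_nat q \<in> P" and x: "x \<in> R"
  shows "poly (map_poly of_int f) x ^ q - poly (map_poly of_int f) (x ^ q) \<in> P"
proof (induction f)
  case 0
  then show ?case using P_zero prime_gt_0_nat[OF q(1)] by (simp add: zero_power)
next
  case (pCons a f)
  let ?f = "\<lambda>x. poly (map_poly of_int f) x"
  have f: "?f x \<in> R" by (rule int_subring_poly[OF R x])
  have xf: "x * ?f x \<in> R" using f x int_subringD[OF R] by blast
  have "(of_int a + x * ?f x) ^ q - (of_int a ^ q + (x * ?f x) ^ q) \<in> P"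
    by (intro P_freshman q xf int_subring_of_int[OF R])
  moreover have "of_int a ^ q - of_int a \<in> P" by (rule P_fermat[OF q])
  moreover have "x ^ q * (?f x ^ q - ?f (x ^ q)) \<in> P"
    by (intro P_mult pCons.IH int_subring_power[OF R] x)
  ultimately have "((of_int a + x * ?f x) ^ q - (of_int a ^ q + (x * ?f x) ^ q)) + (of_int a ^ q - of_int a)
       + x ^ q * (?f x ^ q - ?f (x ^ q)) \<in> P"
    by (intro P_add)
  then show ?case
    by (simp add: of_int_hom.map_poly_pCons_hom power_mult_distrib algebra_simps)
qed

end

text \<open>A polynomial in the roots is encoded as the function taking a permutation \<open>\<rho>\<close> of the indices to
  the value of the polynomial after permuting the roots by \<open>\<rho>\<close>. Such functions, unlike elements of the
  splitting field, are acted on by all permutations, even before the Galois group is known.\<close>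
inductive_set root_fun :: "nat \<Rightarrow> (nat \<Rightarrow> complex) \<Rightarrow> complex set \<Rightarrow> ((nat \<Rightarrow> nat) \<Rightarrow> complex) set"
  for n \<alpha> K where
  const: "c \<in> K \<Longrightarrow> (\<lambda>_. c) \<in> root_fun n \<alpha> K"
| root: "i \<in> {1..n} \<Longrightarrow> (\<lambda>\<rho>. \<alpha> (\<rho> i)) \<in> root_fun n \<alpha> K"
| add: "b \<in> root_fun n \<alpha> K \<Longrightarrow> b' \<in> root_fun n \<alpha> K \<Longrightarrow> (\<lambda>\<rho>. b \<rho> + b' \<rho>) \<in> root_fun n \<alpha> K"
| mult: "b \<in> root_fun n \<alpha> K \<Longrightarrow> b' \<in> root_fun n \<alpha> K \<Longrightarrow> (\<lambda>\<rho>. b \<rho> * b' \<rho>) \<in> root_fun n \<alpha> K"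

lemma root_fun_mono: "b \<in> root_fun n \<alpha> K \<Longrightarrow> K \<subseteq> K' \<Longrightarrow> b \<in> root_fun n \<alpha> K'"
  by (induction rule: root_fun.induct) (auto intro: root_fun.intros)

lemma root_fun_compose:
  assumes "b \<in> root_fun n \<alpha> K" "\<tau> permutes {1..n}"
  shows "(\<lambda>\<rho>. b (\<rho> \<circ> \<tau>)) \<in> root_fun n \<alpha> K"
  using assms(1)
proof induction
  case (root i)
  then show ?case using root_fun.root[of "\<tau> i" n \<alpha> K] permutes_in_image[OF assms(2)] by simp
qed (auto intro: root_fun.intros)

lemma root_fun_sum:
  "0 \<in> K \<Longrightarrow> (\<And>x. x \<in> A \<Longrightarrow> f x \<in> root_fun n \<alpha> K) \<Longrightarrow> (\<lambda>\<rho>. \<Sum>x\<in>A. f x \<rho>) \<in> root_fun n \<alpha> K"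
  by (induction A rule: infinite_finite_induct) (auto intro: root_fun.intros)

lemma root_fun_prod:
  "1 \<in> K \<Longrightarrow> (\<And>x. x \<in> A \<Longrightarrow> f x \<in> root_fun n \<alpha> K) \<Longrightarrow> (\<lambda>\<rho>. \<Prod>x\<in>A. f x \<rho>) \<in> root_fun n \<alpha> K"
  by (induction A rule: infinite_finite_induct) (auto intro: root_fun.intros)

lemma root_fun_sum_list:
  "0 \<in> K \<Longrightarrow> (\<And>x. x \<in> set xs \<Longrightarrow> f x \<in> root_fun n \<alpha> K) \<Longrightarrow> (\<lambda>\<rho>. \<Sum>x\<leftarrow>xs. f x \<rho>) \<in> root_fun n \<alpha> K"
  by (induction xs) (auto intro: root_fun.intros)

lemma root_fun_power:
  "1 \<in> K \<Longrightarrow> b \<in> root_fun n \<alpha> K \<Longrightarrow> (\<lambda>\<rho>. b \<rho> ^ k) \<in> root_fun n \<alpha> K"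
  by (induction k) (auto intro: root_fun.intros)

lemma root_fun_uminus:
  "- 1 \<in> K \<Longrightarrow> b \<in> root_fun n \<alpha> K \<Longrightarrow> (\<lambda>\<rho>. - b \<rho>) \<in> root_fun n \<alpha> K"
  using root_fun.mult[OF root_fun.const[of "-1" K n \<alpha>], of b] by simp

lemma root_fun_diff:
  "- 1 \<in> K \<Longrightarrow> b \<in> root_fun n \<alpha> K \<Longrightarrow> b' \<in> root_fun n \<alpha> K \<Longrightarrow> (\<lambda>\<rho>. b \<rho> - b' \<rho>) \<in> root_fun n \<alpha> K"
  using root_fun.add[of b n \<alpha> K "\<lambda>\<rho>. - b' \<rho>"] root_fun_uminus[of K b' n \<alpha>] by simp

lemma root_fun_poly:
  assumes "0 \<in> K" "1 \<in> K" "\<And>i. coeff p i \<in> K" "b \<in> root_fun n \<alpha> K"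
  shows "(\<lambda>\<rho>. poly p (b \<rho>)) \<in> root_fun n \<alpha> K"
  unfolding poly_altdef
  by (intro root_fun_sum root_fun.mult root_fun_power root_fun.const assms)

lemma root_fun_coeff_prod:
  assumes "0 \<in> K" "1 \<in> K" "- 1 \<in> K" "finite A" "\<And>x. x \<in> A \<Longrightarrow> f x \<in> root_fun n \<alpha> K"
  shows "(\<lambda>\<rho>. coeff (\<Prod>x\<in>A. [:- f x \<rho>, 1:]) k) \<in> root_fun n \<alpha> K"
  using assms(4,5)
proof (induction A arbitrary: k rule: finite_induct)
  case empty
  then show ?case using assms by (cases "k = 0") (auto intro: root_fun.const)
next
  case (insert a A)
  let ?p = "\<lambda>\<rho>. \<Prod>x\<in>A. [:- f x \<rho>, 1:]"
  have p: "(\<lambda>\<rho>. coeff (?p \<rho>) k) \<in> root_fun n \<alpha> K" for k using insert by blast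
  have "(\<lambda>\<rho>. - f a \<rho> * coeff (?p \<rho>) k + (case k of 0 \<Rightarrow> 0 | Suc j \<Rightarrow> coeff (?p \<rho>) j)) \<in> root_fun n \<alpha> K"
    using assms p insert.prems
    by (intro root_fun.add root_fun.mult root_fun_uminus) (cases k; auto intro: root_fun.const)+
  then show ?case using insert by (simp add: coeff_pCons mult_ac)
qed

lemma root_fun_monomials:
  assumes "b \<in> root_fun n \<alpha> \<rat>"
  shows "\<exists>ms::(complex \<times> (nat \<Rightarrow> nat)) list. (\<forall>(c,e)\<in>set ms. c \<in> \<rat>) \<and>
     (\<forall>\<rho>. b \<rho> = (\<Sum>(c,e)\<leftarrow>ms. c * (\<Prod>i\<in>{1..n}. \<alpha> (\<rho> i) ^ e i)))"
  using assms
proof induction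
  case (const c)
  then show ?case by (intro exI[of _ "[(c, \<lambda>_. 0)]"]) simp
next
  case (root i)
  have "(\<Prod>j\<in>{1..n}. \<alpha> (\<rho> j) ^ (if j = i then 1 else 0)) = \<alpha> (\<rho> i)" for \<rho>
  proof -
    have "(\<Prod>j\<in>{1..n}. \<alpha> (\<rho> j) ^ (if j = i then 1 else 0)) = (\<Prod>j\<in>{1..n}. if j = i then \<alpha> (\<rho> j) else 1)"
      by (intro prod.cong) auto
    then show ?thesis using root by simp
  qed
  then show ?case by (intro exI[of _ "[(1, \<lambda>j. if j = i then 1 else 0)]"]) simp
next
  case (add b b')
  then obtain ms ms' where *: "(\<forall>(c,e)\<in>set ms. c \<in> \<rat>)" "(\<forall>(c,e)\<in>set ms'. c \<in> \<rat>)"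
     "\<And>\<rho>. b \<rho> = (\<Sum>(c,e)\<leftarrow>ms. c * (\<Prod>i\<in>{1..n}. \<alpha> (\<rho> i) ^ e i))"
     "\<And>\<rho>. b' \<rho> = (\<Sum>(c,e)\<leftarrow>ms'. c * (\<Prod>i\<in>{1..n}. \<alpha> (\<rho> i) ^ e i))" by blast
  then show ?case by (intro exI[of _ "ms @ ms'"]) auto
next
  case (mult b b')
  then obtain ms ms' where *: "(\<forall>(c,e)\<in>set ms. c \<in> \<rat>)" "(\<forall>(c,e)\<in>set ms'. c \<in> \<rat>)"
     "\<And>\<rho>. b \<rho> = (\<Sum>(c,e)\<leftarrow>ms. c * (\<Prod>i\<in>{1..n}. \<alpha> (\<rho> i) ^ e i))"
     "\<And>\<rho>. b' \<rho> = (\<Sum>(c,e)\<leftarrow>ms'. c * (\<Prod>i\<in>{1..n}. \<alpha> (\<rho> i) ^ e i))" by blast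
  define mm where "mm = (\<lambda>xs ys :: (complex \<times> (nat \<Rightarrow> nat)) list. concat (map (\<lambda>(c,e). map (\<lambda>(c',e'). (c * c', \<lambda>i. e i + e' i)) ys) xs))"
  have 1: "(\<Sum>(c',e')\<leftarrow>map (\<lambda>(c',e'). (c * c', \<lambda>i. e i + e' i)) ys. c' * (\<Prod>i\<in>{1..n}. \<alpha> (\<rho> i) ^ e' i))
     = (c * (\<Prod>i\<in>{1..n}. \<alpha> (\<rho> i) ^ e i)) * (\<Sum>(c',e')\<leftarrow>ys. c' * (\<Prod>i\<in>{1..n}. \<alpha> (\<rho> i) ^ e' i))"
    for c e \<rho> and ys :: "(complex \<times> (nat \<Rightarrow> nat)) list"
    by (induction ys) (auto simp: power_add prod.distrib algebra_simps)
  have "(\<Sum>(c,e)\<leftarrow>mm xs ys. c * (\<Prod>i\<in>{1..n}. \<alpha> (\<rho> i) ^ e i)) =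
    (\<Sum>(c,e)\<leftarrow>xs. c * (\<Prod>i\<in>{1..n}. \<alpha> (\<rho> i) ^ e i)) * (\<Sum>(c,e)\<leftarrow>ys. c * (\<Prod>i\<in>{1..n}. \<alpha> (\<rho> i) ^ e i))"
    for xs ys \<rho>
  proof (induction xs)
    case (Cons x xs)
    obtain c e where x: "x = (c, e)" by force
    have "mm (x # xs) ys = map (\<lambda>(c',e'). (c * c', \<lambda>i. e i + e' i)) ys @ mm xs ys"
      by (simp add: mm_def x)
    then show ?case using 1[where c = c and e = e and ys = ys] Cons by (simp add: x distrib_right)
  qed (simp add: mm_def)
  moreover have "\<forall>(c,e)\<in>set (mm ms ms'). c \<in> \<rat>" using *(1,2) by (force simp: mm_def)
  ultimately show ?case using *(3,4) by (intro exI[of _ "mm ms ms'"]) auto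
qed

section \<open>Symmetric functions of the roots\<close>

definition injective_lists :: "nat \<Rightarrow> nat \<Rightarrow> nat list set" where
  "injective_lists n m = {xs. length xs = m \<and> distinct xs \<and> set xs \<subseteq> {1..n}}"

lemma finite_injective_lists: "finite (injective_lists n m)"
  by (rule finite_subset[OF _ finite_lists_length_eq[of "{1..n}" m]]) (auto simp: injective_lists_def)

lemma sum_injective_lists_Suc:
  "(\<Sum>xs\<in>injective_lists n (Suc m). f xs) = (\<Sum>xs\<in>injective_lists n m. \<Sum>a\<in>{1..n} - set xs. f (a # xs))"
proof -
  have "(\<Sum>xs\<in>injective_lists n m. \<Sum>a\<in>{1..n} - set xs. f (a # xs))
      = (\<Sum>(xs,a)\<in>(SIGMA xs:injective_lists n m. {1..n} - set xs). f (a # xs))"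
    by (rule sum.Sigma) (auto intro: finite_injective_lists)
  also have "\<dots> = (\<Sum>xs\<in>injective_lists n (Suc m). f xs)"
    by (rule sum.reindex_bij_witness[of _ "\<lambda>ys. (tl ys, hd ys)" "\<lambda>(xs,a). a # xs"])
       (auto simp: injective_lists_def length_Suc_conv)
  finally show ?thesis ..
qed

context monic_split
begin

lemma power_sum_Ints: "(\<Sum>i\<in>{1..n}. \<alpha> i ^ k) \<in> \<int>"
proof -
  have refl: "reflect_poly (\<Prod>i<n. [:- \<alpha> (Suc i), 1:]) = (\<Prod>i<n. [:1, - \<alpha> (Suc i):])"
    by (subst reflect_poly_prod) (intro prod.cong refl, simp add: reflect_poly_def)
  have "(\<Sum>i\<in>{1..n}. \<alpha> i ^ k) = (\<Sum>i<n. \<alpha> (Suc i) ^ k)"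
    using sum.atLeast1_atMost_eq[of "\<lambda>i. \<alpha> i ^ k" n] by simp
  also have "\<dots> = newton_psum n (coeff (reflect_poly (map_poly of_int F))) k"
    unfolding split' refl newton_psum_roots ..
  also have "coeff (reflect_poly (map_poly of_int F)) = (\<lambda>i. of_int (coeff (reflect_poly F) i) :: complex)"
    by (auto simp: coeff_reflect_poly)
  also have "newton_psum n \<dots> k = of_int (newton_psum n (coeff (reflect_poly F)) k)"
    by (simp add: of_int_hom.hom_newton_psum)
  finally show ?thesis by simp
qed

text \<open>Split off the first exponent \<open>e\<close>. Summing over the indices outside
  \<open>xs\<close> gives a full power sum minus the terms whose index repeats an entry of
  \<open>xs\<close>, and such a repetition merely adds \<open>e\<close> to another exponent. Both
  parts involve shorter exponent lists, so everything reduces to power sums, which are integers by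
  Newton's identities.\<close>

lemma symmetric_monomial_Ints:
  "(\<Sum>xs\<in>injective_lists n (length es). \<Prod>i<length es. \<alpha> (xs ! i) ^ (es ! i)) \<in> \<int>"
proof (induction "length es" arbitrary: es)
  case 0
  then show ?case by simp
next
  case (Suc m)
  then obtain e es' where es: "es = e # es'" "length es' = m" by (cases es) auto
  let ?M = "\<lambda>xs es. \<Prod>i<m. \<alpha> (xs ! i) ^ (es ! i)"
  let ?p = "\<Sum>a\<in>{1..n}. \<alpha> a ^ e"
  have IH: "(\<Sum>xs\<in>injective_lists n m. ?M xs es) \<in> \<int>" if "length es = m" for es
    using Suc(1)[of es] that by simp
  have "(\<Sum>xs\<in>injective_lists n (length es). \<Prod>i<length es. \<alpha> (xs ! i) ^ (es ! i))
     = (\<Sum>xs\<in>injective_lists n m. \<Sum>a\<in>{1..n} - set xs. \<alpha> a ^ e * ?M xs es')"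
    by (simp add: es sum_injective_lists_Suc prod.lessThan_Suc_shift del: prod.lessThan_Suc)
  also have "\<dots> = (\<Sum>xs\<in>injective_lists n m. ?p * ?M xs es' - (\<Sum>j<m. ?M xs (es'[j := es' ! j + e])))"
  proof (rule sum.cong[OF refl])
    fix xs assume xs: "xs \<in> injective_lists n m"
    then have len: "length xs = m" and d: "distinct xs" and sub: "set xs \<subseteq> {1..n}" by (auto simp: injective_lists_def)
    have "(\<Sum>a\<in>{1..n} - set xs. \<alpha> a ^ e) = ?p - (\<Sum>a\<in>set xs. \<alpha> a ^ e)"
      using sub by (simp add: sum_diff)
    also have "(\<Sum>a\<in>set xs. \<alpha> a ^ e) = (\<Sum>j<m. \<alpha> (xs ! j) ^ e)"
      using sum.list_conv_set_nth[of "map (\<lambda>a. \<alpha> a ^ e) xs"] sum_list_distinct_conv_sum_set[OF d, of "\<lambda>a. \<alpha> a ^ e"] len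
      by (simp add: atLeast0LessThan)
    finally have "(\<Sum>a\<in>{1..n} - set xs. \<alpha> a ^ e * ?M xs es') = (?p - (\<Sum>j<m. \<alpha> (xs ! j) ^ e)) * ?M xs es'"
      unfolding sum_distrib_right[symmetric] by simp
    also have "\<dots> = ?p * ?M xs es' - (\<Sum>j<m. \<alpha> (xs ! j) ^ e * ?M xs es')"
      by (simp add: left_diff_distrib sum_distrib_right)
    also have "(\<Sum>j<m. \<alpha> (xs ! j) ^ e * ?M xs es') = (\<Sum>j<m. ?M xs (es'[j := es' ! j + e]))"
    proof (rule sum.cong[OF refl])
      fix j assume j: "j \<in> {..<m}"
      have "?M xs (es'[j := es' ! j + e]) = \<alpha> (xs ! j) ^ (es' ! j + e) * (\<Prod>i\<in>{..<m}-{j}. \<alpha> (xs ! i) ^ (es' ! i))"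
        using j es(2) by (subst prod.remove[of _ j]) (auto intro!: prod.cong)
      moreover have "?M xs es' = \<alpha> (xs ! j) ^ (es' ! j) * (\<Prod>i\<in>{..<m}-{j}. \<alpha> (xs ! i) ^ (es' ! i))"
        using j by (subst prod.remove[of _ j]) auto
      ultimately show "\<alpha> (xs ! j) ^ e * ?M xs es' = ?M xs (es'[j := es' ! j + e])"
        by (simp add: power_add)
    qed
    finally show "(\<Sum>a\<in>{1..n} - set xs. \<alpha> a ^ e * ?M xs es') = ?p * ?M xs es' - (\<Sum>j<m. ?M xs (es'[j := es' ! j + e]))" .
  qed
  also have "\<dots> = ?p * (\<Sum>xs\<in>injective_lists n m. ?M xs es') - (\<Sum>j<m. \<Sum>xs\<in>injective_lists n m. ?M xs (es'[j := es' ! j + e]))"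
    by (simp add: sum_subtractf sum_distrib_left sum.swap[of _ "injective_lists n m"])
  also have "\<dots> \<in> \<int>"
    by (intro Ints_diff Ints_mult power_sum_Ints Ints_sum IH) (simp_all add: es)
  finally show ?case .
qed

lemma symmetric_monomial_perm_Ints:
  "(\<Sum>\<rho> | \<rho> permutes {1..n}. \<Prod>i\<in>{1..n}. \<alpha> (\<rho> i) ^ e i) \<in> \<int>"
proof -
  let ?es = "map e [1..<Suc n]"
  have "(\<Sum>\<rho> | \<rho> permutes {1..n}. \<Prod>i\<in>{1..n}. \<alpha> (\<rho> i) ^ e i)
      = (\<Sum>xs\<in>injective_lists n n. \<Prod>i<n. \<alpha> (xs ! i) ^ e (Suc i))"
  proof (rule sum.reindex_bij_witness[of _ "\<lambda>xs i. if i \<in> {1..n} then xs ! (i - 1) else i" "\<lambda>\<rho>. map \<rho> [1..<Suc n]"])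
    fix \<rho> assume "\<rho> \<in> {\<rho>. \<rho> permutes {1..n}}"
    then have \<rho>: "\<rho> permutes {1..n}" by simp
    show "(\<lambda>i. if i \<in> {1..n} then map \<rho> [1..<Suc n] ! (i - 1) else i) = \<rho>"
      using permutes_not_in[OF \<rho>] by (auto simp: fun_eq_iff nth_append simp del: upt_Suc)
    show "map \<rho> [1..<Suc n] \<in> injective_lists n n"
      using permutes_inj_on[OF \<rho>] permutes_in_image[OF \<rho>] by (auto simp: injective_lists_def distinct_map simp del: upt_Suc)
    show "(\<Prod>i<n. \<alpha> (map \<rho> [1..<Suc n] ! i) ^ e (Suc i)) = (\<Prod>i\<in>{1..n}. \<alpha> (\<rho> i) ^ e i)"
      using prod.atLeast1_atMost_eq[of "\<lambda>i. \<alpha> (\<rho> i) ^ e i" n] by (simp del: upt_Suc)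
  next
    fix xs assume xs: "xs \<in> injective_lists n n"
    then have len: "length xs = n" and d: "distinct xs" and sub: "set xs \<subseteq> {1..n}" by (auto simp: injective_lists_def)
    have eq: "set xs = {1..n}"
      by (rule card_subset_eq[OF _ sub]) (use distinct_card[OF d] len in auto)
    let ?\<rho> = "\<lambda>i. if i \<in> {1..n} then xs ! (i - 1) else i"
    show "map ?\<rho> [1..<Suc n] = xs"
      by (rule nth_equalityI) (auto simp: len simp del: upt_Suc)
    have "?\<rho> ` {1..n} = {1..n}"
    proof -
      have S: "{1..n} = Suc ` {0..<n}" by (simp add: image_Suc_atLeastLessThan atLeastLessThanSuc_atLeastAtMost)
      have "?\<rho> ` Suc ` {0..<n} = (\<lambda>i. xs ! i) ` {0..<n}" unfolding image_image by (rule image_cong) auto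
      then have "?\<rho> ` {1..n} = (\<lambda>i. xs ! i) ` {0..<n}" by (simp only: S)
      also have "\<dots> = set xs" using len by (auto simp: set_conv_nth)
      finally show ?thesis using eq by simp
    qed
    then have "?\<rho> permutes {1..n}"
      by (intro bij_imp_permutes) (auto simp: bij_betw_def intro: eq_card_imp_inj_on)
    then show "?\<rho> \<in> {\<rho>. \<rho> permutes {1..n}}" by simp
  qed
  also have "\<dots> = (\<Sum>xs\<in>injective_lists n (length ?es). \<Prod>i<length ?es. \<alpha> (xs ! i) ^ (?es ! i))"
    by (simp del: upt_Suc)
  also have "\<dots> \<in> \<int>" by (rule symmetric_monomial_Ints)
  finally show ?thesis .
qed

abbreviation "perms \<equiv> {\<rho>. \<rho> permutes {1..n}}"

lemma finite_perms: "finite perms"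
  by (rule finite_permutations) simp

lemma id_perms: "id \<in> perms" by (simp add: permutes_id)

section \<open>Rationality of invariant functions of the roots\<close>

lemma root_fun_trace_rat:
  assumes "b \<in> root_fun n \<alpha> \<rat>"
  shows "(\<Sum>\<rho>\<in>perms. b \<rho>) \<in> \<rat>"
proof -
  obtain ms :: "(complex \<times> (nat \<Rightarrow> nat)) list" where ms: "\<forall>(c,e)\<in>set ms. c \<in> \<rat>"
     "\<And>\<rho>. b \<rho> = (\<Sum>(c,e)\<leftarrow>ms. c * (\<Prod>i\<in>{1..n}. \<alpha> (\<rho> i) ^ e i))"
    using root_fun_monomials[OF assms] by blast
  have "(\<Sum>\<rho>\<in>perms. \<Sum>(c,e)\<leftarrow>ms. c * (\<Prod>i\<in>{1..n}. \<alpha> (\<rho> i) ^ e i)) \<in> \<rat>" using ms(1)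
  proof (induction ms)
    case (Cons m ms)
    obtain c e where m: "m = (c,e)" by force
    have "(\<Sum>\<rho>\<in>perms. \<Prod>i\<in>{1..n}. \<alpha> (\<rho> i) ^ e i) \<in> \<rat>"
      using symmetric_monomial_perm_Ints[of e] Ints_subset_Rats by blast
    then show ?case using Cons by (simp add: m sum.distrib sum_distrib_left[symmetric])
  qed simp
  then show ?thesis by (simp add: ms(2))
qed

lemma root_fun_symmetric_rat:
  assumes "b \<in> root_fun n \<alpha> \<rat>" "\<And>\<rho>. \<rho> \<in> perms \<Longrightarrow> b \<rho> = b id"
  shows "b id \<in> \<rat>"
proof -
  have "(\<Sum>\<rho>\<in>perms. b \<rho>) = (\<Sum>\<rho>\<in>perms. b id)"
    by (intro sum.cong refl assms(2))
  then have "(\<Sum>\<rho>\<in>perms. b \<rho>) = of_nat (card perms) * b id" by simp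
  moreover have "card perms \<noteq> 0" using finite_perms id_perms by (metis card_0_eq empty_iff)
  ultimately have "b id = (\<Sum>\<rho>\<in>perms. b \<rho>) / of_nat (card perms)" by simp
  then show ?thesis using root_fun_trace_rat[OF assms(1)] by simp
qed

lemma Ints_subset_all_integers: "\<int> \<subseteq> all_integers"
  by (auto simp: int_imp_algebraic_int)

lemma root_fun_algebraic_int:
  assumes "b \<in> root_fun n \<alpha> K" "K \<subseteq> all_integers" "\<rho> \<in> perms"
  shows "algebraic_int (b \<rho>)"
  using assms(1)
proof induction
  case (root i)
  then show ?case using alg_int_root[of "\<rho> i"] permutes_in_image[of \<rho> "{1..n}" i] assms(3) by simp
qed (use assms(2) in \<open>auto intro: algebraic_int_add algebraic_int_mult\<close>)

text \<open>Translation by a permutation only rearranges the linear factors, so each coefficient is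
  a symmetric function of the roots.\<close>

lemma root_fun_charpoly_rat:
  assumes b: "b \<in> root_fun n \<alpha> \<rat>"
  shows "coeff (\<Prod>\<tau>\<in>perms. [:- b \<tau>, 1:]) k \<in> \<rat>"
proof -
  define c where "c = (\<lambda>\<rho>. coeff (\<Prod>\<tau>\<in>perms. [:- b (\<rho> \<circ> \<tau>), 1:]) k)"
  have "c \<in> root_fun n \<alpha> \<rat>" unfolding c_def
    by (rule root_fun_coeff_prod) (use finite_perms root_fun_compose[OF b] in auto)
  moreover have "c \<rho> = c id" if "\<rho> \<in> perms" for \<rho>
  proof -
    have "bij_betw (\<lambda>\<tau>. \<rho> \<circ> \<tau>) perms perms"
      using that by (intro bij_betw_byWitness[of _ "\<lambda>\<tau>. inv' \<rho> \<circ> \<tau>"])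
        (auto simp: permutes_compose permutes_inv o_assoc[symmetric] permutes_inv_o fun_eq_iff permutes_inverses)
    from prod.reindex_bij_betw[OF this, of "\<lambda>\<tau>. [:- b \<tau>, 1:]"] show ?thesis by (simp add: c_def)
  qed
  ultimately have "c id \<in> \<rat>" by (rule root_fun_symmetric_rat)
  then show ?thesis by (simp add: c_def)
qed

text \<open>Divide the characteristic polynomial of \<open>b\<close> by the highest power of X it
  contains. The quotient \<open>r\<close> still kills every nonzero value of \<open>b\<close> but
  not 0, so \<open>r\<close> evaluated at \<open>b\<close> and divided by \<open>poly r 0\<close> is
  the indicator.\<close>

lemma root_fun_zero_indicator:
  assumes b: "b \<in> root_fun n \<alpha> \<rat>"
  shows "\<exists>e\<in>root_fun n \<alpha> \<rat>. \<forall>\<rho>\<in>perms. e \<rho> = (if b \<rho> = 0 then 1 else 0)"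
proof -
  define Q where "Q = (\<Prod>\<tau>\<in>perms. [:- b \<tau>, 1:])"
  have "Q \<noteq> 0" using finite_perms by (simp add: Q_def)
  then obtain r where r: "Q = [:- 0, 1:] ^ Polynomial.order 0 Q * r" "\<not> [:- 0, 1:] dvd r"
    using order_decomp[of Q 0] by blast
  have mon: "[:0, 1:] ^ k = (monom 1 k :: complex poly)" for k by (simp add: monom_altdef)
  have "coeff r i = coeff Q (i + Polynomial.order 0 Q)" for i
    using arg_cong[OF r(1)[unfolded minus_zero mon], of "\<lambda>p. coeff p (i + Polynomial.order 0 Q)"]
    by (simp add: coeff_monom_mult)
  then have rat: "coeff r i \<in> \<rat>" for i using root_fun_charpoly_rat[OF b] by (simp add: Q_def)
  have r0: "poly r 0 \<noteq> 0" using r(2) by (simp add: poly_eq_0_iff_dvd)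
  define e where "e = (\<lambda>\<rho>. poly (smult (1 / poly r 0) r) (b \<rho>))"
  have "e \<in> root_fun n \<alpha> \<rat>" unfolding e_def
    by (rule root_fun_poly) (use rat b in \<open>auto simp: poly_0_coeff_0\<close>)
  moreover have "e \<rho> = (if b \<rho> = 0 then 1 else 0)" if "\<rho> \<in> perms" for \<rho>
  proof (cases "b \<rho> = 0")
    case False
    have "poly Q (b \<rho>) = 0" using that finite_perms by (auto simp: Q_def poly_prod)
    then have "poly r (b \<rho>) = 0" using False by (subst (asm) r(1)) (simp add: poly_power)
    then show ?thesis using False by (simp add: e_def)
  qed (use r0 in \<open>simp add: e_def\<close>)
  ultimately show ?thesis by blast
qed

text \<open>Galois's own description of his group: the permutations that respect every polynomial
  relation with rational coefficients between the roots.\<close>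

definition galois_perms :: "(nat \<Rightarrow> nat) set" where
  "galois_perms = {\<sigma>. \<sigma> permutes {1..n} \<and> (\<forall>b\<in>root_fun n \<alpha> \<rat>. b id = 0 \<longrightarrow> b \<sigma> = 0)}"

lemma galois_perms_subset: "galois_perms \<subseteq> perms"
  by (auto simp: galois_perms_def)

lemma galois_perms_id: "id \<in> galois_perms"
  by (simp add: galois_perms_def permutes_id)

lemma galois_perms_compose:
  assumes "\<sigma> \<in> galois_perms" "\<tau> \<in> galois_perms"
  shows "\<sigma> \<circ> \<tau> \<in> galois_perms"
  unfolding galois_perms_def
proof (intro CollectI conjI ballI impI)
  show "\<sigma> \<circ> \<tau> permutes {1..n}" using assms by (auto simp: galois_perms_def intro: permutes_compose)
  fix b assume b: "b \<in> root_fun n \<alpha> \<rat>" "b id = 0"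
  have \<tau>: "\<tau> permutes {1..n}" "b \<tau> = 0" using assms(2) b by (auto simp: galois_perms_def)
  have "(\<lambda>\<rho>. b (\<rho> \<circ> \<tau>)) \<in> root_fun n \<alpha> \<rat>" by (rule root_fun_compose[OF b(1) \<tau>(1)])
  then show "b (\<sigma> \<circ> \<tau>) = 0" using assms(1) \<tau>(2) by (auto simp: galois_perms_def dest: bspec)
qed

lemma galois_perms_funpow: "\<sigma> \<in> galois_perms \<Longrightarrow> \<sigma> ^^ k \<in> galois_perms"
  by (induction k) (auto intro: galois_perms_id galois_perms_compose)

text \<open>The definition is one-sided: relations valid at \<open>id\<close> must persist at
  \<sigma>. Inverses come from finiteness, since translation by \<sigma> is injective on the set and
  therefore reaches \<open>id\<close>.\<close>

lemma galois_perms_inv: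
  assumes \<sigma>: "\<sigma> \<in> galois_perms"
  shows "inv' \<sigma> \<in> galois_perms"
proof -
  have p: "\<sigma> permutes {1..n}" using \<sigma> by (simp add: galois_perms_def)
  have fin: "finite galois_perms" using finite_subset[OF galois_perms_subset finite_perms] .
  have "(\<lambda>\<rho>. \<sigma> \<circ> \<rho>) ` galois_perms = galois_perms"
  proof (rule card_subset_eq[OF fin])
    show "(\<lambda>\<rho>. \<sigma> \<circ> \<rho>) ` galois_perms \<subseteq> galois_perms" using galois_perms_compose[OF \<sigma>] by auto
    have "inj_on (\<lambda>\<rho>. \<sigma> \<circ> \<rho>) galois_perms"
      using permutes_inj[OF p] by (auto simp: inj_on_def fun_eq_iff dest: injD)
    then show "card ((\<lambda>\<rho>. \<sigma> \<circ> \<rho>) ` galois_perms) = card galois_perms" by (rule card_image)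
  qed
  then obtain \<rho> where \<rho>: "\<rho> \<in> galois_perms" "\<sigma> \<circ> \<rho> = id" using galois_perms_id by (metis imageE)
  then have "inv' \<sigma> = \<rho>" using permutes_inj[OF p]
    by (metis comp_id fun.map_comp id_comp permutes_inv_o(2)[OF p])
  then show ?thesis using \<rho> by simp
qed

text \<open>Every permutation outside the group violates a relation that the whole group respects.
  The indicator of the zeros of that relation separates the permutation from the group, and the
  product of these indicators does so for all of them at once. It turns sums over the group into
  sums over all permutations.\<close>

lemma galois_perms_indicator:
  "\<exists>e\<in>root_fun n \<alpha> \<rat>. \<forall>\<rho>\<in>perms. e \<rho> = (if \<rho> \<in> galois_perms then 1 else 0)"
proof -
  have "\<forall>\<pi>\<in>perms - galois_perms. \<exists>e. e \<in> root_fun n \<alpha> \<rat> \<and> e \<pi> = 0 \<and> (\<forall>\<rho>\<in>perms. e \<rho> \<in> {0,1}) \<and> (\<forall>\<rho>\<in>galois_perms. e \<rho> = 1)"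
  proof
    fix \<pi> assume \<pi>: "\<pi> \<in> perms - galois_perms"
    then obtain b where b: "b \<in> root_fun n \<alpha> \<rat>" "b id = 0" "b \<pi> \<noteq> 0" by (auto simp: galois_perms_def)
    then obtain e where "e \<in> root_fun n \<alpha> \<rat>" "\<forall>\<rho>\<in>perms. e \<rho> = (if b \<rho> = 0 then 1 else 0)"
      using root_fun_zero_indicator by blast
    moreover have "b \<rho> = 0" if "\<rho> \<in> galois_perms" for \<rho> using that b by (auto simp: galois_perms_def)
    ultimately show "\<exists>e. e \<in> root_fun n \<alpha> \<rat> \<and> e \<pi> = 0 \<and> (\<forall>\<rho>\<in>perms. e \<rho> \<in> {0,1}) \<and> (\<forall>\<rho>\<in>galois_perms. e \<rho> = 1)"
      using \<pi> b galois_perms_subset by (intro exI[of _ e]) auto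
  qed
  from bchoice[OF this] obtain e :: "(nat \<Rightarrow> nat) \<Rightarrow> (nat \<Rightarrow> nat) \<Rightarrow> complex"
    where e': "\<forall>\<pi>\<in>perms - galois_perms. e \<pi> \<in> root_fun n \<alpha> \<rat> \<and> e \<pi> \<pi> = 0 \<and>
      (\<forall>\<rho>\<in>perms. e \<pi> \<rho> \<in> {0,1}) \<and> (\<forall>\<rho>\<in>galois_perms. e \<pi> \<rho> = 1)" ..
  have e: "e \<pi> \<in> root_fun n \<alpha> \<rat>" "e \<pi> \<pi> = 0" "\<rho> \<in> galois_perms \<Longrightarrow> e \<pi> \<rho> = 1"
    if "\<pi> \<in> perms - galois_perms" for \<pi> \<rho>
    by (rule conjunct1[OF bspec[OF e' that]], rule conjunct1[OF conjunct2[OF bspec[OF e' that]]],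
      rule bspec[OF conjunct2[OF conjunct2[OF conjunct2[OF bspec[OF e' that]]]]])
  let ?E = "\<lambda>\<rho>. \<Prod>\<pi>\<in>perms - galois_perms. e \<pi> \<rho>"
  have "?E \<in> root_fun n \<alpha> \<rat>" by (rule root_fun_prod) (simp, rule e(1))
  moreover have "?E \<rho> = (if \<rho> \<in> galois_perms then 1 else 0)" if \<rho>: "\<rho> \<in> perms" for \<rho>
  proof (cases "\<rho> \<in> galois_perms")
    case False
    then have "\<exists>\<pi>\<in>perms - galois_perms. e \<pi> \<rho> = 0" using \<rho> e(2)[of \<rho>] by (intro bexI[of _ \<rho>]) simp_all
    then have "?E \<rho> = 0" using finite_perms by (intro prod_zero) simp_all
    then show ?thesis using False by simp
  next
    case True
    have "?E \<rho> = 1" by (rule prod.neutral) (rule ballI, erule e(3), rule True)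
    then show ?thesis using True by simp
  qed
  ultimately show ?thesis by (intro bexI[of _ ?E] ballI)
qed

lemma root_fun_galois_invariant_rat:
  assumes b: "b \<in> root_fun n \<alpha> \<rat>" "\<And>\<sigma>. \<sigma> \<in> galois_perms \<Longrightarrow> b \<sigma> = b id"
  shows "b id \<in> \<rat>"
proof -
  obtain e where e: "e \<in> root_fun n \<alpha> \<rat>" "\<forall>\<rho>\<in>perms. e \<rho> = (if \<rho> \<in> galois_perms then 1 else 0)"
    using galois_perms_indicator by blast
  have fin: "finite galois_perms" using finite_subset[OF galois_perms_subset finite_perms] .
  have "(\<Sum>\<rho>\<in>perms. b \<rho> * e \<rho>) = (\<Sum>\<rho>\<in>perms. if \<rho> \<in> galois_perms then b \<rho> else 0)"
    using e(2) by (intro sum.cong) auto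
  also have "\<dots> = (\<Sum>\<rho>\<in>galois_perms. b \<rho>)"
    using galois_perms_subset finite_perms by (simp add: sum.If_cases Int_absorb1)
  also have "\<dots> = (\<Sum>\<rho>\<in>galois_perms. b id)" by (intro sum.cong refl b(2))
  also have "\<dots> = of_nat (card galois_perms) * b id" by simp
  finally have "(\<Sum>\<rho>\<in>perms. b \<rho> * e \<rho>) = of_nat (card galois_perms) * b id" .
  moreover have "card galois_perms \<noteq> 0" using fin galois_perms_id by (metis card_0_eq empty_iff)
  ultimately have "b id = (\<Sum>\<rho>\<in>perms. b \<rho> * e \<rho>) / of_nat (card galois_perms)" by simp
  then show ?thesis using root_fun_trace_rat[OF root_fun.mult[OF b(1) e(1)]] by simp
qed

section \<open>Integral functions of the roots and Frobenius elements\<close>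

definition root_diff_prod :: complex where
  "root_diff_prod = (\<Prod>(i,j)\<in>{1..n}\<times>{1..n} - Id. \<alpha> i - \<alpha> j)"

lemma separated_root_diffs:
  assumes "finite A" "A \<subseteq> {1..n} \<times> {1..n}"
  shows "\<exists>ps. set ps \<subseteq> root_fun n \<alpha> \<int> \<times> root_fun n \<alpha> \<int> \<and>
    (\<forall>\<rho> \<tau>. (\<Prod>(i,j)\<in>A. \<alpha> (\<rho> i) - \<alpha> (\<tau> j)) = (\<Sum>(a,b)\<leftarrow>ps. a \<rho> * b \<tau>))"
  using assms
proof (induction A rule: finite_induct)
  case empty
  show ?case by (intro exI[of _ "[(\<lambda>_. 1, \<lambda>_. 1)]"]) (auto intro: root_fun.const)
next
  case (insert x A)
  obtain i j where x: "x = (i,j)" "i \<in> {1..n}" "j \<in> {1..n}" using insert.prems by auto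
  obtain ps where ps: "set ps \<subseteq> root_fun n \<alpha> \<int> \<times> root_fun n \<alpha> \<int>"
    "\<And>\<rho> \<tau>. (\<Prod>(i,j)\<in>A. \<alpha> (\<rho> i) - \<alpha> (\<tau> j)) = (\<Sum>(a,b)\<leftarrow>ps. a \<rho> * b \<tau>)" using insert by auto
  let ?f = "\<lambda>(a,b). (\<lambda>\<rho>. \<alpha> (\<rho> i) * a \<rho>, b)" and ?g = "\<lambda>(a,b). (\<lambda>\<rho>. - a \<rho>, \<lambda>\<tau>. \<alpha> (\<tau> j) * b \<tau>)"
  have "set (map ?f ps @ map ?g ps) \<subseteq> root_fun n \<alpha> \<int> \<times> root_fun n \<alpha> \<int>"
    using ps(1) x(2,3) by (auto intro!: root_fun.mult root_fun.root root_fun_uminus)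
  moreover have "(\<Sum>(a,b)\<leftarrow>map ?f ps @ map ?g ps. a \<rho> * b \<tau>) = (\<alpha> (\<rho> i) - \<alpha> (\<tau> j)) * (\<Sum>(a,b)\<leftarrow>ps. a \<rho> * b \<tau>)" for \<rho> \<tau>
    by (induction ps) (auto simp: algebra_simps)
  ultimately show ?case using insert(1,2) ps(2)
    by (intro exI[of _ "map ?f ps @ map ?g ps"]) (simp add: x)
qed

text \<open>The pairs \<open>(a, b)\<close> are a dual basis for the trace form, up to the factor \<^term>\<open>root_diff_prod\<close>:
  the product of all \<open>\<alpha> (\<rho> i) - \<alpha> (\<tau> j)\<close> with \<open>i \<noteq> j\<close> vanishes unless \<open>\<rho> = \<tau>\<close>.\<close>
lemma dual_basis:
  "\<exists>ps. set ps \<subseteq> root_fun n \<alpha> \<int> \<times> root_fun n \<alpha> \<int> \<and>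
    (\<forall>f. \<forall>\<rho>\<in>perms. root_diff_prod * f \<rho> = (\<Sum>(a,b)\<leftarrow>ps. (\<Sum>\<tau>\<in>perms. b \<tau> * f \<tau>) * a \<rho>))"
proof -
  let ?A = "{1..n}\<times>{1..n} - Id"
  obtain ps where ps: "set ps \<subseteq> root_fun n \<alpha> \<int> \<times> root_fun n \<alpha> \<int>"
    "\<And>\<rho> \<tau>. (\<Prod>(i,j)\<in>?A. \<alpha> (\<rho> i) - \<alpha> (\<tau> j)) = (\<Sum>(a,b)\<leftarrow>ps. a \<rho> * b \<tau>)"
    using separated_root_diffs[of ?A] by auto
  have diag: "(\<Prod>(i,j)\<in>?A. \<alpha> (\<rho> i) - \<alpha> (\<tau> j)) = (if \<rho> = \<tau> then root_diff_prod else 0)"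
    if \<rho>: "\<rho> \<in> perms" and \<tau>: "\<tau> \<in> perms" for \<rho> \<tau>
  proof (cases "\<rho> = \<tau>")
    case True
    have inj: "inj \<rho>" using \<rho> permutes_inj by auto
    have "bij_betw (map_prod \<rho> \<rho>) ?A ?A"
    proof (rule bij_betw_byWitness[of _ "map_prod (inv' \<rho>) (inv' \<rho>)"])
      have im: "\<rho> i \<in> {1..n} \<longleftrightarrow> i \<in> {1..n}" "inv' \<rho> i \<in> {1..n} \<longleftrightarrow> i \<in> {1..n}" for i
        using \<rho> permutes_in_image[of \<rho> "{1..n}" i] permutes_in_image[OF permutes_inv, of \<rho> "{1..n}" i] by auto
      have iv: "\<rho> (inv' \<rho> i) = i" "inv' \<rho> (\<rho> i) = i" for i using \<rho> permutes_inverses by auto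
      show "\<forall>a\<in>?A. map_prod (inv' \<rho>) (inv' \<rho>) (map_prod \<rho> \<rho> a) = a"
        "\<forall>a\<in>?A. map_prod \<rho> \<rho> (map_prod (inv' \<rho>) (inv' \<rho>) a) = a" using iv by auto
      have *: "map_prod \<rho> \<rho> x \<in> ?A" if "x \<in> ?A" for x
      proof -
        obtain i j where x: "x = (i,j)" by force
        have "\<rho> i \<noteq> \<rho> j" using that inj by (auto simp: x dest: injD)
        then show ?thesis using that im(1)[of i] im(1)[of j] unfolding x by simp
      qed
      have **: "map_prod (inv' \<rho>) (inv' \<rho>) x \<in> ?A" if "x \<in> ?A" for x
      proof -
        obtain i j where x: "x = (i,j)" by force
        have "inv' \<rho> i \<noteq> inv' \<rho> j" using that iv(1)[of i] iv(1)[of j] by (auto simp: x)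
        then show ?thesis using that im(2)[of i] im(2)[of j] unfolding x by simp
      qed
      show "map_prod \<rho> \<rho> ` ?A \<subseteq> ?A" "map_prod (inv' \<rho>) (inv' \<rho>) ` ?A \<subseteq> ?A"
        by (intro image_subsetI *, assumption, intro image_subsetI **, assumption)
    qed
    from prod.reindex_bij_betw[OF this, of "\<lambda>(i,j). \<alpha> i - \<alpha> j"]
    show ?thesis using True by (simp add: root_diff_prod_def case_prod_unfold)
  next
    case False
    then obtain j where j: "\<rho> j \<noteq> \<tau> j" by auto
    then have jn: "j \<in> {1..n}" using \<rho> \<tau> by (metis mem_Collect_eq permutes_not_in)
    define i where "i = inv' \<rho> (\<tau> j)"
    have i: "\<rho> i = \<tau> j" "i \<in> {1..n}"
      using \<rho> \<tau> jn permutes_inverses(1)[of \<rho> "{1..n}"] permutes_in_image[OF permutes_inv, of \<rho> "{1..n}" "\<tau> j"]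
        permutes_in_image[of \<tau> "{1..n}" j] by (auto simp: i_def)
    have "(i,j) \<in> ?A" using i j jn by auto
    then have "(\<Prod>(i,j)\<in>?A. \<alpha> (\<rho> i) - \<alpha> (\<tau> j)) = 0"
      using i by (intro prod_zero) (auto intro!: bexI[of _ "(i,j)"])
    then show ?thesis using False by simp
  qed
  have "root_diff_prod * f \<rho> = (\<Sum>(a,b)\<leftarrow>ps. (\<Sum>\<tau>\<in>perms. b \<tau> * f \<tau>) * a \<rho>)" if \<rho>: "\<rho> \<in> perms" for f \<rho>
  proof -
    have "root_diff_prod * f \<rho> = (\<Sum>\<tau>\<in>perms. if \<rho> = \<tau> then root_diff_prod * f \<tau> else 0)"
      using \<rho> finite_perms by (simp add: sum.delta')
    also have "\<dots> = (\<Sum>\<tau>\<in>perms. (\<Sum>(a,b)\<leftarrow>ps. a \<rho> * b \<tau>) * f \<tau>)"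
      using diag[OF \<rho>] ps(2) by (intro sum.cong) auto
    also have "\<dots> = (\<Sum>(a,b)\<leftarrow>ps. (\<Sum>\<tau>\<in>perms. b \<tau> * f \<tau>) * a \<rho>)"
      by (induction ps) (auto simp: distrib_right distrib_left sum.distrib sum_distrib_left sum_distrib_right mult_ac)
    finally show ?thesis .
  qed
  then show ?thesis using ps(1) by blast
qed

text \<open>The coordinates of \<open>e\<close> in the dual basis are traces of algebraic integers,
  hence rational integers. The common denominator \<open>root_diff_prod\<close> contains each pair
  of roots in both orders: it is the discriminant up to sign.\<close>

lemma root_fun_integral:
  assumes e: "e \<in> root_fun n \<alpha> \<rat>" "\<And>\<rho>. \<rho> \<in> perms \<Longrightarrow> algebraic_int (e \<rho>)"
  shows "\<exists>e'\<in>root_fun n \<alpha> \<int>. \<forall>\<rho>\<in>perms. e' \<rho> = root_diff_prod * e \<rho>"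
proof -
  obtain ps where ps: "set ps \<subseteq> root_fun n \<alpha> \<int> \<times> root_fun n \<alpha> \<int>"
    "\<And>f \<rho>. \<rho> \<in> perms \<Longrightarrow> root_diff_prod * f \<rho> = (\<Sum>(a,b)\<leftarrow>ps. (\<Sum>\<tau>\<in>perms. b \<tau> * f \<tau>) * a \<rho>)"
    using dual_basis by blast
  have int: "(\<Sum>\<tau>\<in>perms. b \<tau> * e \<tau>) \<in> \<int>" if b: "b \<in> root_fun n \<alpha> \<int>" for b
  proof (rule rational_algebraic_int_is_int)
    show "algebraic_int (\<Sum>\<tau>\<in>perms. b \<tau> * e \<tau>)"
      using root_fun_algebraic_int[OF b Ints_subset_all_integers] e(2)
      by (intro algebraic_int_sum algebraic_int_mult) auto
    show "(\<Sum>\<tau>\<in>perms. b \<tau> * e \<tau>) \<in> \<rat>"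
      by (intro root_fun_trace_rat root_fun.mult e root_fun_mono[OF b] Ints_subset_Rats)
  qed
  let ?e = "\<lambda>\<rho>. \<Sum>(a,b)\<leftarrow>ps. (\<Sum>\<tau>\<in>perms. b \<tau> * e \<tau>) * a \<rho>"
  have "(\<lambda>\<rho>. (case x of (a,b) \<Rightarrow> (\<Sum>\<tau>\<in>perms. b \<tau> * e \<tau>) * a \<rho>)) \<in> root_fun n \<alpha> \<int>" if x: "x \<in> set ps" for x
  proof -
    obtain a b where x': "x = (a,b)" by force
    have "(\<lambda>\<rho>. (\<Sum>\<tau>\<in>perms. b \<tau> * e \<tau>) * a \<rho>) \<in> root_fun n \<alpha> \<int>"
      using ps(1) x unfolding x' by (intro root_fun.mult root_fun.const int) auto
    then show ?thesis by (simp add: x')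
  qed
  then have "?e \<in> root_fun n \<alpha> \<int>" by (intro root_fun_sum_list) auto
  then show ?thesis using ps(2) by (intro bexI[of _ ?e]) auto
qed

text \<open>The q-th power map permutes the roots modulo \<open>P\<close>, since they are distinct
  there. For the resulting permutation \<phi>, every root function \<open>b\<close> with integer
  coefficients satisfies b(\<phi>) = b(id)^q modulo \<open>P\<close>. If \<phi> violated a rational
  relation, the indicator of the Galois group, with denominators cleared by
  \<open>root_diff_prod\<close>, would give such a function with value 0 at \<open>id\<close> and
  \<open>root_diff_prod\<close> at \<phi>; but \<open>root_diff_prod\<close> is not in
  \<open>P\<close>.\<close>

lemma frobenius_exists:
  assumes P: "prime_ideal_in all_integers P" and q: "prime q" "of_nat q \<in> P"
    and sep: "\<And>i j. i \<in> {1..n} \<Longrightarrow> j \<in> {1..n} \<Longrightarrow> i \<noteq> j \<Longrightarrow> \<alpha> i - \<alpha> j \<notin> P"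
  shows "\<exists>\<phi>\<in>galois_perms. \<forall>i\<in>{1..n}. \<alpha> (\<phi> i) - \<alpha> i ^ q \<in> P"
proof -
  interpret prime_ideal_in all_integers P by fact
  have q0: "q > 0" using q prime_gt_0_nat by blast
  have ai: "\<alpha> i \<in> all_integers" if "i \<in> {1..n}" for i using alg_int_root that by simp
  have "\<exists>j\<in>{1..n}. \<alpha> i ^ q - \<alpha> j \<in> P" if i: "i \<in> {1..n}" for i
  proof -
    have "poly (map_poly of_int F) (\<alpha> i) = 0"
      unfolding poly_F by (rule prod_zero) (use i in \<open>auto intro!: bexI[of _ i]\<close>)
    then have "- (0 - poly (map_poly of_int F) (\<alpha> i ^ q)) \<in> P"
      using P_poly_frobenius[OF q ai[OF i], of F] q0 by (intro P_minus) (simp add: zero_power)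
    then have "(\<Prod>j\<in>{1..n}. \<alpha> i ^ q - \<alpha> j) \<in> P" by (simp add: poly_F)
    then show ?thesis by (intro P_prod) (auto intro!: algebraic_int_diff algebraic_int_power alg_int_root i[simplified])
  qed
  then obtain f where f: "\<And>i. i \<in> {1..n} \<Longrightarrow> f i \<in> {1..n}" "\<And>i. i \<in> {1..n} \<Longrightarrow> \<alpha> i ^ q - \<alpha> (f i) \<in> P" by metis
  have inj: "inj_on f {1..n}"
  proof (rule inj_onI, rule ccontr)
    fix i j assume ij: "i \<in> {1..n}" "j \<in> {1..n}" "f i = f j" "i \<noteq> j"
    \<comment> \<open>Additivity of the q-th power modulo \<open>P\<close>: if two roots have
      congruent q-th powers, the q-th power of their difference lies in \<open>P\<close>, hence so
      does the difference.\<close>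
    have "(\<alpha> i - \<alpha> j + \<alpha> j) ^ q - ((\<alpha> i - \<alpha> j) ^ q + \<alpha> j ^ q) \<in> P"
      by (intro P_freshman q) (use ai ij in \<open>auto intro: algebraic_int_diff\<close>)
    moreover have "(\<alpha> i ^ q - \<alpha> (f i)) - (\<alpha> j ^ q - \<alpha> (f i)) \<in> P"
      using f(2)[OF ij(1)] f(2)[OF ij(2)] ij(3) by (intro P_diff[of "\<alpha> i ^ q - \<alpha> (f i)"]) simp_all
    ultimately have "(\<alpha> i ^ q - \<alpha> (f i)) - (\<alpha> j ^ q - \<alpha> (f i)) - ((\<alpha> i - \<alpha> j + \<alpha> j) ^ q - ((\<alpha> i - \<alpha> j) ^ q + \<alpha> j ^ q)) \<in> P"
      by (rule P_diff[rotated])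
    then have "(\<alpha> i - \<alpha> j) ^ q \<in> P" by simp
    then have "\<alpha> i - \<alpha> j \<in> P" by (rule P_power[rotated]) (use ai ij in \<open>auto intro: algebraic_int_diff\<close>)
    then show False using sep ij by blast
  qed
  define \<phi> where "\<phi> = (\<lambda>i. if i \<in> {1..n} then f i else i)"
  have "f ` {1..n} = {1..n}" using f(1) inj by (intro endo_inj_surj) auto
  have eq: "\<And>i. i \<in> {1..n} \<Longrightarrow> \<phi> i = f i" by (simp add: \<phi>_def)
  have "bij_betw \<phi> {1..n} {1..n}"
    unfolding bij_betw_def
  proof
    show "inj_on \<phi> {1..n}" by (subst inj_on_cong[OF eq]) (assumption, rule inj)
    show "\<phi> ` {1..n} = {1..n}"
      by (rule trans[OF image_cong[OF refl eq]]) (assumption, rule \<open>f ` {1..n} = {1..n}\<close>)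
  qed
  then have \<phi>: "\<phi> permutes {1..n}" by (intro bij_imp_permutes) (auto simp: \<phi>_def)
  have frob: "\<alpha> (\<phi> i) - \<alpha> i ^ q \<in> P" if "i \<in> {1..n}" for i
    using P_minus[OF f(2)[OF that]] that by (simp add: \<phi>_def)
  have reduce: "b \<phi> - b id ^ q \<in> P" if "b \<in> root_fun n \<alpha> \<int>" for b
    using that
  proof induction
    case (const c)
    then obtain z where "c = of_int z" by (auto simp: Ints_def)
    then show ?case using P_minus[OF P_fermat[OF q, of z]] by simp
  next
    case (root i)
    then show ?case using frob by simp
  next
    case (add b b')
    have "algebraic_int (b id)" "algebraic_int (b' id)"
      by (rule root_fun_algebraic_int[OF add.hyps(1) Ints_subset_all_integers id_perms],
          rule root_fun_algebraic_int[OF add.hyps(2) Ints_subset_all_integers id_perms])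
    then have "(b id + b' id) ^ q - (b id ^ q + b' id ^ q) \<in> P" by (intro P_freshman q) auto
    then have "(b \<phi> - b id ^ q) + (b' \<phi> - b' id ^ q) - ((b id + b' id) ^ q - (b id ^ q + b' id ^ q)) \<in> P"
      by (rule P_diff[OF P_add[OF add.IH]])
    then have "(b \<phi> + b' \<phi>) - (b id + b' id) ^ q \<in> P" by (simp add: algebra_simps)
    then show ?case .
  next
    case (mult b b')
    have "algebraic_int (b id)" "algebraic_int (b' \<phi>)"
      by (rule root_fun_algebraic_int[OF mult.hyps(1) Ints_subset_all_integers id_perms],
          rule root_fun_algebraic_int[OF mult.hyps(2) Ints_subset_all_integers]) (use \<phi> in simp)
    then have "(b \<phi> - b id ^ q) * b' \<phi> + b id ^ q * (b' \<phi> - b' id ^ q) \<in> P"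
      by (intro P_add[OF P_mult2[OF _ mult.IH(1)] P_mult[OF _ mult.IH(2)]]) (auto intro: algebraic_int_power)
    then have "(b \<phi> * b' \<phi>) - (b id * b' id) ^ q \<in> P" by (simp add: algebra_simps power_mult_distrib)
    then show ?case .
  qed
  have "\<phi> \<in> galois_perms"
  proof (rule ccontr)
    assume no: "\<phi> \<notin> galois_perms"
    obtain e where e: "e \<in> root_fun n \<alpha> \<rat>" "\<And>\<rho>. \<rho> \<in> perms \<Longrightarrow> e \<rho> = (if \<rho> \<in> galois_perms then 1 else 0)"
      using galois_perms_indicator by blast
    have "(\<lambda>\<rho>. 1 - e \<rho>) \<in> root_fun n \<alpha> \<rat>"
      by (intro root_fun_diff e root_fun.const) auto
    moreover have "algebraic_int (1 - e \<rho>)" if "\<rho> \<in> perms" for \<rho>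
      unfolding e(2)[OF that] by simp
    ultimately obtain e' where e': "e' \<in> root_fun n \<alpha> \<int>" "\<And>\<rho>. \<rho> \<in> perms \<Longrightarrow> e' \<rho> = root_diff_prod * (1 - e \<rho>)"
      using root_fun_integral[of "\<lambda>\<rho>. 1 - e \<rho>"] by blast
    have "e' id = 0" using e'(2)[OF id_perms] e(2)[OF id_perms] galois_perms_id by simp
    moreover have "e' \<phi> = root_diff_prod" using e'(2)[of \<phi>] e(2)[of \<phi>] no \<phi> by simp
    ultimately have "root_diff_prod \<in> P" using reduce[OF e'(1)] q0 by (simp add: zero_power)
    then have "\<exists>x\<in>{1..n}\<times>{1..n} - Id. (case x of (i,j) \<Rightarrow> \<alpha> i - \<alpha> j) \<in> P"
      unfolding root_diff_prod_def by (intro P_prod) (auto intro!: algebraic_int_diff alg_int_root)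
    then obtain i j where ij: "(i,j) \<in> {1..n}\<times>{1..n} - Id" "\<alpha> i - \<alpha> j \<in> P" by fast
    then show False using sep[of i j] by simp
  qed
  then show ?thesis using frob by blast
qed

end

section \<open>Number fields and their automorphisms\<close>

lemma subfield_CD:
  assumes "subfield_C L"
  shows "0 \<in> L" "1 \<in> L" "x \<in> L \<Longrightarrow> y \<in> L \<Longrightarrow> x + y \<in> L" "x \<in> L \<Longrightarrow> y \<in> L \<Longrightarrow> x * y \<in> L"
    "x \<in> L \<Longrightarrow> - x \<in> L" "x \<in> L \<Longrightarrow> inverse x \<in> L"
  using assms by (auto simp: subfield_C_def)

lemma subfield_C_diff: "subfield_C L \<Longrightarrow> x \<in> L \<Longrightarrow> y \<in> L \<Longrightarrow> x - y \<in> L"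
  using subfield_CD(3)[of L x "-y"] subfield_CD(5)[of L y] by simp

lemma subfield_C_divide: "subfield_C L \<Longrightarrow> x \<in> L \<Longrightarrow> y \<in> L \<Longrightarrow> x / y \<in> L"
  by (simp add: divide_inverse subfield_CD)

lemma subfield_C_of_nat: "subfield_C L \<Longrightarrow> of_nat k \<in> L"
  by (induction k) (auto intro: subfield_CD)

lemma subfield_C_of_int: "subfield_C L \<Longrightarrow> of_int k \<in> L"
  by (cases k rule: int_diff_cases) (auto intro: subfield_C_diff subfield_C_of_nat)

lemma subfield_C_Rats: "subfield_C L \<Longrightarrow> x \<in> \<rat> \<Longrightarrow> x \<in> L"
  by (elim Rats_cases') (auto intro: subfield_C_divide subfield_C_of_int)

lemma subfield_C_sum: "subfield_C L \<Longrightarrow> (\<And>i. i \<in> A \<Longrightarrow> f i \<in> L) \<Longrightarrow> (\<Sum>i\<in>A. f i) \<in> L"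
  by (induction A rule: infinite_finite_induct) (auto intro: subfield_CD)

lemma subfield_C_prod: "subfield_C L \<Longrightarrow> (\<And>i. i \<in> A \<Longrightarrow> f i \<in> L) \<Longrightarrow> (\<Prod>i\<in>A. f i) \<in> L"
  by (induction A rule: infinite_finite_induct) (auto intro: subfield_CD)

lemma subfield_C_power: "subfield_C L \<Longrightarrow> x \<in> L \<Longrightarrow> x ^ k \<in> L"
  by (induction k) (auto intro: subfield_CD)

locale emb =
  fixes L :: "complex set" and \<sigma> :: "complex \<Rightarrow> complex"
  assumes L: "subfield_C L" and emb: "field_emb L \<sigma>"
begin

lemma emb_one: "\<sigma> 1 = 1" using emb by (simp add: field_emb_def)
lemma emb_add: "x \<in> L \<Longrightarrow> y \<in> L \<Longrightarrow> \<sigma> (x + y) = \<sigma> x + \<sigma> y" using emb by (simp add: field_emb_def)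
lemma emb_mult: "x \<in> L \<Longrightarrow> y \<in> L \<Longrightarrow> \<sigma> (x * y) = \<sigma> x * \<sigma> y" using emb by (simp add: field_emb_def)

lemma emb_zero: "\<sigma> 0 = 0"
  using emb_add[of 0 0] subfield_CD(1)[OF L] by simp

lemma emb_uminus: "x \<in> L \<Longrightarrow> \<sigma> (- x) = - \<sigma> x"
  using emb_add[of x "-x"] subfield_CD(5)[OF L, of x] emb_zero by (simp add: eq_neg_iff_add_eq_0 add.commute)

lemma emb_diff: "x \<in> L \<Longrightarrow> y \<in> L \<Longrightarrow> \<sigma> (x - y) = \<sigma> x - \<sigma> y"
  using emb_add[of x "-y"] emb_uminus[of y] subfield_CD(5)[OF L, of y] by simp

lemma emb_of_nat: "\<sigma> (of_nat k) = of_nat k"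
  by (induction k) (simp_all add: emb_zero emb_one emb_add subfield_CD(2)[OF L] subfield_C_of_nat[OF L])

lemma emb_of_int: "\<sigma> (of_int k) = of_int k"
  by (cases k rule: int_diff_cases) (simp add: emb_diff emb_of_nat subfield_C_of_nat[OF L])

lemma emb_Rats:
  assumes "c \<in> \<rat>"
  shows "\<sigma> c = c"
proof -
  from assms obtain a b where ab: "b > 0" "c = of_int a / of_int b" by (rule Rats_cases')
  then have "of_int b * c = of_int a" by simp
  then have "\<sigma> (of_int b * c) = of_int a" by (simp add: emb_of_int)
  then have "of_int b * \<sigma> c = of_int a"
    by (simp add: emb_mult emb_of_int subfield_C_of_int[OF L] subfield_C_Rats[OF L assms])
  then have "of_int b * \<sigma> c = of_int b * c" using \<open>of_int b * c = of_int a\<close> by simp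
  then show ?thesis using ab(1) by simp
qed

lemma emb_sum: "(\<And>i. i \<in> A \<Longrightarrow> f i \<in> L) \<Longrightarrow> \<sigma> (\<Sum>i\<in>A. f i) = (\<Sum>i\<in>A. \<sigma> (f i))"
  by (induction A rule: infinite_finite_induct) (auto simp: emb_zero emb_add subfield_C_sum[OF L])

lemma emb_prod: "(\<And>i. i \<in> A \<Longrightarrow> f i \<in> L) \<Longrightarrow> \<sigma> (\<Prod>i\<in>A. f i) = (\<Prod>i\<in>A. \<sigma> (f i))"
  by (induction A rule: infinite_finite_induct) (auto simp: emb_one emb_mult subfield_C_prod[OF L])

lemma emb_power: "x \<in> L \<Longrightarrow> \<sigma> (x ^ k) = \<sigma> x ^ k"
  by (induction k) (auto simp: emb_one emb_mult subfield_C_power[OF L])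

lemma emb_poly:
  assumes "x \<in> L"
  shows "\<sigma> (poly (map_poly of_int p) x) = poly (map_poly of_int p) (\<sigma> x)"
  unfolding poly_altdef using assms
  by (simp add: emb_sum emb_mult emb_power emb_of_int subfield_C_of_int[OF L] subfield_C_power[OF L] subfield_CD(4)[OF L] coeff_map_poly)

lemma emb_inj: "inj_on \<sigma> L"
proof (rule inj_onI, rule ccontr)
  fix x y assume xy: "x \<in> L" "y \<in> L" "\<sigma> x = \<sigma> y" "x \<noteq> y"
  have "\<sigma> ((x - y) * inverse (x - y)) = \<sigma> (x - y) * \<sigma> (inverse (x - y))"
    using xy by (intro emb_mult subfield_CD(6)[OF L] subfield_C_diff[OF L])
  then show False using xy by (simp add: emb_one emb_diff)
qed

lemma emb_algebraic_int:
  assumes "x \<in> L" "algebraic_int x"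
  shows "algebraic_int (\<sigma> x)"
proof -
  obtain p where p: "poly (map_poly of_int p) x = 0" "lead_coeff p = 1"
    using assms(2) by (auto simp: algebraic_int_altdef_ipoly)
  then have "poly (map_poly of_int p) (\<sigma> x) = 0"
    using emb_poly[OF assms(1), of p] by (simp add: emb_zero)
  then show ?thesis using p(2) unfolding algebraic_int_altdef_ipoly by blast
qed

end

text \<open>The dual basis is a list whose values may coincide, whereas \<open>number_field\<close>
  asks for one coefficient per element of a set; coefficients of equal vectors are added up.\<close>

lemma rational_combination_of_list:
  fixes xs :: "(complex \<times> complex) list"
  assumes "finite B" "\<forall>(c,v)\<in>set xs. c \<in> \<rat> \<and> v \<in> B"
  shows "\<exists>c. (\<forall>b\<in>B. c b \<in> \<rat>) \<and> (\<Sum>(c,v)\<leftarrow>xs. c * v) = (\<Sum>b\<in>B. c b * b)"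
  using assms(2)
proof (induction xs)
  case Nil
  then show ?case by (intro exI[of _ "\<lambda>_. 0"]) simp
next
  case (Cons x xs)
  obtain d v where x: "x = (d,v)" "d \<in> \<rat>" "v \<in> B" using Cons.prems by auto
  obtain c where c: "\<forall>b\<in>B. c b \<in> \<rat>" "(\<Sum>(c,v)\<leftarrow>xs. c * v) = (\<Sum>b\<in>B. c b * b)" using Cons by auto
  have "(\<Sum>b\<in>B. (c b + (if b = v then d else 0)) * b) = (\<Sum>b\<in>B. c b * b) + (\<Sum>b\<in>B. if b = v then d * b else 0)"
    by (simp add: distrib_right sum.distrib if_distrib[of "\<lambda>x. x * _"] cong: if_cong)
  also have "\<dots> = (\<Sum>b\<in>B. c b * b) + d * v" using assms(1) x by simp
  finally show ?case using c x by (intro exI[of _ "\<lambda>b. c b + (if b = v then d else 0)"]) auto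
qed

lemma (in monic_split) galois_permsD:
  "\<sigma> \<in> galois_perms \<Longrightarrow> b \<in> root_fun n \<alpha> \<rat> \<Longrightarrow> b id = 0 \<Longrightarrow> b \<sigma> = 0"
  by (simp add: galois_perms_def)

locale full_galois = monic_split +
  assumes inj_roots: "inj_on \<alpha> {1..n}"
    and full: "galois_perms = perms"
begin

abbreviation "RF \<equiv> root_fun n \<alpha> \<rat>"

definition splitting_field :: "complex set" where
  "splitting_field = (\<lambda>b. b id) ` RF"

text \<open>As every permutation respects the relations, a value at \<open>id\<close> determines the
  whole function. This is what makes the action of permutations on numbers well defined.\<close>

lemma RF_eq:
  assumes "b \<in> RF" "c \<in> RF" "b id = c id" "\<rho> \<in> perms"
  shows "b \<rho> = c \<rho>"
proof -
  have "(\<lambda>\<rho>. b \<rho> - c \<rho>) \<in> RF" using assms by (intro root_fun_diff) auto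
  moreover have "\<rho> \<in> galois_perms" using assms(4) full by simp
  ultimately have "b \<rho> - c \<rho> = 0"
    using galois_permsD[of \<rho> "\<lambda>\<rho>. b \<rho> - c \<rho>"] assms(3) by simp
  then show ?thesis by simp
qed

lemma perms_inv: "\<rho> \<in> perms \<Longrightarrow> inv' \<rho> \<in> perms" "\<rho> \<in> perms \<Longrightarrow> inv' \<rho> \<circ> \<rho> = id" "\<rho> \<in> perms \<Longrightarrow> \<rho> \<circ> inv' \<rho> = id"
  by (auto simp: permutes_inv permutes_inv_o)

lemma RF_zero:
  assumes "b \<in> RF" "\<rho> \<in> perms" "b \<rho> = 0"
  shows "b id = 0"
proof -
  have "(\<lambda>\<pi>. b (\<pi> \<circ> \<rho>)) \<in> RF" using root_fun_compose assms by auto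
  moreover have "(\<lambda>_. 0) \<in> RF" by (rule root_fun.const) simp
  ultimately have "b (inv' \<rho> \<circ> \<rho>) = 0"
    using RF_eq[of "\<lambda>\<pi>. b (\<pi> \<circ> \<rho>)" "\<lambda>_. 0" "inv' \<rho>"] perms_inv[OF assms(2)] assms(3) by simp
  then show ?thesis using perms_inv[OF assms(2)] by simp
qed

lemma root_in_splitting_field: "i \<in> {1..n} \<Longrightarrow> \<alpha> i \<in> splitting_field"
  unfolding splitting_field_def by (rule image_eqI[of _ _ "\<lambda>\<rho>. \<alpha> (\<rho> i)"]) (auto intro: root_fun.root)

lemma RF_in_splitting_field: "b \<in> RF \<Longrightarrow> b id \<in> splitting_field"
  unfolding splitting_field_def by auto

lemma splitting_field_cases:
  assumes "x \<in> splitting_field"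
  obtains b where "b \<in> RF" "x = b id"
  using assms unfolding splitting_field_def by auto

lemma subfield_splitting_field: "subfield_C splitting_field"
  unfolding subfield_C_def
proof (intro conjI ballI)
  show "0 \<in> splitting_field" using RF_in_splitting_field[of "\<lambda>_. 0"] by (simp add: root_fun.const)
  show "1 \<in> splitting_field" using RF_in_splitting_field[of "\<lambda>_. 1"] by (simp add: root_fun.const)
next
  fix x y assume "x \<in> splitting_field" "y \<in> splitting_field"
  then obtain b c where bc: "b \<in> RF" "x = b id" "c \<in> RF" "y = c id" by (metis splitting_field_cases)
  show "x + y \<in> splitting_field" using RF_in_splitting_field[OF root_fun.add[OF bc(1,3)]] bc by simp
  show "x * y \<in> splitting_field" using RF_in_splitting_field[OF root_fun.mult[OF bc(1,3)]] bc by simp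
next
  fix x assume "x \<in> splitting_field"
  then obtain b where b: "b \<in> RF" "x = b id" by (rule splitting_field_cases)
  show "- x \<in> splitting_field" using RF_in_splitting_field[OF root_fun_uminus[OF _ b(1)]] b by simp
  show "inverse x \<in> splitting_field"
  proof (cases "x = 0")
    case True
    then show ?thesis using RF_in_splitting_field[of "\<lambda>_. 0"] by (simp add: root_fun.const)
  next
    case False
    \<comment> \<open>The inverse is the product of the other conjugates divided by the norm;
      \<open>M\<close> is the norm up to sign, so it is rational, and it is nonzero because no
      conjugate of a nonzero element vanishes.\<close>
    define M where "M = (\<Prod>\<tau>\<in>perms. - b \<tau>)"
    have "poly (\<Prod>\<tau>\<in>perms. [:- b \<tau>, 1:]) 0 \<in> \<rat>"
      using root_fun_charpoly_rat[OF b(1), of 0] by (simp add: poly_0_coeff_0)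
    then have Mrat: "M \<in> \<rat>" by (simp add: M_def poly_prod)
    have "\<forall>\<tau>\<in>perms. b \<tau> \<noteq> 0" using RF_zero[OF b(1)] False b(2) by blast
    then have M0: "M \<noteq> 0" using finite_perms unfolding M_def by (subst prod_zero_iff) auto
    define c where "c = (\<lambda>\<rho>. (\<Prod>\<tau>\<in>perms - {id}. - b (\<rho> \<circ> \<tau>)) * (- 1 / M))"
    have "c \<in> RF" unfolding c_def
    proof (intro root_fun.mult root_fun_prod root_fun.const)
      show "(\<lambda>\<rho>. - b (\<rho> \<circ> \<tau>)) \<in> RF" if "\<tau> \<in> perms - {id}" for \<tau>
        using that by (intro root_fun_uminus root_fun_compose b) auto
    qed (use Mrat in auto)
    moreover have "M = - x * (\<Prod>\<tau>\<in>perms - {id}. - b \<tau>)"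
      unfolding M_def b(2) by (rule prod.remove[OF finite_perms id_perms])
    then have "x * c id = 1" using M0 by (simp add: c_def field_simps)
    then have "inverse x = c id" by (rule inverse_unique)
    ultimately show ?thesis using RF_in_splitting_field by simp
  qed
qed

lemma root_diff_prod_nonzero: "root_diff_prod \<noteq> 0"
proof -
  have "(case x of (i,j) \<Rightarrow> \<alpha> i - \<alpha> j) \<noteq> 0" if "x \<in> {1..n}\<times>{1..n} - Id" for x
    using that inj_roots by (cases x) (auto dest: inj_onD)
  then show ?thesis unfolding root_diff_prod_def by (subst prod_zero_iff) auto
qed

lemma root_diff_prod_in: "root_diff_prod \<in> splitting_field"
  unfolding root_diff_prod_def
  by (intro subfield_C_prod[OF subfield_splitting_field])
     (auto intro!: subfield_C_diff[OF subfield_splitting_field] root_in_splitting_field)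

lemma number_field_splitting_field: "number_field splitting_field"
  unfolding number_field_def
proof (intro conjI subfield_splitting_field)
  obtain ps where ps: "set ps \<subseteq> root_fun n \<alpha> \<int> \<times> root_fun n \<alpha> \<int>"
    "\<And>f \<rho>. \<rho> \<in> perms \<Longrightarrow> root_diff_prod * f \<rho> = (\<Sum>(a,b)\<leftarrow>ps. (\<Sum>\<tau>\<in>perms. b \<tau> * f \<tau>) * a \<rho>)"
    using dual_basis by blast
  have sub: "root_fun n \<alpha> \<int> \<subseteq> RF" using root_fun_mono Ints_subset_Rats by blast
  \<comment> \<open>By the dual basis at \<open>id\<close> these elements span the field over the
    rationals, with traces as coefficients.\<close>
  let ?B = "(\<lambda>(a,b). a id / root_diff_prod) ` set ps"
  have "?B \<subseteq> splitting_field"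
  proof (rule image_subsetI)
    fix x assume "x \<in> set ps"
    then have "x \<in> root_fun n \<alpha> \<int> \<times> root_fun n \<alpha> \<int>" using ps(1) by blast
    then obtain a b where x: "x = (a,b)" "a \<in> RF" using sub by blast
    then show "(case x of (a,b) \<Rightarrow> a id / root_diff_prod) \<in> splitting_field"
      by (simp only: prod.case)
        (rule subfield_C_divide[OF subfield_splitting_field RF_in_splitting_field root_diff_prod_in])
  qed
  moreover have "\<exists>c. (\<forall>b\<in>?B. c b \<in> \<rat>) \<and> x = (\<Sum>b\<in>?B. c b * b)" if x: "x \<in> splitting_field" for x
  proof -
    obtain f where f: "f \<in> RF" "x = f id" using x by (rule splitting_field_cases)
    let ?xs = "map (\<lambda>(a,b). ((\<Sum>\<tau>\<in>perms. b \<tau> * f \<tau>), a id / root_diff_prod)) ps"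
    have "(\<Sum>\<tau>\<in>perms. b \<tau> * f \<tau>) \<in> \<rat>" if "(a,b) \<in> set ps" for a b
      using that ps(1) sub f by (intro root_fun_trace_rat root_fun.mult) auto
    then have "\<forall>(c,v)\<in>set ?xs. c \<in> \<rat> \<and> v \<in> ?B" by force
    then obtain c where c: "\<forall>b\<in>?B. c b \<in> \<rat>" "(\<Sum>(c,v)\<leftarrow>?xs. c * v) = (\<Sum>b\<in>?B. c b * b)"
      using rational_combination_of_list[of ?B ?xs] by auto
    have "(\<Sum>(c,v)\<leftarrow>?xs. c * v) = (\<Sum>(a,b)\<leftarrow>ps. (\<Sum>\<tau>\<in>perms. b \<tau> * f \<tau>) * a id) / root_diff_prod"
      by (induction ps) (auto simp: add_divide_distrib)
    also have "\<dots> = x" using ps(2)[OF id_perms, of f] root_diff_prod_nonzero f by (simp add: field_simps)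
    finally show ?thesis using c by auto
  qed
  ultimately show "\<exists>B. finite B \<and> B \<subseteq> splitting_field \<and> (\<forall>x\<in>splitting_field. \<exists>c. (\<forall>b\<in>B. c b \<in> \<rat>) \<and> x = (\<Sum>b\<in>B. c b * b))"
    by (intro exI[of _ ?B]) auto
qed

text \<open>The chosen \<open>b\<close> is immaterial by \<open>RF_eq\<close>. Outside the field the
  map is the identity, as \<open>Aut\<close> demands.\<close>

definition act :: "(nat \<Rightarrow> nat) \<Rightarrow> complex \<Rightarrow> complex" where
  "act \<rho> x = (if x \<in> splitting_field then (SOME b. b \<in> RF \<and> b id = x) \<rho> else x)"

lemma act_RF:
  assumes "b \<in> RF" "\<rho> \<in> perms"
  shows "act \<rho> (b id) = b \<rho>"
proof -
  let ?c = "SOME c. c \<in> RF \<and> c id = b id"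
  have "?c \<in> RF \<and> ?c id = b id" by (rule someI[of _ b]) (use assms in simp)
  then have "?c \<rho> = b \<rho>" by (elim conjE) (rule RF_eq[OF _ assms(1) _ assms(2)])
  then show ?thesis using RF_in_splitting_field[OF assms(1)] by (simp add: act_def)
qed

lemma act_root: "\<rho> \<in> perms \<Longrightarrow> i \<in> {1..n} \<Longrightarrow> act \<rho> (\<alpha> i) = \<alpha> (\<rho> i)"
  using act_RF[OF root_fun.root, of i \<rho>] by simp

lemma act_outside: "x \<notin> splitting_field \<Longrightarrow> act \<rho> x = x"
  by (simp add: act_def)

lemma act_in:
  assumes "x \<in> splitting_field" "\<rho> \<in> perms"
  shows "act \<rho> x \<in> splitting_field"
proof -
  obtain b where b: "b \<in> RF" "x = b id" using assms(1) by (rule splitting_field_cases)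
  have "(\<lambda>\<pi>. b (\<pi> \<circ> \<rho>)) \<in> RF" using root_fun_compose b assms by auto
  from RF_in_splitting_field[OF this] show ?thesis using act_RF[OF b(1) assms(2)] b by simp
qed

lemma act_compose:
  assumes "\<rho> \<in> perms" "\<tau> \<in> perms"
  shows "act (\<rho> \<circ> \<tau>) = act \<rho> \<circ> act \<tau>"
proof
  fix x
  show "act (\<rho> \<circ> \<tau>) x = (act \<rho> \<circ> act \<tau>) x"
  proof (cases "x \<in> splitting_field")
    case True
    then obtain b where b: "b \<in> RF" "x = b id" by (rule splitting_field_cases)
    have b': "(\<lambda>\<pi>. b (\<pi> \<circ> \<tau>)) \<in> RF" using root_fun_compose b assms by auto
    have "act \<rho> (act \<tau> x) = b (\<rho> \<circ> \<tau>)"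
      using act_RF[OF b' assms(1)] act_RF[OF b(1) assms(2)] b by simp
    moreover have "\<rho> \<circ> \<tau> \<in> perms" using assms permutes_compose by auto
    ultimately show ?thesis using act_RF[OF b(1)] b by simp
  qed (simp add: act_outside)
qed

lemma act_id: "act id = id"
proof
  fix x show "act id x = id x"
    using act_RF[OF _ id_perms] by (cases "x \<in> splitting_field") (auto simp: act_outside elim: splitting_field_cases)
qed

lemma act_Aut:
  assumes "\<rho> \<in> perms"
  shows "act \<rho> \<in> Aut splitting_field"
  unfolding Aut_def
proof (intro CollectI conjI allI impI)
  show "field_emb splitting_field (act \<rho>)"
    unfolding field_emb_def
  proof (intro conjI ballI)
    show "act \<rho> 1 = 1" using act_RF[OF root_fun.const assms, of 1] by simp
  next
    fix x y assume "x \<in> splitting_field" "y \<in> splitting_field"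
    then obtain b c where bc: "b \<in> RF" "x = b id" "c \<in> RF" "y = c id" by (metis splitting_field_cases)
    show "act \<rho> (x + y) = act \<rho> x + act \<rho> y"
      using act_RF[OF root_fun.add[OF bc(1,3)] assms] act_RF[OF bc(1) assms] act_RF[OF bc(3) assms] bc by simp
    show "act \<rho> (x * y) = act \<rho> x * act \<rho> y"
      using act_RF[OF root_fun.mult[OF bc(1,3)] assms] act_RF[OF bc(1) assms] act_RF[OF bc(3) assms] bc by simp
  qed
  have *: "act (inv' \<rho>) \<circ> act \<rho> = id" "act \<rho> \<circ> act (inv' \<rho>) = id"
    using act_compose[OF perms_inv(1)[OF assms] assms] act_compose[OF assms perms_inv(1)[OF assms]]
      perms_inv[OF assms] act_id by simp_all
  show "bij_betw (act \<rho>) splitting_field splitting_field"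
    by (rule bij_betw_byWitness[of _ "act (inv' \<rho>)"])
       (use *[unfolded fun_eq_iff] act_in[OF _ assms] act_in[OF _ perms_inv(1)[OF assms]] in auto)
qed (simp add: act_outside)

lemma emb_root:
  assumes "field_emb splitting_field \<sigma>" "i \<in> {1..n}"
  shows "\<exists>j\<in>{1..n}. \<sigma> (\<alpha> i) = \<alpha> j"
proof -
  interpret emb splitting_field \<sigma> using assms subfield_splitting_field by unfold_locales
  have "poly (map_poly of_int F) (\<alpha> i) = 0"
    unfolding poly_F by (rule prod_zero) (use assms(2) in \<open>auto intro!: bexI[of _ i]\<close>)
  then have "poly (map_poly of_int F) (\<sigma> (\<alpha> i)) = 0"
    using emb_poly[OF root_in_splitting_field[OF assms(2)], of F] by (simp add: emb_zero)
  then show ?thesis unfolding poly_F by auto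
qed

lemma Aut_eq_act:
  assumes \<sigma>: "\<sigma> \<in> Aut splitting_field"
  shows "\<exists>\<rho>\<in>perms. \<sigma> = act \<rho>"
proof -
  have e: "field_emb splitting_field \<sigma>" and out: "\<And>x. x \<notin> splitting_field \<Longrightarrow> \<sigma> x = x" using \<sigma> by (auto simp: Aut_def)
  interpret emb splitting_field \<sigma> using e subfield_splitting_field by unfold_locales
  have "\<forall>i\<in>{1..n}. \<exists>j. j \<in> {1..n} \<and> \<sigma> (\<alpha> i) = \<alpha> j" using emb_root[OF e] by blast
  from bchoice[OF this] obtain f where f: "\<And>i. i \<in> {1..n} \<Longrightarrow> f i \<in> {1..n}" "\<And>i. i \<in> {1..n} \<Longrightarrow> \<sigma> (\<alpha> i) = \<alpha> (f i)"
    by blast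
  have inj: "inj_on f {1..n}"
  proof (rule inj_onI)
    fix i j assume ij: "i \<in> {1..n}" "j \<in> {1..n}" "f i = f j"
    then have "\<sigma> (\<alpha> i) = \<sigma> (\<alpha> j)" using f(2)[OF ij(1)] f(2)[OF ij(2)] by simp
    then have "\<alpha> i = \<alpha> j" using emb_inj root_in_splitting_field ij by (auto dest: inj_onD)
    then show "i = j" using inj_roots ij by (auto dest: inj_onD)
  qed
  define \<rho> where "\<rho> = (\<lambda>i. if i \<in> {1..n} then f i else i)"
  have "f ` {1..n} = {1..n}" using f(1) inj by (intro endo_inj_surj) auto
  have eq: "\<And>i. i \<in> {1..n} \<Longrightarrow> \<rho> i = f i" by (simp add: \<rho>_def)
  have "bij_betw \<rho> {1..n} {1..n}"
    unfolding bij_betw_def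
  proof
    show "inj_on \<rho> {1..n}" by (subst inj_on_cong[OF eq]) (assumption, rule inj)
    show "\<rho> ` {1..n} = {1..n}"
      by (rule trans[OF image_cong[OF refl eq]]) (assumption, rule \<open>f ` {1..n} = {1..n}\<close>)
  qed
  then have \<rho>: "\<rho> \<in> perms" by (auto intro!: bij_imp_permutes simp: \<rho>_def)
  have "\<sigma> (b id) = b \<rho>" if "b \<in> RF" for b
    using that
  proof induction
    case (const c) then show ?case by (simp add: emb_Rats)
  next
    case (root i) then show ?case using f(2) by (simp add: \<rho>_def)
  next
    case (add b b')
    then show ?case
      using emb_add[OF RF_in_splitting_field[OF add.hyps(1)] RF_in_splitting_field[OF add.hyps(2)]] by (simp add: id_def)
  next
    case (mult b b')
    then show ?case
      using emb_mult[OF RF_in_splitting_field[OF mult.hyps(1)] RF_in_splitting_field[OF mult.hyps(2)]] by (simp add: id_def)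
  qed
  then have "\<sigma> x = act \<rho> x" for x
    using act_RF[OF _ \<rho>] by (cases "x \<in> splitting_field") (auto simp: act_outside out elim: splitting_field_cases)
  then show ?thesis using \<rho> by blast
qed

lemma galois_splitting_field: "galois_over_Q splitting_field"
  unfolding galois_over_Q_def
proof (intro conjI number_field_splitting_field equalityI subsetI)
  fix x assume "x \<in> {x \<in> splitting_field. \<forall>\<sigma>\<in>Aut splitting_field. \<sigma> x = x}"
  then have x: "x \<in> splitting_field" "\<And>\<rho>. \<rho> \<in> perms \<Longrightarrow> act \<rho> x = x" using act_Aut by auto
  obtain b where b: "b \<in> RF" "x = b id" using x(1) by (rule splitting_field_cases)
  have "b id \<in> \<rat>"
  proof (rule root_fun_symmetric_rat[OF b(1)])
    fix \<rho> assume \<rho>: "\<rho> \<in> perms"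
    have "b \<rho> = act \<rho> x" unfolding b(2) by (rule act_RF[OF b(1) \<rho>, symmetric])
    also have "\<dots> = b id" unfolding x(2)[OF \<rho>] by (rule b(2))
    finally show "b \<rho> = b id" .
  qed
  then show "x \<in> \<rat>" using b by simp
next
  fix x :: complex assume x: "x \<in> \<rat>"
  have "\<sigma> x = x" if "\<sigma> \<in> Aut splitting_field" for \<sigma>
  proof -
    interpret emb splitting_field \<sigma> using that subfield_splitting_field by unfold_locales (auto simp: Aut_def)
    show ?thesis using emb_Rats[OF x] .
  qed
  then show "x \<in> {x \<in> splitting_field. \<forall>\<sigma>\<in>Aut splitting_field. \<sigma> x = x}"
    using subfield_C_Rats[OF subfield_splitting_field x] by blast
qed

lemma galois_group_splitting_field: "galois_group splitting_field \<cong> sym_group n"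
proof -
  have "act \<in> iso (sym_group n) (galois_group splitting_field)"
    unfolding iso_def
  proof (intro CollectI conjI)
    show "act \<in> hom (sym_group n) (galois_group splitting_field)"
      by (rule homI) (auto simp: sym_group_def galois_group_def act_Aut act_compose)
    have inj: "inj_on act perms"
    proof (rule inj_onI)
      fix \<rho> \<tau> assume rt: "\<rho> \<in> perms" "\<tau> \<in> perms" "act \<rho> = act \<tau>"
      show "\<rho> = \<tau>"
      proof
        fix i
        show "\<rho> i = \<tau> i"
        proof (cases "i \<in> {1..n}")
          case True
          then have "\<alpha> (\<rho> i) = \<alpha> (\<tau> i)" using act_root[OF rt(1) True] act_root[OF rt(2) True] rt(3) by simp
          moreover have "\<rho> i \<in> {1..n}" "\<tau> i \<in> {1..n}" using True rt permutes_in_image by (metis mem_Collect_eq)+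
          ultimately show ?thesis using inj_roots by (auto dest: inj_onD)
        next
          case False
          then show ?thesis using rt by (metis mem_Collect_eq permutes_not_in)
        qed
      qed
    qed
    have "act ` perms = Aut splitting_field" using act_Aut Aut_eq_act by blast
    then show "bij_betw act (carrier (sym_group n)) (carrier (galois_group splitting_field))"
      using inj by (simp add: bij_betw_def sym_group_def galois_group_def)
  qed
  then have "sym_group n \<cong> galois_group splitting_field" by (auto simp: is_iso_def)
  then show ?thesis by (rule group.iso_sym[OF sym_group_is_group])
qed

lemma totally_real_splitting_field:
  assumes "\<And>i. i \<in> {1..n} \<Longrightarrow> \<alpha> i \<in> \<real>"
  shows "totally_real splitting_field"
  unfolding totally_real_def
proof (intro allI impI subsetI)
  fix \<sigma> y assume e: "field_emb splitting_field \<sigma>" "y \<in> \<sigma> ` splitting_field"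
  interpret emb splitting_field \<sigma> using e subfield_splitting_field by unfold_locales
  obtain b where b: "b \<in> RF" "y = \<sigma> (b id)" using e(2) by (auto elim: splitting_field_cases)
  have "\<sigma> (b id) \<in> \<real>" using b(1)
  proof induction
    case (const c)
    then show ?case by (auto simp: emb_Rats elim!: Rats_cases')
  next
    case (root i)
    then show ?case using emb_root[OF e(1), of i] assms by auto
  next
    case (add b b')
    then show ?case
      using emb_add[OF RF_in_splitting_field[OF add.hyps(1)] RF_in_splitting_field[OF add.hyps(2)]] by (simp add: id_def)
  next
    case (mult b b')
    then show ?case
      using emb_mult[OF RF_in_splitting_field[OF mult.hyps(1)] RF_in_splitting_field[OF mult.hyps(2)]] by (simp add: id_def)
  qed
  then show "y \<in> \<real>" using b by simp
qed

end

section \<open>Ramification in Galois extensions\<close>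

lemma common_denominator:
  fixes S :: "complex set"
  assumes "finite S" "S \<subseteq> \<rat>"
  shows "\<exists>d>0. \<forall>c\<in>S. of_nat d * c \<in> \<int>"
  using assms
proof (induction S rule: finite_induct)
  case (insert x S)
  then obtain d where d: "d > 0" "\<forall>c\<in>S. of_nat d * c \<in> \<int>" by auto
  obtain a b where ab: "b > 0" "x = of_int a / of_int b" using insert.prems by (auto elim: Rats_cases')
  let ?d = "d * nat b"
  have "of_nat ?d * x = of_int (int d * a)" using ab by simp
  then have "of_nat ?d * x \<in> \<int>" by (metis Ints_of_int)
  moreover have "of_nat ?d * c \<in> \<int>" if "c \<in> S" for c
  proof -
    have "of_nat ?d * c = of_nat (nat b) * (of_nat d * c)" by simp
    also have "\<dots> \<in> \<int>" by (rule Ints_mult[OF Ints_of_nat]) (use d that in blast)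
    finally show ?thesis .
  qed
  ultimately show ?case using d ab by (intro exI[of _ ?d]) auto
qed (auto intro: exI[of _ 1])

text \<open>Multiplication by \<open>x\<close> has a rational matrix on a finite spanning set; a
  common denominator \<open>d\<close> turns it into an integer matrix for d x. The spanning set need
  not be independent, which the eigenvector argument tolerates.\<close>

lemma number_field_integral_multiple:
  assumes "number_field L" "x \<in> L"
  shows "\<exists>d>0. algebraic_int (of_nat d * x)"
proof -
  have L: "subfield_C L" using assms by (simp add: number_field_def)
  obtain B where B: "finite B" "B \<subseteq> L" "\<And>x. x \<in> L \<Longrightarrow> \<exists>c. (\<forall>b\<in>B. c b \<in> \<rat>) \<and> x = (\<Sum>b\<in>B. c b * b)"
    using assms(1) unfolding number_field_def by blast
  have "\<forall>b\<in>B. \<exists>c. (\<forall>b'\<in>B. c b' \<in> \<rat>) \<and> x * b = (\<Sum>b'\<in>B. c b' * b')"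
    using B assms(2) subfield_CD(4)[OF L] by blast
  from bchoice[OF this] obtain c where c: "\<And>b b'. b \<in> B \<Longrightarrow> b' \<in> B \<Longrightarrow> c b b' \<in> \<rat>"
    "\<And>b. b \<in> B \<Longrightarrow> x * b = (\<Sum>b'\<in>B. c b b' * b')" by blast
  have "finite ((\<lambda>(b,b'). c b b') ` (B \<times> B))" "(\<lambda>(b,b'). c b b') ` (B \<times> B) \<subseteq> \<rat>" using B(1) c(1) by auto
  from common_denominator[OF this] obtain d where d: "d > 0" "\<And>b b'. b \<in> B \<Longrightarrow> b' \<in> B \<Longrightarrow> of_nat d * c b b' \<in> \<int>"
    by fastforce
  have "algebraic_int (of_nat d * x)"
  proof (rule algebraic_int_if_integer_eigenvector[OF B(1), of _ "\<lambda>b. b" "\<lambda>b b'. \<lfloor>Re (of_nat d * c b b')\<rfloor>"])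
    fix b assume b: "b \<in> B"
    have "of_nat d * x * b = (\<Sum>b'\<in>B. (of_nat d * c b b') * b')"
      using c(2)[OF b] by (simp add: mult.assoc sum_distrib_left)
    also have "\<dots> = (\<Sum>b'\<in>B. of_int \<lfloor>Re (of_nat d * c b b')\<rfloor> * b')"
    proof (intro sum.cong refl)
      fix b' assume "b' \<in> B"
      then obtain k where "of_nat d * c b b' = of_int k" using d(2)[OF b] by (auto simp: Ints_def)
      then show "(of_nat d * c b b') * b' = of_int \<lfloor>Re (of_nat d * c b b')\<rfloor> * b'" by simp
    qed
    finally show "of_nat d * x * b = (\<Sum>b'\<in>B. of_int \<lfloor>Re (of_nat d * c b b')\<rfloor> * b')" .
  next
    show "\<exists>b\<in>B. b \<noteq> 0"
    proof (rule ccontr)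
      assume no: "\<not> ?thesis"
      obtain c' where "1 = (\<Sum>b\<in>B. c' b * b)" using B(3)[OF subfield_CD(2)[OF L]] by blast
      also have "\<dots> = 0" using no by (intro sum.neutral) auto
      finally show False by simp
    qed
  qed
  then show ?thesis using d by blast
qed

locale finite_galois =
  fixes L :: "complex set"
  assumes gal: "galois_over_Q L" and fin_Aut: "finite (Aut L)"
begin

abbreviation "\<O> \<equiv> ring_of_integers L"

lemma number_field_L: "number_field L" using gal by (simp add: galois_over_Q_def)
lemma L: "subfield_C L" using number_field_L by (simp add: number_field_def)

lemma Aut_emb: "\<sigma> \<in> Aut L \<Longrightarrow> emb L \<sigma>"
  using L by unfold_locales (auto simp: Aut_def)

lemma Aut_in: "\<sigma> \<in> Aut L \<Longrightarrow> x \<in> L \<Longrightarrow> \<sigma> x \<in> L"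
  by (auto simp: Aut_def bij_betw_def)

lemma Aut_fixed: "x \<in> L \<Longrightarrow> (\<And>\<sigma>. \<sigma> \<in> Aut L \<Longrightarrow> \<sigma> x = x) \<Longrightarrow> x \<in> \<rat>"
  using gal by (auto simp: galois_over_Q_def)

lemma id_Aut: "id \<in> Aut L"
  by (auto simp: Aut_def field_emb_def)

lemma compose_Aut:
  assumes "\<sigma> \<in> Aut L" "\<tau> \<in> Aut L"
  shows "\<sigma> \<circ> \<tau> \<in> Aut L"
proof -
  have "bij_betw (\<sigma> \<circ> \<tau>) L L" using assms by (auto simp: Aut_def intro: bij_betw_trans)
  moreover have "field_emb L (\<sigma> \<circ> \<tau>)"
    using assms Aut_in[OF assms(2)] by (simp add: Aut_def field_emb_def)
  ultimately show ?thesis using assms by (auto simp: Aut_def)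
qed

lemma Aut_eqI:
  assumes "\<sigma> \<in> Aut L" "\<tau> \<in> Aut L" "\<And>x. x \<in> L \<Longrightarrow> \<sigma> x = \<tau> x"
  shows "\<sigma> = \<tau>"
proof
  fix x show "\<sigma> x = \<tau> x" using assms by (cases "x \<in> L") (auto simp: Aut_def)
qed

lemma bij_compose_Aut:
  assumes \<sigma>: "\<sigma> \<in> Aut L"
  shows "bij_betw (\<lambda>\<tau>. \<sigma> \<circ> \<tau>) (Aut L) (Aut L)"
proof -
  have inj: "inj_on (\<lambda>\<tau>. \<sigma> \<circ> \<tau>) (Aut L)"
  proof (rule inj_onI)
    fix \<tau> \<tau>' assume t: "\<tau> \<in> Aut L" "\<tau>' \<in> Aut L" "\<sigma> \<circ> \<tau> = \<sigma> \<circ> \<tau>'"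
    show "\<tau> = \<tau>'"
    proof (rule Aut_eqI[OF t(1,2)])
      fix x assume x: "x \<in> L"
      have "\<sigma> (\<tau> x) = \<sigma> (\<tau>' x)" using t(3) by (metis comp_apply)
      then show "\<tau> x = \<tau>' x" using emb.emb_inj[OF Aut_emb[OF \<sigma>]] Aut_in t x by (auto dest: inj_onD)
    qed
  qed
  moreover have "(\<lambda>\<tau>. \<sigma> \<circ> \<tau>) ` Aut L = Aut L"
    using compose_Aut[OF \<sigma>] by (intro endo_inj_surj fin_Aut inj) auto
  ultimately show ?thesis by (simp add: bij_betw_def)
qed

lemma trace_rat:
  assumes "x \<in> L"
  shows "(\<Sum>\<sigma>\<in>Aut L. \<sigma> x) \<in> \<rat>"
proof (rule Aut_fixed)
  show "(\<Sum>\<sigma>\<in>Aut L. \<sigma> x) \<in> L" using Aut_in assms by (intro subfield_C_sum[OF L])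
  fix \<tau> assume \<tau>: "\<tau> \<in> Aut L"
  have "\<tau> (\<Sum>\<sigma>\<in>Aut L. \<sigma> x) = (\<Sum>\<sigma>\<in>Aut L. (\<tau> \<circ> \<sigma>) x)"
    unfolding comp_def by (rule emb.emb_sum[OF Aut_emb[OF \<tau>] Aut_in[OF _ assms]])
  also have "\<dots> = (\<Sum>\<sigma>\<in>Aut L. \<sigma> x)"
    by (rule sum.reindex_bij_betw[OF bij_compose_Aut[OF \<tau>], of "\<lambda>\<sigma>. \<sigma> x"])
  finally show "\<tau> (\<Sum>\<sigma>\<in>Aut L. \<sigma> x) = (\<Sum>\<sigma>\<in>Aut L. \<sigma> x)" .
qed

lemma norm_rat:
  assumes "x \<in> L"
  shows "(\<Prod>\<sigma>\<in>Aut L. \<sigma> x) \<in> \<rat>"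
proof (rule Aut_fixed)
  show "(\<Prod>\<sigma>\<in>Aut L. \<sigma> x) \<in> L" using Aut_in assms by (intro subfield_C_prod[OF L])
  fix \<tau> assume \<tau>: "\<tau> \<in> Aut L"
  have "\<tau> (\<Prod>\<sigma>\<in>Aut L. \<sigma> x) = (\<Prod>\<sigma>\<in>Aut L. (\<tau> \<circ> \<sigma>) x)"
    unfolding comp_def by (rule emb.emb_prod[OF Aut_emb[OF \<tau>] Aut_in[OF _ assms]])
  also have "\<dots> = (\<Prod>\<sigma>\<in>Aut L. \<sigma> x)"
    by (rule prod.reindex_bij_betw[OF bij_compose_Aut[OF \<tau>], of "\<lambda>\<sigma>. \<sigma> x"])
  finally show "\<tau> (\<Prod>\<sigma>\<in>Aut L. \<sigma> x) = (\<Prod>\<sigma>\<in>Aut L. \<sigma> x)" .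
qed

lemma O_iff: "x \<in> \<O> \<longleftrightarrow> x \<in> L \<and> algebraic_int x"
  by (simp add: ring_of_integers_def)

lemma int_subring_O: "int_subring \<O>"
  unfolding int_subring_def ring_of_integers_def
  using subfield_CD[OF L] by (auto intro: algebraic_int_add algebraic_int_mult)

lemma Aut_O: "\<sigma> \<in> Aut L \<Longrightarrow> x \<in> \<O> \<Longrightarrow> \<sigma> x \<in> \<O>"
  using Aut_in emb.emb_algebraic_int[OF Aut_emb] by (auto simp: O_iff)

lemma O_rat_Ints: "x \<in> \<O> \<Longrightarrow> x \<in> \<rat> \<Longrightarrow> x \<in> \<int>"
  using rational_algebraic_int_is_int by (auto simp: O_iff)

lemma trace_Ints: "x \<in> \<O> \<Longrightarrow> (\<Sum>\<sigma>\<in>Aut L. \<sigma> x) \<in> \<int>"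
  by (rule O_rat_Ints[OF int_subring_sum[OF int_subring_O]])
     (erule Aut_O, assumption, simp add: O_iff trace_rat)

lemma norm_Ints: "x \<in> \<O> \<Longrightarrow> (\<Prod>\<sigma>\<in>Aut L. \<sigma> x) \<in> \<int>"
  by (rule O_rat_Ints[OF int_subring_prod[OF int_subring_O]])
     (erule Aut_O, assumption, simp add: O_iff norm_rat)

section \<open>A criterion for a prime to be unramified\<close>

lemma separated_conjugate_diffs:
  assumes "finite A" "A \<subseteq> Aut L" "\<And>\<tau>. \<tau> \<in> A \<Longrightarrow> b \<tau> \<in> \<O>"
  shows "\<exists>ps. set ps \<subseteq> \<O> \<times> \<O> \<and>
    (\<forall>\<sigma>\<in>Aut L. (\<Prod>\<tau>\<in>A. \<tau> (b \<tau>) - \<sigma> (b \<tau>)) = (\<Sum>(x,y)\<leftarrow>ps. x * \<sigma> y))"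
  using assms
proof (induction A rule: finite_induct)
  case empty
  show ?case
    using int_subringD(1)[OF int_subring_O]
    by (intro exI[of _ "[(1,1)]"]) (auto simp: emb.emb_one[OF Aut_emb])
next
  case (insert t A)
  obtain ps where ps: "set ps \<subseteq> \<O> \<times> \<O>"
    "\<And>\<sigma>. \<sigma> \<in> Aut L \<Longrightarrow> (\<Prod>\<tau>\<in>A. \<tau> (b \<tau>) - \<sigma> (b \<tau>)) = (\<Sum>(x,y)\<leftarrow>ps. x * \<sigma> y)" using insert by auto
  have t: "t \<in> Aut L" "b t \<in> \<O>" "t (b t) \<in> \<O>" using insert.prems Aut_O by auto
  let ?f = "\<lambda>(x,y). (t (b t) * x, y)" and ?g = "\<lambda>(x,y). (- x, b t * y)"
  have "set (map ?f ps @ map ?g ps) \<subseteq> \<O> \<times> \<O>"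
    using ps(1) t by (auto intro!: int_subringD(5,6)[OF int_subring_O])
  moreover have "(\<Sum>(x,y)\<leftarrow>map ?f ps @ map ?g ps. x * \<sigma> y) = (t (b t) - \<sigma> (b t)) * (\<Sum>(x,y)\<leftarrow>ps. x * \<sigma> y)"
    if \<sigma>: "\<sigma> \<in> Aut L" for \<sigma>
    using ps(1)
  proof (induction ps)
    case (Cons q ps)
    obtain x y where q: "q = (x,y)" by force
    have "\<sigma> (b t * y) = \<sigma> (b t) * \<sigma> y"
      using Cons.prems t q by (intro emb.emb_mult[OF Aut_emb[OF \<sigma>]]) (auto simp: O_iff)
    then show ?case using Cons by (simp add: q algebra_simps)
  qed simp
  ultimately show ?case using insert(1,2) ps(2)
    by (intro exI[of _ "map ?f ps @ map ?g ps"]) simp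
qed

text \<open>The orbit of \<open>x\<close> under the finite group is finite, so some positive power
  \<open>\<sigma> ^^ m\<close> fixes \<open>x\<close>. Thus \<sigma> x is carried into
  \<open>P\<close> by m - 1 further applications, and \<open>down\<close> undoes these one at a
  time. Contrapositively, an automorphism that moves \<open>P\<close> out of itself also moves some
  element from outside \<open>P\<close> into \<open>P\<close>.\<close>

lemma Aut_preserves_prime:
  assumes P: "prime_ideal_of \<O> P" and \<sigma>: "\<sigma> \<in> Aut L" and down: "\<And>j. j \<in> \<O> \<Longrightarrow> \<sigma> j \<in> P \<Longrightarrow> j \<in> P"
    and x: "x \<in> P"
  shows "\<sigma> x \<in> P"
proof -
  interpret prime_ideal_in \<O> P using P int_subring_O by unfold_locales
  have xO: "x \<in> \<O>" using x by (rule P_R)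
  have pow: "\<sigma> ^^ k \<in> Aut L" for k by (induction k) (simp_all only: funpow.simps id_Aut compose_Aut[OF \<sigma>])
  have "(\<lambda>k. (\<sigma> ^^ k) x) ` UNIV \<subseteq> (\<lambda>\<tau>. \<tau> x) ` Aut L" using pow by auto
  then have "finite (range (\<lambda>k. (\<sigma> ^^ k) x))" using fin_Aut by (meson finite_imageI finite_subset)
  then have "\<not> inj (\<lambda>k. (\<sigma> ^^ k) x)" using finite_imageD infinite_UNIV_nat by blast
  then obtain i k where ik: "i < k" "(\<sigma> ^^ i) x = (\<sigma> ^^ k) x"
    by (metis (no_types, lifting) injI linorder_neqE_nat)
  define m where "m = k - i"
  have "(\<sigma> ^^ i) ((\<sigma> ^^ m) x) = (\<sigma> ^^ i) x"
    using ik by (simp add: m_def funpow_add[symmetric, unfolded o_def, THEN fun_cong] flip: funpow_add comp_apply[of "\<sigma> ^^ i"])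
  then have mx: "(\<sigma> ^^ m) x = x"
    using emb.emb_inj[OF Aut_emb[OF pow]] Aut_in[OF pow] xO by (auto simp: O_iff dest: inj_onD)
  have "m > 0" using ik by (simp add: m_def)
  then have "(\<sigma> ^^ (m - 1)) (\<sigma> x) = x" using mx by (cases m) (simp_all add: funpow_swap1)
  then have "(\<sigma> ^^ (m - 1)) (\<sigma> x) \<in> P" using x by simp
  moreover have "(\<sigma> ^^ l) z \<in> P \<Longrightarrow> z \<in> P" if "z \<in> \<O>" for l z
    by (induction l) (auto intro: down Aut_O[OF pow] that)
  ultimately show ?thesis using Aut_O[OF \<sigma> xO] by blast
qed

text \<open>An element \<open>x\<close> all of whose conjugates lie in \<open>P\<close> is divisible by \<open>p\<close>, as \<open>D x\<close> is a combination of
  traces of multiples of \<open>x\<close>. Choose \<open>j\<close> outside \<open>P\<close> such that this applies to \<open>x j\<close> for every \<open>x \<in> P\<close>.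
  If \<open>p = \<Sum> u\<^sub>i v\<^sub>i\<close> with \<open>u\<^sub>i, v\<^sub>i \<in> P\<close>, then \<open>p j\<^sup>2 = \<Sum> (u\<^sub>i j) (v\<^sub>i j)\<close> is divisible by \<open>p\<^sup>2\<close>, so that
  \<open>j\<^sup>2 \<in> P\<close>.\<close>
lemma unramified_criterion:
  assumes p: "prime p" and b: "\<And>\<tau>. \<tau> \<in> Aut L - {id} \<Longrightarrow> b \<tau> \<in> \<O>"
    and D: "of_int D = (\<Prod>\<tau>\<in>Aut L - {id}. \<tau> (b \<tau>) - b \<tau>) * e" "e \<in> \<O>" "\<not> int p dvd D"
  shows "\<not> ramified_at p L"
proof
  assume "ramified_at p L"
  then obtain P where P: "prime_ideal_of \<O> P" and sub: "{of_nat p * x | x. x \<in> \<O>} \<subseteq> ideal_prod P P"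
    by (auto simp: ramified_at_def)
  interpret prime_ideal_in \<O> P using P int_subring_O by unfold_locales
  note Oc = int_subringD[OF int_subring_O]
  have "of_nat p * 1 \<in> ideal_prod P P" using sub Oc(1) by blast
  then obtain k :: nat and u v where kuv: "of_nat p = (\<Sum>i<k. u i * v i)" "\<And>i. i < k \<Longrightarrow> u i \<in> P \<and> v i \<in> P"
    unfolding ideal_prod_def by auto
  have pP: "of_nat p \<in> P" unfolding kuv(1) using kuv(2) P_R by (intro P_sum P_mult) auto
  have p0: "p \<noteq> 0" using p by auto
  have divisible: "\<exists>y\<in>\<O>. x = of_nat p * y" if x: "x \<in> \<O>" "\<And>\<sigma>. \<sigma> \<in> Aut L \<Longrightarrow> \<sigma> x \<in> P" for x
  proof -
    let ?\<delta> = "\<Prod>\<tau>\<in>Aut L - {id}. \<tau> (b \<tau>) - b \<tau>"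
    obtain ps where ps: "set ps \<subseteq> \<O> \<times> \<O>"
      "\<And>\<sigma>. \<sigma> \<in> Aut L \<Longrightarrow> (\<Prod>\<tau>\<in>Aut L - {id}. \<tau> (b \<tau>) - \<sigma> (b \<tau>)) = (\<Sum>(x,y)\<leftarrow>ps. x * \<sigma> y)"
      using separated_conjugate_diffs[of "Aut L - {id}" b] fin_Aut b by auto
    \<comment> \<open>The separated product at \<sigma> equals \<open>?\<delta>\<close> for \<sigma>
      = id, and otherwise it contains the vanishing factor with \<tau> = \<sigma>. Summing over all
      \<sigma> thus isolates \<open>x\<close> and leaves traces on the other side.\<close>
    have "?\<delta> * x = (\<Sum>\<sigma>\<in>Aut L. if \<sigma> = id then ?\<delta> * \<sigma> x else 0)"
      using fin_Aut id_Aut by simp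
    also have "\<dots> = (\<Sum>\<sigma>\<in>Aut L. (\<Sum>(x,y)\<leftarrow>ps. x * \<sigma> y) * \<sigma> x)"
    proof (intro sum.cong refl)
      fix \<sigma> assume \<sigma>: "\<sigma> \<in> Aut L"
      show "(if \<sigma> = id then ?\<delta> * \<sigma> x else 0) = (\<Sum>(x,y)\<leftarrow>ps. x * \<sigma> y) * \<sigma> x"
      proof (cases "\<sigma> = id")
        case True
        then show ?thesis using ps(2)[OF \<sigma>] by simp
      next
        case False
        then have "(\<Prod>\<tau>\<in>Aut L - {id}. \<tau> (b \<tau>) - \<sigma> (b \<tau>)) = 0"
          using \<sigma> fin_Aut by (intro prod_zero) auto
        then show ?thesis using ps(2)[OF \<sigma>] False by simp
      qed
    qed
    also have "\<dots> = (\<Sum>(z,y)\<leftarrow>ps. z * (\<Sum>\<sigma>\<in>Aut L. \<sigma> (y * x)))" using ps(1)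
    proof (induction ps)
      case (Cons q ps)
      obtain z y where q: "q = (z,y)" by force
      have "\<sigma> (y * x) = \<sigma> y * \<sigma> x" if "\<sigma> \<in> Aut L" for \<sigma>
        using Cons.prems x q by (intro emb.emb_mult[OF Aut_emb[OF that]]) (auto simp: O_iff)
      then show ?case using Cons by (simp add: q distrib_right sum.distrib sum_distrib_left mult.assoc)
    qed simp
    finally have dx: "?\<delta> * x = (\<Sum>(z,y)\<leftarrow>ps. z * (\<Sum>\<sigma>\<in>Aut L. \<sigma> (y * x)))" .
    have tr: "\<exists>t. (\<Sum>\<sigma>\<in>Aut L. \<sigma> (y * x)) = of_nat p * of_int t" if y: "y \<in> \<O>" for y
    proof -
      have "(\<Sum>\<sigma>\<in>Aut L. \<sigma> (y * x)) \<in> \<int>" using y x Oc(5) by (intro trace_Ints) auto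
      then obtain t where t: "(\<Sum>\<sigma>\<in>Aut L. \<sigma> (y * x)) = of_int t" by (auto simp: Ints_def)
      have "\<sigma> (y * x) \<in> P" if "\<sigma> \<in> Aut L" for \<sigma>
      proof -
        have "\<sigma> (y * x) = \<sigma> y * \<sigma> x"
          using y x by (intro emb.emb_mult[OF Aut_emb[OF that]]) (auto simp: O_iff)
        then show ?thesis using P_mult[OF Aut_O[OF that y] x(2)[OF that]] by simp
      qed
      then have "of_int t \<in> P" unfolding t[symmetric] by (rule P_sum)
      then have "int p dvd t" by (rule P_int[OF p pP])
      then show ?thesis using t by auto
    qed
    have "\<exists>w\<in>\<O>. (\<Sum>(z,y)\<leftarrow>ps. z * (\<Sum>\<sigma>\<in>Aut L. \<sigma> (y * x))) = of_nat p * w" using ps(1)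
    proof (induction ps)
      case Nil
      then show ?case using Oc(2) by auto
    next
      case (Cons q ps)
      obtain z y where q: "q = (z,y)" "z \<in> \<O>" "y \<in> \<O>" using Cons.prems by force
      obtain w where w: "w \<in> \<O>" "(\<Sum>(z,y)\<leftarrow>ps. z * (\<Sum>\<sigma>\<in>Aut L. \<sigma> (y * x))) = of_nat p * w" using Cons by auto
      obtain t where t: "(\<Sum>\<sigma>\<in>Aut L. \<sigma> (y * x)) = of_nat p * of_int t" using tr[OF q(3)] by blast
      show ?case
        by (rule bexI[of _ "z * of_int t + w"])
           (auto simp: q(1) w(2) t distrib_left intro!: Oc(4,5) q w int_subring_of_int[OF int_subring_O])
    qed
    then obtain w where w: "w \<in> \<O>" "?\<delta> * x = of_nat p * w" using dx by auto
    \<comment> \<open>\<open>D\<close> is invertible modulo \<open>p\<close> and a multiple of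
      \<open>?\<delta>\<close>, so divisibility passes from \<delta> x to \<open>x\<close>.\<close>
    have "coprime (int p) D" using p D(3) by (simp add: prime_imp_coprime)
    then obtain r s where rs: "r * int p + s * D = 1" by (metis bezout_int coprime_iff_gcd_eq_1)
    have "x = of_int (r * int p + s * D) * x" using rs by simp
    also have "\<dots> = of_nat p * (of_int r * x) + of_int s * (of_int D * x)" by (simp add: algebra_simps)
    also have "of_int D * x = of_nat p * (e * w)" using w(2) unfolding D(1) by (simp add: mult_ac)
    also have "of_nat p * (of_int r * x) + of_int s * (of_nat p * (e * w)) = of_nat p * (of_int r * x + of_int s * (e * w))"
      by (simp add: algebra_simps)
    finally have "x = of_nat p * (of_int r * x + of_int s * (e * w))" .
    moreover have "of_int r * x + of_int s * (e * w) \<in> \<O>"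
      using x w D by (intro Oc(4,5) int_subring_of_int[OF int_subring_O])
    ultimately show ?thesis by blast
  qed
  \<comment> \<open>The automorphisms outside the decomposition group of \<open>P\<close>. Each
    supplies a factor outside \<open>P\<close> that it carries into \<open>P\<close>; the product
    \<open>j\<close> of these factors stays outside \<open>P\<close>, and the conjugates of x j lie
    in \<open>P\<close> for every \<open>x\<close> in \<open>P\<close>.\<close>
  define B where "B = {\<sigma>\<in>Aut L. \<exists>x\<in>P. \<sigma> x \<notin> P}"
  have fB: "finite B" using fin_Aut by (simp add: B_def)
  have "\<forall>\<sigma>\<in>B. \<exists>j. j \<in> \<O> \<and> \<sigma> j \<in> P \<and> j \<notin> P"
    using Aut_preserves_prime[OF P] by (auto simp: B_def)
  from bchoice[OF this] obtain J where J': "\<forall>\<sigma>\<in>B. J \<sigma> \<in> \<O> \<and> \<sigma> (J \<sigma>) \<in> P \<and> J \<sigma> \<notin> P" ..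
  have J: "J \<sigma> \<in> \<O>" "\<sigma> (J \<sigma>) \<in> P" "J \<sigma> \<notin> P" if "\<sigma> \<in> B" for \<sigma>
    using bspec[OF J' that] by simp_all
  define j where "j = (\<Prod>\<sigma>\<in>B. J \<sigma>)"
  have jO: "j \<in> \<O>" unfolding j_def by (rule int_subring_prod[OF int_subring_O J(1)])
  have jP: "j \<notin> P"
  proof
    assume "j \<in> P"
    then have "\<exists>\<sigma>\<in>B. J \<sigma> \<in> P" unfolding j_def using P_prod[OF fB, of J] J(1) by blast
    then show False using J(3) by blast
  qed
  have conj: "\<sigma> (x * j) \<in> P" if x: "x \<in> P" and \<sigma>: "\<sigma> \<in> Aut L" for x \<sigma>
  proof -
    have xL: "x \<in> L" "j \<in> L" using P_R[OF x] jO by (auto simp: O_iff)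
    have e: "\<sigma> (x * j) = \<sigma> x * \<sigma> j" by (rule emb.emb_mult[OF Aut_emb[OF \<sigma>] xL])
    show ?thesis
    proof (cases "\<sigma> \<in> B")
      case False
      then have "\<sigma> x \<in> P" using x \<sigma> by (auto simp: B_def)
      then show ?thesis unfolding e by (rule P_mult2[OF Aut_O[OF \<sigma> jO]])
    next
      case True
      have "\<sigma> j = (\<Prod>\<tau>\<in>B. \<sigma> (J \<tau>))" unfolding j_def
        using J(1) by (intro emb.emb_prod[OF Aut_emb[OF \<sigma>]]) (auto simp: O_iff)
      also have "\<dots> = \<sigma> (J \<sigma>) * (\<Prod>\<tau>\<in>B - {\<sigma>}. \<sigma> (J \<tau>))" by (rule prod.remove[OF fB True])
      also have "\<dots> \<in> P"
        using J(1) by (intro P_mult2 J(2)[OF True] int_subring_prod[OF int_subring_O] Aut_O[OF \<sigma>]) auto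
      finally show ?thesis unfolding e by (rule P_mult[OF Aut_O[OF \<sigma> P_R[OF x]]])
    qed
  qed
  have "\<forall>x\<in>P. \<exists>y. y \<in> \<O> \<and> x * j = of_nat p * y"
    using divisible conj Oc(5)[OF P_R jO] by blast
  from bchoice[OF this] obtain g where g: "\<And>x. x \<in> P \<Longrightarrow> g x \<in> \<O>" "\<And>x. x \<in> P \<Longrightarrow> x * j = of_nat p * g x" by blast
  have "of_nat p * (j * j) = (\<Sum>i<k. (u i * j) * (v i * j))"
    unfolding kuv(1) by (simp add: sum_distrib_right sum_distrib_left mult_ac)
  also have "\<dots> = (\<Sum>i<k. of_nat p * (of_nat p * (g (u i) * g (v i))))"
  proof (intro sum.cong refl)
    fix i assume "i \<in> {..<k}"
    then have "u i * j = of_nat p * g (u i)" "v i * j = of_nat p * g (v i)" using g(2) kuv(2) by auto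
    then show "(u i * j) * (v i * j) = of_nat p * (of_nat p * (g (u i) * g (v i)))" by (simp only: mult_ac)
  qed
  also have "\<dots> = of_nat p * (of_nat p * (\<Sum>i<k. g (u i) * g (v i)))" by (simp add: sum_distrib_left)
  finally have "j * j = of_nat p * (\<Sum>i<k. g (u i) * g (v i))" using p0 by simp
  also have "\<dots> \<in> P" using g(1) kuv(2) by (intro P_mult2 pP int_subring_sum[OF int_subring_O] Oc(5)) auto
  finally show False using P_prime[OF jO jO] jP by blast
qed

text \<open>The norm of a product of differences \<open>\<tau> (b \<tau>) - b \<tau>\<close>, with
  each integer \<open>b \<tau>\<close> moved by \<tau>, is a nonzero integer divisible by every
  ramified prime. Finiteness is essential for \<open>num_ramified\<close>, because
  \<open>card\<close> of an infinite set is 0.\<close>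

lemma finite_ramified: "finite {p::nat. prime p \<and> ramified_at p L}"
proof -
  have "\<forall>\<tau>\<in>Aut L - {id}. \<exists>b. b \<in> \<O> \<and> \<tau> b \<noteq> b"
  proof
    fix \<tau> assume \<tau>: "\<tau> \<in> Aut L - {id}"
    then obtain x where x: "x \<in> L" "\<tau> x \<noteq> x" using Aut_eqI[OF _ id_Aut, of \<tau>] by auto
    obtain d where d: "d > 0" "algebraic_int (of_nat d * x)"
      using number_field_integral_multiple[OF number_field_L x(1)] by blast
    have "\<tau> (of_nat d * x) = of_nat d * \<tau> x"
      using \<tau> emb.emb_mult[OF Aut_emb, of \<tau> "of_nat d" x] emb.emb_of_nat[OF Aut_emb, of \<tau> d] x subfield_C_of_nat[OF L] by simp
    then have "\<tau> (of_nat d * x) \<noteq> of_nat d * x" using x d by simp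
    moreover have "of_nat d * x \<in> \<O>" using d x by (auto simp: O_iff intro: subfield_CD(4)[OF L] subfield_C_of_nat[OF L])
    ultimately show "\<exists>b. b \<in> \<O> \<and> \<tau> b \<noteq> b" by blast
  qed
  from bchoice[OF this] obtain b where b': "\<forall>\<tau>\<in>Aut L - {id}. b \<tau> \<in> \<O> \<and> \<tau> (b \<tau>) \<noteq> b \<tau>" ..
  have b: "b \<tau> \<in> \<O>" "\<tau> (b \<tau>) \<noteq> b \<tau>" if "\<tau> \<in> Aut L - {id}" for \<tau>
    using bspec[OF b' that] by simp_all
  let ?\<delta> = "\<Prod>\<tau>\<in>Aut L - {id}. \<tau> (b \<tau>) - b \<tau>"
  have \<delta>O: "?\<delta> \<in> \<O>"
    using b(1) Aut_O by (intro int_subring_prod[OF int_subring_O] int_subringD(7)[OF int_subring_O]) auto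
  have \<delta>0: "?\<delta> \<noteq> 0" using b(2) fin_Aut by (subst prod_zero_iff) auto
  obtain D where D: "(\<Prod>\<sigma>\<in>Aut L. \<sigma> ?\<delta>) = of_int D" using norm_Ints[OF \<delta>O] by (auto simp: Ints_def)
  have "\<sigma> ?\<delta> \<noteq> 0" if "\<sigma> \<in> Aut L" for \<sigma>
    using emb.emb_inj[OF Aut_emb[OF that]] emb.emb_zero[OF Aut_emb[OF that]] \<delta>0 \<delta>O subfield_CD(1)[OF L]
    by (metis (no_types, lifting) O_iff inj_onD)
  then have "(\<Prod>\<sigma>\<in>Aut L. \<sigma> ?\<delta>) \<noteq> 0" using fin_Aut by (subst prod_zero_iff) auto
  then have D0: "D \<noteq> 0" using D by auto
  have "(\<Prod>\<sigma>\<in>Aut L. \<sigma> ?\<delta>) = id ?\<delta> * (\<Prod>\<sigma>\<in>Aut L - {id}. \<sigma> ?\<delta>)" by (rule prod.remove[OF fin_Aut id_Aut])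
  then have "of_int D = ?\<delta> * (\<Prod>\<sigma>\<in>Aut L - {id}. \<sigma> ?\<delta>)" unfolding D by simp
  moreover have "(\<Prod>\<sigma>\<in>Aut L - {id}. \<sigma> ?\<delta>) \<in> \<O>"
    using \<delta>O Aut_O by (intro int_subring_prod[OF int_subring_O]) auto
  ultimately have "int p dvd D" if "prime p" "ramified_at p L" for p
    using unramified_criterion[of p b D "\<Prod>\<sigma>\<in>Aut L - {id}. \<sigma> ?\<delta>"] b(1) that by blast
  then have "{p::nat. prime p \<and> ramified_at p L} \<subseteq> {p. int p dvd D}" by auto
  moreover have "finite {p. int p dvd D}"
  proof (rule finite_subset)
    show "{p. int p dvd D} \<subseteq> {..nat \<bar>D\<bar>}"
    proof
      fix q assume "q \<in> {p. int p dvd D}"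
      then have "int q \<le> \<bar>D\<bar>" using D0 by (intro zdvd_imp_le) auto
      then show "q \<in> {..nat \<bar>D\<bar>}" by simp
    qed
  qed simp
  ultimately show ?thesis by (rule finite_subset)
qed

section \<open>The quadratic subfield and its ramified primes\<close>

lemma Aut_independent:
  assumes "finite A" "A \<subseteq> Aut L" "\<And>x. x \<in> L \<Longrightarrow> (\<Sum>\<sigma>\<in>A. c \<sigma> * \<sigma> x) = 0" "\<sigma> \<in> A"
  shows "c \<sigma> = 0"
  using assms
proof (induction A arbitrary: c \<sigma> rule: finite_induct)
  case (insert \<tau> A)
  have \<tau>: "\<tau> \<in> Aut L" using insert.prems by blast
  have zero: "c \<sigma> = 0" if \<sigma>: "\<sigma> \<in> A" for \<sigma>
  proof -
    have "\<sigma> \<noteq> \<tau>" using \<sigma> insert.hyps by blast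
    then obtain z where z: "z \<in> L" "\<sigma> z \<noteq> \<tau> z" using Aut_eqI[of \<sigma> \<tau>] insert.prems(1) \<sigma> \<tau> by blast
    \<comment> \<open>Dedekind's argument: replace x by z x, where \<open>z\<close> separates
      \<sigma> from \<tau>, and subtract \<open>\<tau> z\<close> times the original relation. The
      term of \<tau> cancels, which leaves a relation over \<open>A\<close>.\<close>
    have "c \<sigma> * (\<sigma> z - \<tau> z) = 0"
    proof (rule insert.IH[of "\<lambda>\<sigma>. c \<sigma> * (\<sigma> z - \<tau> z)" \<sigma>])
      show "A \<subseteq> Aut L" using insert.prems by blast
      fix x assume x: "x \<in> L"
      have 1: "c \<tau> * \<tau> x + (\<Sum>\<sigma>\<in>A. c \<sigma> * \<sigma> x) = 0" using insert.prems(2)[OF x] insert.hyps by simp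
      have "c \<tau> * \<tau> (z * x) + (\<Sum>\<sigma>\<in>A. c \<sigma> * \<sigma> (z * x)) = 0"
        using insert.prems(2)[OF subfield_CD(4)[OF L z(1) x]] insert.hyps by simp
      moreover have "\<sigma> (z * x) = \<sigma> z * \<sigma> x" if "\<sigma> \<in> insert \<tau> A" for \<sigma>
        using that insert.prems(1) z x by (intro emb.emb_mult[OF Aut_emb]) auto
      ultimately have "c \<tau> * (\<tau> z * \<tau> x) + (\<Sum>\<sigma>\<in>A. c \<sigma> * (\<sigma> z * \<sigma> x)) = 0" by simp
      then have "c \<tau> * (\<tau> z * \<tau> x) + (\<Sum>\<sigma>\<in>A. c \<sigma> * (\<sigma> z * \<sigma> x))
         - \<tau> z * (c \<tau> * \<tau> x + (\<Sum>\<sigma>\<in>A. c \<sigma> * \<sigma> x)) = 0" unfolding 1 by simp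
      then show "(\<Sum>\<sigma>\<in>A. c \<sigma> * (\<sigma> z - \<tau> z) * \<sigma> x) = 0"
        by (simp add: algebra_simps sum_subtractf sum_distrib_left)
    qed (rule \<sigma>)
    then show ?thesis using z by simp
  qed
  have "c \<tau> = 0"
  proof -
    have "(\<Sum>\<sigma>\<in>A. c \<sigma> * \<sigma> 1) = 0" by (rule sum.neutral) (simp add: zero)
    then show ?thesis
      using insert.prems(2)[OF subfield_CD(2)[OF L]] insert.hyps(1,2) emb.emb_one[OF Aut_emb[OF \<tau>]] by simp
  qed
  then show ?case using insert.prems(3) zero by (elim insertE) simp_all
qed simp

lemma quadratic_character_element:
  assumes \<chi>: "\<And>\<sigma> \<tau>. \<sigma> \<in> Aut L \<Longrightarrow> \<tau> \<in> Aut L \<Longrightarrow> \<chi> (\<sigma> \<circ> \<tau>) = \<chi> \<sigma> * \<chi> \<tau>"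
    and val: "\<And>\<sigma>. \<sigma> \<in> Aut L \<Longrightarrow> \<chi> \<sigma> = 1 \<or> \<chi> \<sigma> = (- 1 :: complex)"
    and nontriv: "\<sigma>0 \<in> Aut L" "\<chi> \<sigma>0 = - 1"
  shows "\<exists>y\<in>L. y \<notin> \<rat> \<and> y\<^sup>2 \<in> \<rat>"
proof -
  have "\<exists>x\<in>L. (\<Sum>\<sigma>\<in>Aut L. \<chi> \<sigma> * \<sigma> x) \<noteq> 0"
    using Aut_independent[OF fin_Aut order_refl, of \<chi> \<sigma>0] nontriv by auto
  then obtain x where x: "x \<in> L" "(\<Sum>\<sigma>\<in>Aut L. \<chi> \<sigma> * \<sigma> x) \<noteq> 0" by blast
  \<comment> \<open>A Lagrange resolvent: the automorphism \<tau> multiplies it by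
    \<open>\<chi> \<tau>\<close>, so \<open>y\<close> is moved by \<open>\<sigma>0\<close> while its
    square is fixed by all. Independence of the automorphisms provides an \<open>x\<close> for which
    it does not vanish.\<close>
  define y where "y = (\<Sum>\<sigma>\<in>Aut L. \<chi> \<sigma> * \<sigma> x)"
  have \<chi>rat: "\<chi> \<sigma> \<in> \<rat>" if "\<sigma> \<in> Aut L" for \<sigma> using val[OF that] by auto
  have inL: "\<chi> \<sigma> * \<sigma> x \<in> L" if "\<sigma> \<in> Aut L" for \<sigma>
    using that x Aut_in \<chi>rat subfield_C_Rats[OF L] by (intro subfield_CD(4)[OF L]) auto
  have yL: "y \<in> L" unfolding y_def using inL by (intro subfield_C_sum[OF L])
  have act: "\<tau> y = \<chi> \<tau> * y" if \<tau>: "\<tau> \<in> Aut L" for \<tau>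
  proof -
    interpret emb L \<tau> by (rule Aut_emb[OF \<tau>])
    have "\<tau> y = (\<Sum>\<sigma>\<in>Aut L. \<tau> (\<chi> \<sigma> * \<sigma> x))" unfolding y_def using inL by (rule emb_sum)
    also have "\<dots> = (\<Sum>\<sigma>\<in>Aut L. \<chi> \<tau> * (\<chi> (\<tau> \<circ> \<sigma>) * (\<tau> \<circ> \<sigma>) x))"
    proof (intro sum.cong refl)
      fix \<sigma> assume \<sigma>: "\<sigma> \<in> Aut L"
      have "\<tau> (\<chi> \<sigma> * \<sigma> x) = \<chi> \<sigma> * \<tau> (\<sigma> x)"
        using emb_mult[OF subfield_C_Rats[OF L \<chi>rat[OF \<sigma>]] Aut_in[OF \<sigma> x(1)]] emb_Rats[OF \<chi>rat[OF \<sigma>]] by simp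
      also have "\<dots> = \<chi> \<tau> * (\<chi> (\<tau> \<circ> \<sigma>) * (\<tau> \<circ> \<sigma>) x)"
        using val[OF \<tau>] unfolding \<chi>[OF \<tau> \<sigma>] by auto
      finally show "\<tau> (\<chi> \<sigma> * \<sigma> x) = \<chi> \<tau> * (\<chi> (\<tau> \<circ> \<sigma>) * (\<tau> \<circ> \<sigma>) x)" .
    qed
    also have "\<dots> = \<chi> \<tau> * (\<Sum>\<sigma>\<in>Aut L. \<chi> (\<tau> \<circ> \<sigma>) * (\<tau> \<circ> \<sigma>) x)" by (simp add: sum_distrib_left)
    also have "(\<Sum>\<sigma>\<in>Aut L. \<chi> (\<tau> \<circ> \<sigma>) * (\<tau> \<circ> \<sigma>) x) = y"
      unfolding y_def by (rule sum.reindex_bij_betw[OF bij_compose_Aut[OF \<tau>], of "\<lambda>\<sigma>. \<chi> \<sigma> * \<sigma> x"])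
    finally show ?thesis .
  qed
  have "y\<^sup>2 \<in> \<rat>"
  proof (rule Aut_fixed)
    show "y\<^sup>2 \<in> L" by (rule subfield_C_power[OF L yL])
    fix \<tau> assume \<tau>: "\<tau> \<in> Aut L"
    show "\<tau> (y\<^sup>2) = y\<^sup>2"
      using emb.emb_power[OF Aut_emb[OF \<tau>] yL, of 2] act[OF \<tau>] val[OF \<tau>] by (auto simp: power_mult_distrib)
  qed
  moreover have "y \<notin> \<rat>"
  proof
    assume "y \<in> \<rat>"
    then have "\<sigma>0 y = y" by (rule emb.emb_Rats[OF Aut_emb[OF nontriv(1)]])
    then show False using act[OF nontriv(1)] nontriv x by (simp add: y_def)
  qed
  ultimately show ?thesis using yL by blast
qed

text \<open>Write d = p m with \<open>m\<close> prime to \<open>p\<close> and r p + s m = 1. A prime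
  ideal \<open>P\<close> above \<open>p\<close> contains \<open>y\<close>, and multiplying by
  \<open>p\<close> gives p = r p p + s y y, which lies in the square of \<open>P\<close>.\<close>

lemma ramified_if_squarefree_sqrt:
  assumes y: "y \<in> L" "y\<^sup>2 = of_nat d" and d: "squarefree d" and p: "prime p" "p dvd d"
  shows "ramified_at p L"
proof -
  have "algebraic_int y"
    by (rule algebraic_int_root[of "y\<^sup>2" "monom 1 2"]) (auto simp: y(2) poly_monom degree_monom_eq)
  then have yO: "y \<in> \<O>" using y by (simp add: O_iff)
  obtain m where m: "d = p * m" using p(2) by blast
  have "coprime p m" 
  proof (rule ccontr)
    assume "\<not> coprime p m"
    then have "p dvd m" using p(1) prime_imp_coprime by blast
    then have "p\<^sup>2 dvd d" unfolding m power2_eq_square by (intro mult_dvd_mono) auto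
    then show False using d p(1) unfolding squarefree_def by auto
  qed
  then have "coprime (int p) (int m)" by simp
  then obtain r s where rs: "r * int p + s * int m = 1" by (metis bezout_int coprime_iff_gcd_eq_1)
  obtain P where P: "prime_ideal_of \<O> P" "of_nat p \<in> P" by (rule prime_ideal_exists[OF int_subring_O p(1)])
  interpret prime_ideal_in \<O> P using P(1) int_subring_O by unfold_locales
  note Oc = int_subringD[OF int_subring_O]
  have "y\<^sup>2 = of_nat m * of_nat p" by (simp add: y(2) m)
  then have "y\<^sup>2 \<in> P" using P_mult[OF int_subring_of_nat[OF int_subring_O] P(2), of m] by simp
  then have yP: "y \<in> P" using P_power[OF yO] by blast
  have "of_nat p * x \<in> ideal_prod P P" if x: "x \<in> \<O>" for x
  proof -
    define u v where "u = (\<lambda>i::nat. if i = 0 then of_int r * x * of_nat p else of_int s * x * y)"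
      and "v = (\<lambda>i::nat. if i = 0 then of_nat p else y)"
    have "of_nat p * x = of_nat p * x * of_int (r * int p + s * int m)" using rs by simp
    also have "\<dots> = (of_int r * x * of_nat p) * of_nat p + of_int s * x * (of_nat p * of_nat m)" by (simp add: algebra_simps)
    also have "of_nat p * of_nat m = y * y" using y(2) m by (simp add: power2_eq_square)
    finally have "of_nat p * x = (\<Sum>i<2. u i * v i)" by (simp add: u_def v_def numeral_2_eq_2)
    moreover have "\<forall>i<2. u i \<in> P \<and> v i \<in> P"
      using P(2) yP x by (auto simp: u_def v_def intro!: P_mult Oc(5) int_subring_of_int[OF int_subring_O])
    ultimately show ?thesis unfolding ideal_prod_def by blast
  qed
  then show ?thesis unfolding ramified_at_def using P(1) by blast
qed

lemma totally_real_subset: "totally_real L \<Longrightarrow> L \<subseteq> \<real>"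
  unfolding totally_real_def by (drule spec[of _ id]) (auto simp: field_emb_def)

text \<open>Clearing denominators and square factors replaces \<open>y\<close> by a square root of a
  squarefree integer. Total reality makes this integer a positive \<open>d\<close>, which excludes
  -1, and irrationality excludes 1; so \<open>d\<close> has a prime factor, and that prime
  ramifies.\<close>

lemma some_prime_ramifies:
  assumes tr: "totally_real L" and y: "y \<in> L" "y \<notin> \<rat>" "y\<^sup>2 \<in> \<rat>"
  shows "\<exists>p. prime p \<and> ramified_at p L"
proof -
  obtain a b where ab: "b > 0" "y\<^sup>2 = of_int a / of_int b" using y(3) by (rule Rats_cases')
  define z where "z = of_int b * y"
  have zL: "z \<in> L" unfolding z_def by (intro subfield_CD(4)[OF L] subfield_C_of_int[OF L] y)
  have "z\<^sup>2 = of_int b * of_int b * (of_int a / of_int b)"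
    unfolding z_def power_mult_distrib ab(2) by (simp add: power2_eq_square)
  then have z2: "z\<^sup>2 = of_int (a * b)" using ab(1) by simp
  have znR: "z \<notin> \<rat>"
  proof
    assume "z \<in> \<rat>"
    then have "z / of_int b \<in> \<rat>" by simp
    then show False using y(2) ab by (simp add: z_def)
  qed
  have "z \<in> \<real>" using totally_real_subset[OF tr] zL by blast
  then obtain r where r: "z = of_real r" by (auto elim: Reals_cases)
  have "of_real (r\<^sup>2) = (of_real (real_of_int (a * b)) :: complex)" using z2 r by simp
  then have "r\<^sup>2 = real_of_int (a * b)" by (simp only: of_real_eq_iff)
  then have "a * b \<ge> 0" by (metis of_int_0_le_iff zero_le_power2)
  then obtain m where m: "a * b = int m" by (metis nonneg_int_cases)
  have m0: "m \<noteq> 0"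
  proof
    assume "m = 0"
    then have "z = 0" using z2 m by simp
    then show False using znR by simp
  qed
  define s where "s = square_part m"
  define d where "d = squarefree_part m"
  have md: "m = d * s\<^sup>2" unfolding s_def d_def by (rule squarefree_decompose)
  then have s0: "s \<noteq> 0" using m0 by auto
  define w where "w = z / of_nat s"
  have "w \<in> L" unfolding w_def by (intro subfield_C_divide[OF L] zL subfield_C_of_nat[OF L])
  moreover have w2: "w\<^sup>2 = of_nat d" using z2 m md s0 by (simp add: w_def power_divide)
  moreover have "squarefree d" unfolding d_def by simp
  moreover have "d \<noteq> 1"
  proof
    assume "d = 1"
    then have "w = 1 \<or> w = -1" using w2 by (simp add: power2_eq_1_iff)
    then have "w * of_nat s \<in> \<rat>" by auto
    then show False using znR s0 by (simp add: w_def)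
  qed
  then obtain p where "prime p" "p dvd d" using prime_factor_nat by blast
  ultimately show ?thesis using ramified_if_squarefree_sqrt by blast
qed

end

lemma symmetric_galois_finite:
  assumes "galois_group L \<cong> sym_group n"
  shows "finite (Aut L)"
proof -
  obtain f where "bij_betw f (Aut L) {p. p permutes {1..n}}"
    using assms by (auto simp: is_iso_def iso_def galois_group_def sym_group_def)
  then show ?thesis using bij_betw_finite finite_permutations[of "{1..n}"] by blast
qed

lemma symmetric_galois_some_prime_ramifies:
  assumes "galois_over_Q L" "galois_group L \<cong> sym_group n" "n \<ge> 2" "totally_real L"
  shows "\<exists>p. prime p \<and> ramified_at p L"
proof -
  interpret finite_galois L
    using assms(1) symmetric_galois_finite[OF assms(2)] by unfold_locales
  obtain f where f: "f \<in> hom (galois_group L) (sym_group n)" "bij_betw f (Aut L) {p. p permutes {1..n}}"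
    using assms(2) by (auto simp: is_iso_def iso_def galois_group_def sym_group_def)
  define \<chi> where "\<chi> = (\<lambda>\<sigma>. complex_of_int (sign (f \<sigma>)))"
  have fperm: "permutation (f \<sigma>)" if "\<sigma> \<in> Aut L" for \<sigma>
  proof -
    have "f \<sigma> permutes {1..n}" using f(2) that by (auto simp: bij_betw_def)
    then show ?thesis unfolding permutation_permutes by auto
  qed
  have "f (\<sigma> \<circ> \<tau>) = f \<sigma> \<circ> f \<tau>" if "\<sigma> \<in> Aut L" "\<tau> \<in> Aut L" for \<sigma> \<tau>
    using hom_mult[OF f(1), of \<sigma> \<tau>] that by (simp add: galois_group_def sym_group_def)
  then have "\<chi> (\<sigma> \<circ> \<tau>) = \<chi> \<sigma> * \<chi> \<tau>" if "\<sigma> \<in> Aut L" "\<tau> \<in> Aut L" for \<sigma> \<tau>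
    using that sign_compose[OF fperm fperm] by (simp add: \<chi>_def)
  moreover have "\<chi> \<sigma> = 1 \<or> \<chi> \<sigma> = - 1" for \<sigma> by (simp add: \<chi>_def sign_def)
  moreover have "- 1 \<in> sign ` carrier (sym_group n)"
    using sign_is_surj[OF assms(3)] by (simp add: sign_img_def)
  then obtain \<pi> where \<pi>: "\<pi> permutes {1..n}" "sign \<pi> = -1"
    by (metis imageE sym_group_carrier)
  have "\<pi> \<in> f ` Aut L" using \<pi>(1) f(2) by (simp add: bij_betw_def)
  then obtain \<sigma>0 where "\<sigma>0 \<in> Aut L" "\<chi> \<sigma>0 = - 1" using \<pi>(2) by (auto simp: \<chi>_def)
  ultimately obtain y where "y \<in> L" "y \<notin> \<rat>" "y\<^sup>2 \<in> \<rat>"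
    using quadratic_character_element[of \<chi> \<sigma>0] by blast
  then show ?thesis using some_prime_ramifies[OF assms(4)] by blast
qed

lemma symmetric_galois_num_ramified_pos:
  assumes "galois_over_Q L" "galois_group L \<cong> sym_group n" "n \<ge> 2"
  shows "num_ramified L \<ge> 1"
proof (cases "totally_real L")
  case True
  interpret finite_galois L
    using assms(1) symmetric_galois_finite[OF assms(2)] by unfold_locales
  have "{p::nat. prime p \<and> ramified_at p L} \<noteq> {}"
    using symmetric_galois_some_prime_ramifies[OF assms True] by blast
  then have "card {p::nat. prime p \<and> ramified_at p L} > 0"
    using finite_ramified by (simp add: card_gt_0_iff)
  then show ?thesis by (simp add: num_ramified_def)
qed (simp add: num_ramified_def)

section \<open>Permutation groups generated by Frobenius elements\<close>

definition frobenius_scalar :: "nat \<Rightarrow> nat \<Rightarrow> int \<Rightarrow> int" where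
  "frobenius_scalar q m a = a ^ ((q - 1) div m)"

text \<open>The scalar \<open>a ^ ((q - 1) div m)\<close> has exact order \<open>m\<close> modulo \<open>q\<close>, so \<open>X ^ m - a\<close> is irreducible
  modulo \<open>q\<close> and the Frobenius at \<open>q\<close> multiplies its roots by this scalar.\<close>
definition kummer_prime :: "nat \<Rightarrow> nat \<Rightarrow> int \<Rightarrow> bool" where
  "kummer_prime q m a \<longleftrightarrow> prime q \<and> m > 0 \<and> m dvd q - 1 \<and> \<not> int q dvd a \<and>
     (\<forall>d. 0 < d \<longrightarrow> d < m \<longrightarrow> \<not> int q dvd frobenius_scalar q m a ^ d - 1)"

lemma kummer_prime_not_dvd:
  assumes "kummer_prime q m a"
  shows "\<not> q dvd m"
proof
  assume "q dvd m"
  then have "q dvd q - 1" using assms unfolding kummer_prime_def by (meson dvd_trans)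
  moreover have "q > 1" using assms prime_gt_1_nat by (auto simp: kummer_prime_def)
  ultimately show False using dvd_imp_le[of q "q - 1"] by simp
qed

context monic_split
begin

text \<open>If two roots were congruent modulo \<open>P\<close>, the derivative of \<open>F\<close>
  at one of them, being the product of its differences to the others, would lie in \<open>P\<close>;
  then \<open>E\<close> would have a multiple zero modulo \<open>P\<close>.\<close>

lemma root_diff_not_in_prime:
  assumes P: "prime_ideal_in all_integers P" and q: "of_nat q \<in> P"
    and cong: "\<And>i. int q dvd coeff F i - coeff E i"
    and sep: "\<And>x. algebraic_int x \<Longrightarrow> poly (map_poly of_int E) x \<in> P \<Longrightarrow> poly (map_poly of_int (pderiv E)) x \<notin> P"
    and ij: "i \<in> {1..n}" "j \<in> {1..n}" "i \<noteq> j"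
  shows "\<alpha> i - \<alpha> j \<notin> P"
proof
  assume d: "\<alpha> i - \<alpha> j \<in> P"
  interpret prime_ideal_in all_integers P by fact
  have ai: "\<alpha> i \<in> all_integers" using alg_int_root[OF ij(1)] by simp
  have "poly (map_poly of_int F) (\<alpha> i) = 0" unfolding poly_F by (rule prod_zero) (use ij in \<open>auto intro!: bexI[of _ i]\<close>)
  then have "poly (map_poly of_int E) (\<alpha> i) \<in> P"
    using P_minus[OF P_poly_cong[OF q cong ai]] by simp
  have "poly (map_poly of_int (pderiv F)) (\<alpha> i) = (\<alpha> i - \<alpha> j) * (\<Prod>k\<in>{1..n}-{i}-{j}. \<alpha> i - \<alpha> k)"
    unfolding poly_pderiv_root[OF ij(1)] by (rule prod.remove) (use ij in auto)
  moreover have "algebraic_int (\<Prod>k\<in>{1..n}-{i}-{j}. \<alpha> i - \<alpha> k)"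
    by (intro algebraic_int_prod algebraic_int_diff alg_int_root) (use ij in auto)
  ultimately have "poly (map_poly of_int (pderiv F)) (\<alpha> i) \<in> P" using P_mult2[OF _ d] by simp
  moreover have "int q dvd coeff (pderiv F) k - coeff (pderiv E) k" for k
    using cong[of "Suc k"] by (simp add: coeff_pderiv right_diff_distrib[symmetric] del: of_nat_Suc)
  then have "poly (map_poly of_int (pderiv F)) (\<alpha> i) - poly (map_poly of_int (pderiv E)) (\<alpha> i) \<in> P"
    by (rule P_poly_cong[OF q _ ai])
  ultimately have "poly (map_poly of_int (pderiv E)) (\<alpha> i) \<in> P"
    using P_diff[of "poly (map_poly of_int (pderiv F)) (\<alpha> i)"
      "poly (map_poly of_int (pderiv F)) (\<alpha> i) - poly (map_poly of_int (pderiv E)) (\<alpha> i)"] by simp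
  with \<open>poly (map_poly of_int E) (\<alpha> i) \<in> P\<close> show False using sep ai by blast
qed

lemma root_of_congruent:
  assumes P: "prime_ideal_in all_integers P" and q: "of_nat q \<in> P"
    and cong: "\<And>i. int q dvd coeff F i - coeff E i" and i: "i \<in> {1..n}"
  shows "poly (map_poly of_int E) (\<alpha> i) \<in> P"
proof -
  interpret prime_ideal_in all_integers P by fact
  have ai: "\<alpha> i \<in> all_integers" using alg_int_root[OF i] by simp
  have "poly (map_poly of_int F) (\<alpha> i) = 0" unfolding poly_F by (rule prod_zero) (use i in \<open>auto intro!: bexI[of _ i]\<close>)
  then show ?thesis
    using P_minus[OF P_poly_cong[OF q cong ai]] by simp
qed

text \<open>On roots of X^m = a modulo \<open>P\<close>, the q-th power is multiplication by the
  scalar \<zeta>. Its powers with exponents below \<open>m\<close> are distinct modulo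
  \<open>q\<close>, so the orbit of \<open>i\<close> has at least \<open>m\<close> elements and
  fills \<open>S\<close>. The set \<open>S\<close> will be all indices, all but the one of the zero
  root, or the pair belonging to a quadratic factor.\<close>

lemma frobenius_orbit:
  assumes P: "prime_ideal_in all_integers P" and q: "of_nat q \<in> P" and kp: "kummer_prime q m a"
    and \<phi>: "\<phi> permutes {1..n}" and frob: "\<And>i. i \<in> {1..n} \<Longrightarrow> \<alpha> (\<phi> i) - \<alpha> i ^ q \<in> P"
    and S: "S \<subseteq> {1..n}" "\<And>i. i \<in> S \<Longrightarrow> \<phi> i \<in> S" "card S \<le> m"
    and root: "\<And>i. i \<in> S \<Longrightarrow> \<alpha> i ^ m - of_int a \<in> P"
    and ij: "i \<in> S" "j \<in> S"
  shows "\<exists>k. (\<phi> ^^ k) i = j"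
proof -
  interpret prime_ideal_in all_integers P by fact
  have pq: "prime q" and m0: "m > 0" and mq: "m dvd q - 1" and qa: "\<not> int q dvd a"
    and ord: "\<And>d. 0 < d \<Longrightarrow> d < m \<Longrightarrow> \<not> int q dvd frobenius_scalar q m a ^ d - 1"
    using kp by (auto simp: kummer_prime_def)
  define \<zeta> where "\<zeta> = frobenius_scalar q m a"
  obtain c where c: "q - 1 = m * c" using mq by blast
  have qmc: "q = Suc (m * c)" using c prime_gt_0_nat[OF pq] by simp
  have \<zeta>: "\<zeta> = a ^ c" using c m0 by (simp add: \<zeta>_def frobenius_scalar_def)
  have \<alpha>q: "\<alpha> i ^ q = \<alpha> i * (\<alpha> i ^ m) ^ c" for i
    by (simp add: qmc power_mult[symmetric])
  have aiS: "\<alpha> i \<in> all_integers" if "i \<in> S" for i using alg_int_root S(1) that by auto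
  have step: "\<alpha> (\<phi> i) - of_int \<zeta> * \<alpha> i \<in> P" if i: "i \<in> S" for i
  proof -
    have "(\<alpha> i ^ m) ^ c - of_int a ^ c = (\<alpha> i ^ m - of_int a) * (\<Sum>k<c. of_int a ^ (c - Suc k) * (\<alpha> i ^ m) ^ k)"
      by (rule power_diff_sumr2)
    also have "\<dots> \<in> P"
      using aiS[OF i] by (intro P_mult2 root[OF i]) (auto intro!: algebraic_int_sum algebraic_int_mult algebraic_int_power)
    finally have "\<alpha> i * ((\<alpha> i ^ m) ^ c - of_int a ^ c) \<in> P" by (rule P_mult[OF aiS[OF i]])
    then have "\<alpha> i ^ q - of_int \<zeta> * \<alpha> i \<in> P"
      unfolding \<zeta> \<alpha>q by (simp add: algebra_simps)
    moreover have "\<alpha> (\<phi> i) - \<alpha> i ^ q \<in> P" using frob i S(1) by blast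
    ultimately have "(\<alpha> (\<phi> i) - \<alpha> i ^ q) + (\<alpha> i ^ q - of_int \<zeta> * \<alpha> i) \<in> P" by (rule P_add[rotated])
    then show ?thesis by simp
  qed
  have orbit: "(\<phi> ^^ k) i \<in> S" for k using ij(1) by (induction k) (auto intro: S(2))
  have pow: "\<alpha> ((\<phi> ^^ k) i) - of_int (\<zeta> ^ k) * \<alpha> i \<in> P" for k
  proof (induction k)
    case 0
    then show ?case using P_zero by simp
  next
    case (Suc k)
    have "of_int \<zeta> * (\<alpha> ((\<phi> ^^ k) i) - of_int (\<zeta> ^ k) * \<alpha> i) \<in> P" by (rule P_mult[OF _ Suc]) simp
    from P_add[OF step[OF orbit[of k]] this] show ?case by (simp add: algebra_simps)
  qed
  have \<alpha>P: "\<alpha> i \<notin> P"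
  proof
    assume "\<alpha> i \<in> P"
    then have "\<alpha> i * \<alpha> i ^ (m - 1) \<in> P" using aiS[OF ij(1)] by (intro P_mult2) (auto intro: algebraic_int_power)
    then have "\<alpha> i ^ m \<in> P" using m0 by (cases m) auto
    from P_diff[OF this root[OF ij(1)]] have "of_int a \<in> P" by simp
    then show False using P_int[OF pq q] qa by blast
  qed
  have \<zeta>q: "\<not> int q dvd \<zeta>" using qa pq unfolding \<zeta> by (meson prime_dvd_power prime_nat_int_transfer)
  have inj: "inj_on (\<lambda>k. (\<phi> ^^ k) i) {..<m}"
  proof (rule linorder_inj_onI)
    fix d e assume de: "d < e" "d \<in> {..<m}" "e \<in> {..<m}"
    show "(\<phi> ^^ d) i \<noteq> (\<phi> ^^ e) i"
    proof
      assume eq: "(\<phi> ^^ d) i = (\<phi> ^^ e) i"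
      have "of_int (\<zeta> ^ d * (\<zeta> ^ (e - d) - 1)) * \<alpha> i
          = (\<alpha> ((\<phi> ^^ d) i) - of_int (\<zeta> ^ d) * \<alpha> i) - (\<alpha> ((\<phi> ^^ e) i) - of_int (\<zeta> ^ e) * \<alpha> i)"
        using de(1) unfolding eq by (simp add: algebra_simps power_add[symmetric])
      also have "\<dots> \<in> P" by (intro P_diff[OF pow pow])
      finally have prod: "of_int (\<zeta> ^ d * (\<zeta> ^ (e - d) - 1)) * \<alpha> i \<in> P" .
      have "of_int (\<zeta> ^ d * (\<zeta> ^ (e - d) - 1)) \<in> P \<or> \<alpha> i \<in> P"
        by (rule P_prime[OF _ aiS[OF ij(1)] prod]) (simp only: mem_Collect_eq algebraic_int_of_int)
      then have "of_int (\<zeta> ^ d * (\<zeta> ^ (e - d) - 1)) \<in> P" using \<alpha>P by blast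
      then have "int q dvd \<zeta> ^ d * (\<zeta> ^ (e - d) - 1)" by (rule P_int[OF pq q])
      then have "int q dvd \<zeta> ^ (e - d) - 1"
        using pq \<zeta>q by (meson prime_dvd_mult_iff prime_dvd_power prime_nat_int_transfer)
      moreover have "0 < e - d" "e - d < m" using de by auto
      ultimately show False using ord[of "e - d"] by (simp add: \<zeta>_def)
    qed
  qed auto
  have finS: "finite S" using S(1) finite_subset by blast
  have "(\<lambda>k. (\<phi> ^^ k) i) ` {..<m} = S"
  proof (rule card_seteq[OF finS])
    show "(\<lambda>k. (\<phi> ^^ k) i) ` {..<m} \<subseteq> S" using orbit by auto
    show "card S \<le> card ((\<lambda>k. (\<phi> ^^ k) i) ` {..<m})" using S(3) card_image[OF inj] by simp
  qed
  then show ?thesis using ij(2) by auto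
qed

end

section \<open>Templates that stay separable modulo a prime\<close>

lemma separable_binomial:
  assumes P: "prime_ideal_in all_integers P" and q: "prime q" "of_nat q \<in> P"
    and "\<not> q dvd n" "\<not> int q dvd a" "n \<ge> 1"
    and x: "algebraic_int x" "poly (map_poly of_int (monom 1 n - [:a:])) x \<in> P"
  shows "poly (map_poly of_int (pderiv (monom 1 n - [:a:]))) x \<notin> P"
proof
  interpret prime_ideal_in all_integers P by fact
  assume "poly (map_poly of_int (pderiv (monom 1 n - [:a:]))) x \<in> P"
  then have "of_nat n * x ^ (n - 1) \<in> P"
    by (simp add: pderiv_diff pderiv_monom of_int_hom.map_poly_hom_monom pderiv_pCons poly_monom)
  moreover have "of_nat n \<notin> P" using P_int[OF q, of "int n"] assms(4) by auto
  ultimately have "x ^ (n - 1) \<in> P"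
    using P_prime[of "of_nat n" "x ^ (n - 1)"] x(1) by (auto intro: algebraic_int_power)
  then have "x \<in> P" using P_power[of x] x(1) by auto
  then have "x * x ^ (n - 1) \<in> P" using x(1) by (intro P_mult2) (auto intro: algebraic_int_power)
  then have "x ^ n \<in> P" using assms(6) by (cases n) auto
  moreover have "x ^ n - of_int a \<in> P"
    using x(2) by (simp add: of_int_poly_hom.hom_minus of_int_hom.map_poly_hom_monom of_int_hom.map_poly_pCons_hom poly_monom)
  ultimately have "x ^ n - (x ^ n - of_int a) \<in> P" by (rule P_diff)
  then show False using P_int[OF q, of a] assms(5) by simp
qed

lemma separable_binomial_X:
  assumes P: "prime_ideal_in all_integers P" and q: "prime q" "of_nat q \<in> P"
    and "\<not> q dvd n - 1" "\<not> int q dvd a" "n \<ge> 2"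
    and x: "algebraic_int x" "poly (map_poly of_int (monom 1 n - monom a 1)) x \<in> P"
  shows "poly (map_poly of_int (pderiv (monom 1 n - monom a 1))) x \<notin> P"
proof
  interpret prime_ideal_in all_integers P by fact
  have xx: "x ^ n = x * x ^ (n - 1)" using assms(6) by (cases n) auto
  assume "poly (map_poly of_int (pderiv (monom 1 n - monom a 1))) x \<in> P"
  then have d: "of_nat n * x ^ (n - 1) - of_int a \<in> P"
    by (simp add: pderiv_diff pderiv_monom of_int_poly_hom.hom_minus of_int_hom.map_poly_hom_monom of_int_hom.map_poly_pCons_hom poly_monom)
  have "x * (x ^ (n - 1) - of_int a) \<in> P"
    using x(2) by (simp add: of_int_poly_hom.hom_minus of_int_hom.map_poly_hom_monom of_int_hom.map_poly_pCons_hom poly_monom xx algebra_simps)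
  then consider "x \<in> P" | "x ^ (n - 1) - of_int a \<in> P"
    using P_prime[of x "x ^ (n - 1) - of_int a"] x(1) by (auto intro: algebraic_int_power algebraic_int_diff)
  then show False
  proof cases
    case 1
    then have "x * x ^ (n - 2) \<in> P" using x(1) by (intro P_mult2) (auto intro: algebraic_int_power)
    moreover have "x ^ (n - 1) = x * x ^ (n - 2)" using assms(6) by (simp flip: power_Suc add: Suc_diff_Suc numeral_2_eq_2)
    ultimately have "of_nat n * x ^ (n - 1) \<in> P" by (intro P_mult) auto
    from P_diff[OF this d] have "of_int a \<in> P" by simp
    then show False using P_int[OF q] assms(5) by blast
  next
    case 2
    have "of_nat n * (x ^ (n - 1) - of_int a) \<in> P" by (rule P_mult[OF _ 2]) simp
    from P_diff[OF d this] have "of_int (int (n - 1) * a) \<in> P"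
      using assms(6) by (simp add: algebra_simps of_nat_diff)
    then have "int q dvd int (n - 1) * a" by (rule P_int[OF q])
    then have "int q dvd int (n - 1) \<or> int q dvd a" using q(1) by (simp add: prime_dvd_mult_iff)
    then show False using assms(4,5) by auto
  qed
qed

text \<open>This template serves two ends. For a nonresidue \<open>a\<close> modulo a prime above
  \<open>n\<close> its Frobenius is a transposition; for \<open>a\<close> equal to a prime r > n
  with r > 2, its only double zero modulo r is 0, and r divides the discriminant exactly
  once.\<close>

definition quadratic_times_linear :: "nat \<Rightarrow> int \<Rightarrow> int poly" where
  "quadratic_times_linear n a = [:- a, 0, 1:] * (\<Prod>c=1..int n - 2. [:- c, 1:])"

lemma poly_quadratic_times_linear:
  "poly (map_poly of_int (quadratic_times_linear n a)) x = (x\<^sup>2 - of_int a) * (\<Prod>c=1..int n - 2. x - of_int c)"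
  for x :: complex
  unfolding quadratic_times_linear_def of_int_poly_hom.hom_mult poly_mult of_int_poly_hom.hom_prod poly_prod
  by (simp add: of_int_hom.map_poly_pCons_hom power2_eq_square algebra_simps)

lemma separable_quadratic_times_linear:
  assumes P: "prime_ideal_in all_integers P" and q: "prime q" "of_nat q \<in> P"
    and qn: "q > n" "q > 2" and a: "\<not> int q dvd a" "\<And>c. \<not> int q dvd c\<^sup>2 - a"
    and x: "algebraic_int x" "poly (map_poly of_int (quadratic_times_linear n a)) x \<in> P"
  shows "poly (map_poly of_int (pderiv (quadratic_times_linear n a))) x \<notin> P"
proof
  interpret prime_ideal_in all_integers P by fact
  let ?I = "{1..int n - 2}"
  define C where "C = (\<Prod>c\<in>?I. [:- c, 1::int:])"
  have E: "quadratic_times_linear n a = [:- a, 0, 1:] * C" by (simp add: quadratic_times_linear_def C_def)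
  have C: "poly (map_poly of_int C) x = (\<Prod>c\<in>?I. x - of_int c)"
    by (simp add: C_def of_int_poly_hom.hom_prod poly_prod)
  assume "poly (map_poly of_int (pderiv (quadratic_times_linear n a))) x \<in> P"
  moreover have "pderiv (quadratic_times_linear n a) = [:- a, 0, 1:] * pderiv C + C * [:0, 2:]"
    unfolding E by (subst pderiv_mult) (simp add: pderiv_pCons)
  ultimately have d: "(x\<^sup>2 - of_int a) * poly (map_poly of_int (pderiv C)) x + (\<Prod>c\<in>?I. x - of_int c) * (2 * x) \<in> P"
    by (simp add: of_int_poly_hom.hom_mult of_int_poly_hom.hom_add C power2_eq_square algebra_simps del: mult_pCons_left mult_pCons_right)
  have xsq: "x\<^sup>2 - of_int a \<in> all_integers" and xc: "x - of_int c \<in> all_integers" for c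
    using x(1) by (auto intro: algebraic_int_diff algebraic_int_power)
  have CR: "poly (map_poly of_int D) x \<in> all_integers" for D using algebraic_int_poly[OF x(1)] by simp
  have int_sep: False if "x - of_int c \<in> P" "x\<^sup>2 - of_int a \<in> P" for c
  proof -
    have "(x - of_int c) * (x + of_int c) \<in> P"
      using x(1) by (intro P_mult2 that) (auto intro: algebraic_int_add)
    from P_diff[OF that(2) this] have "of_int (c\<^sup>2 - a) \<in> P" by (simp add: power2_eq_square algebra_simps)
    then show False using P_int[OF q] a(2) by blast
  qed
  have "(x\<^sup>2 - of_int a) * (\<Prod>c\<in>?I. x - of_int c) \<in> P" using x(2) by (simp add: poly_quadratic_times_linear)
  then consider "x\<^sup>2 - of_int a \<in> P" | "(\<Prod>c\<in>?I. x - of_int c) \<in> P"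
    using P_prime[OF xsq, of "\<Prod>c\<in>?I. x - of_int c"] xc by (auto intro: algebraic_int_prod)
  then show False
  proof cases
    case 1
    then have "(x\<^sup>2 - of_int a) * poly (map_poly of_int (pderiv C)) x \<in> P" using CR by (rule P_mult2[rotated])
    from P_diff[OF d this] have "(\<Prod>c\<in>?I. x - of_int c) * (2 * x) \<in> P" by simp
    moreover have "(\<Prod>c\<in>?I. x - of_int c) \<notin> P"
      using P_prod[of ?I "\<lambda>c. x - of_int c"] xc int_sep[OF _ 1] by auto
    ultimately have "2 * x \<in> P"
      using P_prime[of "\<Prod>c\<in>?I. x - of_int c" "2 * x"] xc x(1) by (auto intro: algebraic_int_prod algebraic_int_mult)
    moreover have "2 \<notin> P" using P_int[OF q, of 2] qn(2) zdvd_imp_le[of "int q" 2] by auto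
    ultimately have "x \<in> P" using P_prime[of 2 x] x(1) by auto
    then have "x * x \<in> P" using x(1) by (intro P_mult) auto
    from P_diff[OF this 1[unfolded power2_eq_square]] have "of_int a \<in> P" by simp
    then show False using P_int[OF q] a(1) by blast
  next
    case 2
    then obtain c where c: "c \<in> ?I" "x - of_int c \<in> P" using P_prod[of ?I "\<lambda>c. x - of_int c"] xc by auto
    have "(\<Prod>c\<in>?I. x - of_int c) * (2 * x) \<in> P" using 2 x(1) by (intro P_mult2) (auto intro: algebraic_int_mult)
    from P_diff[OF d this] have "(x\<^sup>2 - of_int a) * poly (map_poly of_int (pderiv C)) x \<in> P" by simp
    then have "poly (map_poly of_int (pderiv C)) x \<in> P"
      using P_prime[OF xsq CR] int_sep[OF c(2)] by blast
    moreover define G where "G = (\<Prod>d\<in>?I - {c}. [:- d, 1::int:])"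
    have "C = [:- c, 1:] * G" unfolding C_def G_def using c(1) by (simp add: prod.remove)
    then have "pderiv C = [:- c, 1:] * pderiv G + G * [:1:]" by (simp only: pderiv_mult) (simp add: pderiv_pCons)
    then have "poly (map_poly of_int (pderiv C)) x = (x - of_int c) * poly (map_poly of_int (pderiv G)) x + poly (map_poly of_int G) x"
      by (simp add: of_int_poly_hom.hom_mult of_int_poly_hom.hom_add algebra_simps del: mult_pCons_left mult_pCons_right)
    moreover have "(x - of_int c) * poly (map_poly of_int (pderiv G)) x \<in> P" by (rule P_mult2[OF CR c(2)])
    ultimately have "poly (map_poly of_int G) x \<in> P"
      using P_diff[of "poly (map_poly of_int (pderiv C)) x" "(x - of_int c) * poly (map_poly of_int (pderiv G)) x"] by simp
    then have "(\<Prod>d\<in>?I - {c}. x - of_int d) \<in> P"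
      by (simp add: G_def of_int_poly_hom.hom_prod poly_prod)
    then have "\<exists>e\<in>?I - {c}. x - of_int e \<in> P" by (rule P_prod[rotated 2]) (use xc in auto)
    then obtain e where e: "e \<in> ?I - {c}" "x - of_int e \<in> P" by blast
    from P_diff[OF e(2) c(2)] have "of_int (c - e) \<in> P" by simp
    then have "int q dvd c - e" by (rule P_int[OF q])
    moreover have "c - e \<noteq> 0" "\<bar>c - e\<bar> < int q" using c(1) e(1) qn(1) by auto
    ultimately show False using zdvd_imp_le[of "int q" "\<bar>c - e\<bar>"] by auto
  qed
qed

text \<open>If \<open>a\<close> were congruent to the square of \<open>c\<close>, its power with
  exponent (q - 1)/2 would be c^(q-1), which is 1 by Fermat, whereas this scalar has exact order
  2.\<close>

lemma kummer_prime_nonresidue: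
  assumes k3: "kummer_prime q 2 a"
  shows "\<not> int q dvd c\<^sup>2 - a"
proof
  have p3: "prime q" "\<not> int q dvd a" using k3 by (auto simp: kummer_prime_def)
  obtain P where P: "prime_ideal_of all_integers P" "of_nat q \<in> P"
    by (rule prime_ideal_exists[OF int_subring_all_integers p3(1)])
  interpret prime_ideal_in all_integers P using P(1) int_subring_all_integers by unfold_locales
  assume "int q dvd c\<^sup>2 - a"
  then have c: "[c\<^sup>2 = a] (mod int q)" by (simp add: cong_iff_dvd_diff)
  have q2: "2 * ((q - 1) div 2) = q - 1" using k3 by (simp add: kummer_prime_def)
  have "[(c\<^sup>2) ^ ((q - 1) div 2) = a ^ ((q - 1) div 2)] (mod int q)" by (rule cong_pow[OF c])
  then have 1: "[c ^ (q - 1) = frobenius_scalar q 2 a] (mod int q)"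
    by (simp only: power_mult[symmetric] q2 frobenius_scalar_def)
  have "\<not> int q dvd c"
  proof
    assume "int q dvd c"
    then have "int q dvd c\<^sup>2" by (simp add: power2_eq_square)
    then show False using c p3(2) by (simp add: cong_dvd_iff)
  qed
  have "int q dvd c ^ (q - 1) - 1"
  proof -
    have "of_int c ^ q - of_int c \<in> P" by (rule P_fermat[OF p3(1) P(2)])
    then have "of_int (c ^ q - c) \<in> P" by simp
    then have "int q dvd c ^ q - c" by (rule P_int[OF p3(1) P(2)])
    also have "c ^ q - c = c * (c ^ (q - 1) - 1)"
      using prime_gt_0_nat[OF p3(1)] by (cases q) (auto simp: algebra_simps)
    finally show ?thesis using \<open>\<not> int q dvd c\<close> p3(1) by (simp add: prime_dvd_mult_iff)
  qed
  then have "[c ^ (q - 1) = 1] (mod int q)" by (simp add: cong_iff_dvd_diff)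
  from cong_trans[OF cong_sym[OF 1] this] have "int q dvd frobenius_scalar q 2 a ^ 1 - 1"
    by (simp add: cong_iff_dvd_diff)
  moreover have "\<And>d. 0 < d \<Longrightarrow> d < 2 \<Longrightarrow> \<not> int q dvd frobenius_scalar q 2 a ^ d - 1"
    using k3 unfolding kummer_prime_def by blast
  from this[of 1] have "\<not> int q dvd frobenius_scalar q 2 a ^ 1 - 1" by simp
  ultimately show False by blast
qed

section \<open>From Frobenius elements to the symmetric group\<close>

context monic_split
begin

text \<open>The first prime makes the group transitive, and the second makes the stabiliser of a
  point transitive on the remaining points; the group is then doubly transitive. Conjugating the
  transposition at the third prime yields all transpositions, and these generate.\<close>

lemma galois_perms_full:
  assumes n: "n \<ge> 2"
    and k1: "kummer_prime q1 n a1" and c1: "\<And>i. int q1 dvd coeff F i - coeff (monom 1 n - [:a1:]) i"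
    and k2: "kummer_prime q2 (n - 1) a2" and c2: "\<And>i. int q2 dvd coeff F i - coeff (monom 1 n - monom a2 1) i"
    and k3: "kummer_prime q3 2 a3" "q3 > n" "q3 > 2"
    and c3: "\<And>i. int q3 dvd coeff F i - coeff (quadratic_times_linear n a3) i"
  shows "galois_perms = perms"
proof -
  have p1: "prime q1" "\<not> int q1 dvd a1" and p2: "prime q2" "\<not> int q2 dvd a2" and p3: "prime q3" "\<not> int q3 dvd a3"
    using k1 k2 k3 by (auto simp: kummer_prime_def)
  have perm: "\<sigma> permutes {1..n}" if "\<sigma> \<in> galois_perms" for \<sigma> using that galois_perms_subset by auto
  have trans: "\<exists>\<sigma>\<in>galois_perms. \<sigma> i = j" if ij: "i \<in> {1..n}" "j \<in> {1..n}" for i j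
  proof -
    obtain P where P: "prime_ideal_of all_integers P" "of_nat q1 \<in> P"
      by (rule prime_ideal_exists[OF int_subring_all_integers p1(1)])
    have PP: "prime_ideal_in all_integers P" using P(1) int_subring_all_integers by unfold_locales
    have "\<And>i j. i \<in> {1..n} \<Longrightarrow> j \<in> {1..n} \<Longrightarrow> i \<noteq> j \<Longrightarrow> \<alpha> i - \<alpha> j \<notin> P"
      using root_diff_not_in_prime[OF PP P(2) c1 separable_binomial[OF PP p1(1) P(2) kummer_prime_not_dvd[OF k1] p1(2)]] n by simp
    from frobenius_exists[OF PP p1(1) P(2) this]
    obtain \<phi> where \<phi>: "\<phi> \<in> galois_perms" "\<And>i. i \<in> {1..n} \<Longrightarrow> \<alpha> (\<phi> i) - \<alpha> i ^ q1 \<in> P" by blast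
    have "\<exists>k. (\<phi> ^^ k) i = j"
    proof (rule frobenius_orbit[OF PP P(2) k1 perm[OF \<phi>(1)] \<phi>(2), of "{1..n}"])
      show "\<phi> i \<in> {1..n}" if "i \<in> {1..n}" for i using permutes_in_image[OF perm[OF \<phi>(1)]] that by simp
      show "\<alpha> i ^ n - of_int a1 \<in> P" if "i \<in> {1..n}" for i
        using root_of_congruent[OF PP P(2) c1 that]
        by (simp add: of_int_poly_hom.hom_minus of_int_hom.map_poly_hom_monom of_int_hom.map_poly_pCons_hom poly_monom)
    qed (use ij in auto)
    then show ?thesis using galois_perms_funpow[OF \<phi>(1)] by blast
  qed
  have "\<exists>i0\<in>{1..n}. \<forall>i\<in>{1..n}-{i0}. \<forall>j\<in>{1..n}-{i0}. \<exists>\<sigma>\<in>galois_perms. \<sigma> i0 = i0 \<and> \<sigma> i = j"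
  proof -
    obtain P where P: "prime_ideal_of all_integers P" "of_nat q2 \<in> P"
      by (rule prime_ideal_exists[OF int_subring_all_integers p2(1)])
    have PP: "prime_ideal_in all_integers P" using P(1) int_subring_all_integers by unfold_locales
    interpret prime_ideal_in all_integers P by fact
    have sep: "\<And>i j. i \<in> {1..n} \<Longrightarrow> j \<in> {1..n} \<Longrightarrow> i \<noteq> j \<Longrightarrow> \<alpha> i - \<alpha> j \<notin> P"
      using root_diff_not_in_prime[OF PP P(2) c2 separable_binomial_X[OF PP p2(1) P(2) kummer_prime_not_dvd[OF k2] p2(2) n]] .
    from frobenius_exists[OF PP p2(1) P(2) this]
    obtain \<phi> where \<phi>: "\<phi> \<in> galois_perms" "\<And>i. i \<in> {1..n} \<Longrightarrow> \<alpha> (\<phi> i) - \<alpha> i ^ q2 \<in> P" by blast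
    have \<phi>im: "\<phi> i \<in> {1..n}" if "i \<in> {1..n}" for i using permutes_in_image[OF perm[OF \<phi>(1)]] that by simp
    have ai: "\<alpha> i \<in> all_integers" if "i \<in> {1..n}" for i using alg_int_root[OF that] by simp
    \<comment> \<open>Modulo \<open>q2\<close> the template X (X^(n-1) - a2) has the zero 0. The
      root reducing to it is fixed by Frobenius, and the other roots are (n-1)-th roots of
      \<open>a2\<close>.\<close>
    have "int q2 dvd coeff F 0" using c2[of 0] n by (simp add: coeff_monom)
    then have "poly (map_poly of_int F) 0 \<in> P"
      using P_of_int_dvd[OF P(2)] by (simp add: poly_0_coeff_0 coeff_map_poly)
    then have "(\<Prod>j\<in>{1..n}. 0 - \<alpha> j) \<in> P" unfolding poly_F .
    then obtain i0 where i0: "i0 \<in> {1..n}" "0 - \<alpha> i0 \<in> P"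
      using P_prod[of "{1..n}" "\<lambda>j. 0 - \<alpha> j"] ai by auto
    have i0P: "\<alpha> i0 \<in> P" using P_minus[OF i0(2)] by simp
    have fix0: "\<phi> i0 = i0"
    proof (rule ccontr)
      assume ne: "\<phi> i0 \<noteq> i0"
      have "\<alpha> i0 ^ q2 = \<alpha> i0 * \<alpha> i0 ^ (q2 - 1)" using prime_gt_0_nat[OF p2(1)] by (cases q2) auto
      also have "\<dots> \<in> P" using i0P ai[OF i0(1)] by (intro P_mult2) (auto intro: algebraic_int_power)
      finally have "\<alpha> (\<phi> i0) \<in> P" using P_add[OF \<phi>(2)[OF i0(1)], of "\<alpha> i0 ^ q2"] by simp
      then have "\<alpha> (\<phi> i0) - \<alpha> i0 \<in> P" using i0P by (rule P_diff)
      then show False using sep[OF \<phi>im[OF i0(1)] i0(1) ne] by blast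
    qed
    have "\<exists>\<sigma>\<in>galois_perms. \<sigma> i0 = i0 \<and> \<sigma> i = j" if ij: "i \<in> {1..n}-{i0}" "j \<in> {1..n}-{i0}" for i j
    proof -
      have "\<exists>k. (\<phi> ^^ k) i = j"
      proof (rule frobenius_orbit[OF PP P(2) k2 perm[OF \<phi>(1)] \<phi>(2), of "{1..n}-{i0}"])
        fix i assume i: "i \<in> {1..n}-{i0}"
        then have "\<phi> i \<noteq> \<phi> i0" using permutes_inj[OF perm[OF \<phi>(1)]] by (auto dest: injD)
        then show "\<phi> i \<in> {1..n}-{i0}" using \<phi>im[of i] i fix0 by simp
        have "\<alpha> i \<notin> P"
        proof
          assume "\<alpha> i \<in> P"
          then have "\<alpha> i - \<alpha> i0 \<in> P" using i0P by (rule P_diff)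
          then show False using sep[of i i0] i i0(1) by simp
        qed
        moreover have "\<alpha> i ^ n = \<alpha> i * \<alpha> i ^ (n - 1)" using n by (cases n) auto
        then have "\<alpha> i * (\<alpha> i ^ (n - 1) - of_int a2) \<in> P"
          using root_of_congruent[OF PP P(2) c2, of i] i
          by (simp add: of_int_poly_hom.hom_minus of_int_hom.map_poly_hom_monom of_int_hom.map_poly_pCons_hom poly_monom algebra_simps)
        ultimately show "\<alpha> i ^ (n - 1) - of_int a2 \<in> P"
          using P_prime[of "\<alpha> i" "\<alpha> i ^ (n - 1) - of_int a2"] ai[of i] i
          by (auto intro: algebraic_int_diff algebraic_int_power)
      qed (use ij i0 in auto)
      then obtain k where k: "(\<phi> ^^ k) i = j" by blast
      have "(\<phi> ^^ k) i0 = i0" for k using fix0 by (induction k) auto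
      then show ?thesis using galois_perms_funpow[OF \<phi>(1), of k] k by blast
    qed
    then show ?thesis using i0(1) by blast
  qed
  then obtain i0 where i0: "i0 \<in> {1..n}"
    and stab: "\<And>i j. i \<in> {1..n}-{i0} \<Longrightarrow> j \<in> {1..n}-{i0} \<Longrightarrow> \<exists>\<sigma>\<in>galois_perms. \<sigma> i0 = i0 \<and> \<sigma> i = j" by blast
  \<comment> \<open>Carry \<open>i\<close> and \<open>k\<close> to \<open>i0\<close>, match the
    images of \<open>j\<close> and \<open>l\<close> inside the stabiliser of \<open>i0\<close>, and
    undo the second transport.\<close>
  have trans2: "\<exists>\<sigma>\<in>galois_perms. \<sigma> i = k \<and> \<sigma> j = l"
    if ij: "i \<in> {1..n}" "j \<in> {1..n}" "i \<noteq> j" and kl: "k \<in> {1..n}" "l \<in> {1..n}" "k \<noteq> l" for i j k l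
  proof -
    obtain g1 where g1: "g1 \<in> galois_perms" "g1 i = i0" using trans[OF ij(1) i0] by blast
    obtain g2 where g2: "g2 \<in> galois_perms" "g2 k = i0" using trans[OF kl(1) i0] by blast
    have "g1 j \<in> {1..n}-{i0}"
      using permutes_in_image[OF perm[OF g1(1)], of j] permutes_inj[OF perm[OF g1(1)]] g1(2) ij by (auto dest: injD)
    moreover have "g2 l \<in> {1..n}-{i0}"
      using permutes_in_image[OF perm[OF g2(1)], of l] permutes_inj[OF perm[OF g2(1)]] g2(2) kl by (auto dest: injD)
    ultimately obtain \<sigma> where \<sigma>: "\<sigma> \<in> galois_perms" "\<sigma> i0 = i0" "\<sigma> (g1 j) = g2 l" using stab by blast
    have "inv' g2 i0 = k" "inv' g2 (g2 l) = l"
      using permutes_inverses(2)[OF perm[OF g2(1)]] g2(2) by metis+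
    moreover have "inv' g2 \<circ> (\<sigma> \<circ> g1) \<in> galois_perms"
      by (intro galois_perms_compose galois_perms_inv g1 g2 \<sigma>)
    ultimately show ?thesis using g1(2) \<sigma>(2,3) by (intro bexI[of _ "inv' g2 \<circ> (\<sigma> \<circ> g1)"]) auto
  qed
  have "\<exists>a\<in>{1..n}. \<exists>b\<in>{1..n}. a \<noteq> b \<and> transpose a b \<in> galois_perms"
  proof -
    obtain P where P: "prime_ideal_of all_integers P" "of_nat q3 \<in> P"
      by (rule prime_ideal_exists[OF int_subring_all_integers p3(1)])
    have PP: "prime_ideal_in all_integers P" using P(1) int_subring_all_integers by unfold_locales
    interpret prime_ideal_in all_integers P by fact
    let ?I = "{1..int n - 2}"
    have nonres: "\<not> int q3 dvd c\<^sup>2 - a3" for c by (rule kummer_prime_nonresidue[OF k3(1)])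
    have sep: "\<And>i j. i \<in> {1..n} \<Longrightarrow> j \<in> {1..n} \<Longrightarrow> i \<noteq> j \<Longrightarrow> \<alpha> i - \<alpha> j \<notin> P"
      using root_diff_not_in_prime[OF PP P(2) c3 separable_quadratic_times_linear[OF PP p3(1) P(2) k3(2,3) p3(2) nonres]] .
    from frobenius_exists[OF PP p3(1) P(2) this]
    obtain \<phi> where \<phi>: "\<phi> \<in> galois_perms" "\<And>i. i \<in> {1..n} \<Longrightarrow> \<alpha> (\<phi> i) - \<alpha> i ^ q3 \<in> P" by blast
    have \<phi>im: "\<phi> i \<in> {1..n}" if "i \<in> {1..n}" for i using permutes_in_image[OF perm[OF \<phi>(1)]] that by simp
    have ai: "\<alpha> i \<in> all_integers" if "i \<in> {1..n}" for i using alg_int_root[OF that] by simp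
    \<comment> \<open>The roots belonging to X^2 - a3. The linear factors account for at most n - 2
      roots, so \<open>S\<close> has at least two elements. It has at most two, because distinct
      members are opposite modulo \<open>P\<close>. Frobenius fixes every index outside
      \<open>S\<close>.\<close>
    define S where "S = {i\<in>{1..n}. \<alpha> i ^ 2 - of_int a3 \<in> P}"
    have SI: "S \<subseteq> {1..n}" by (auto simp: S_def)
    then have finS: "finite S" using finite_subset by blast
    have lin: "\<exists>c\<in>?I. \<alpha> i - of_int c \<in> P" if i: "i \<in> {1..n} - S" for i
    proof -
      have "(\<alpha> i ^ 2 - of_int a3) * (\<Prod>c\<in>?I. \<alpha> i - of_int c) \<in> P"
        using root_of_congruent[OF PP P(2) c3, of i] i by (simp add: poly_quadratic_times_linear)
      moreover have "\<alpha> i ^ 2 - of_int a3 \<notin> P" using i by (auto simp: S_def)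
      ultimately have "(\<Prod>c\<in>?I. \<alpha> i - of_int c) \<in> P"
        using P_prime[of "\<alpha> i ^ 2 - of_int a3" "\<Prod>c\<in>?I. \<alpha> i - of_int c"] ai[of i] i
        by (auto intro: algebraic_int_prod algebraic_int_diff algebraic_int_power)
      then show ?thesis by (rule P_prod[rotated 2]) (use ai[of i] i in \<open>auto intro: algebraic_int_diff\<close>)
    qed
    then obtain c where c: "\<And>i. i \<in> {1..n} - S \<Longrightarrow> c i \<in> ?I" "\<And>i. i \<in> {1..n} - S \<Longrightarrow> \<alpha> i - of_int (c i) \<in> P"
      by metis
    have "inj_on c ({1..n} - S)"
    proof (rule inj_onI, rule ccontr)
      fix i j assume ij: "i \<in> {1..n} - S" "j \<in> {1..n} - S" "c i = c j" "i \<noteq> j"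
      have "(\<alpha> i - of_int (c i)) - (\<alpha> j - of_int (c j)) \<in> P" by (rule P_diff[OF c(2)[OF ij(1)] c(2)[OF ij(2)]])
      then show False using sep[of i j] ij by simp
    qed
    then have "card ({1..n} - S) \<le> card ?I"
      by (rule card_inj_on_le) (use c(1) in auto)
    then have card2: "card S \<ge> 2" using n SI finS by (simp add: card_Diff_subset)
    have fixed: "\<phi> i = i" if i: "i \<in> {1..n} - S" for i
    proof (rule ccontr)
      assume ne: "\<phi> i \<noteq> i"
      have "\<alpha> i ^ q3 - of_int (c i) ^ q3 = (\<alpha> i - of_int (c i)) * (\<Sum>k<q3. of_int (c i) ^ (q3 - Suc k) * \<alpha> i ^ k)"
        by (rule power_diff_sumr2)
      also have "\<dots> \<in> P"
        using ai[of i] i by (intro P_mult2 c(2) i) (auto intro!: algebraic_int_sum algebraic_int_mult algebraic_int_power)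
      finally have 1: "\<alpha> i ^ q3 - of_int (c i) ^ q3 \<in> P" .
      have "((\<alpha> (\<phi> i) - \<alpha> i ^ q3) + (\<alpha> i ^ q3 - of_int (c i) ^ q3)) + ((of_int (c i) ^ q3 - of_int (c i)) - (\<alpha> i - of_int (c i))) \<in> P"
        using i by (intro P_add[OF P_add[OF \<phi>(2) 1] P_diff[OF P_fermat[OF p3(1) P(2)] c(2)]]) auto
      then show False using sep[of "\<phi> i" i] \<phi>im[of i] i ne by simp
    qed
    have \<phi>S: "\<phi> i \<in> S" if i: "i \<in> S" for i
    proof (rule ccontr)
      assume "\<phi> i \<notin> S"
      then have "\<phi> (\<phi> i) = \<phi> i" using fixed[of "\<phi> i"] \<phi>im i SI by blast
      then have "\<phi> i = i" using permutes_inj[OF perm[OF \<phi>(1)]] by (auto dest: injD)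
      then show False using i \<open>\<phi> i \<notin> S\<close> by simp
    qed
    obtain i where i: "i \<in> S" using card2 by fastforce
    have "card (S - {i}) \<le> Suc 0"
      unfolding card_le_Suc0_iff_eq[OF finite_Diff[OF finS]]
    proof (intro ballI, rule ccontr)
      fix j k assume jk: "j \<in> S - {i}" "k \<in> S - {i}" "j \<noteq> k"
      have opp: "\<alpha> i + \<alpha> j \<in> P" if j: "j \<in> S - {i}" for j
      proof -
        have "(\<alpha> i ^ 2 - of_int a3) - (\<alpha> j ^ 2 - of_int a3) \<in> P" by (rule P_diff) (use i j in \<open>auto simp: S_def\<close>)
        then have "(\<alpha> i - \<alpha> j) * (\<alpha> i + \<alpha> j) \<in> P" by (simp add: power2_eq_square algebra_simps)
        moreover have "\<alpha> i - \<alpha> j \<notin> P" using sep[of i j] i j subsetD[OF SI, of i] subsetD[OF SI, of j] by auto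
        ultimately show ?thesis
          using P_prime[of "\<alpha> i - \<alpha> j" "\<alpha> i + \<alpha> j"] ai[of i] ai[of j] i j subsetD[OF SI, of i] subsetD[OF SI, of j]
          by (auto intro: algebraic_int_diff algebraic_int_add)
      qed
      have "(\<alpha> i + \<alpha> j) - (\<alpha> i + \<alpha> k) \<in> P" by (intro P_diff[OF opp opp] jk)
      then show False using sep[of j k] jk subsetD[OF SI, of j] subsetD[OF SI, of k] by auto
    qed
    then have cardS: "card S \<le> 2" using i finS by simp
    then have "card (S - {i}) = 1" using card2 i finS by simp
    then obtain j where j: "S - {i} = {j}" by (auto simp: card_1_singleton_iff)
    then have Sij: "S = {i, j}" "i \<noteq> j" using i by auto
    have orb: "\<exists>k. (\<phi> ^^ k) u = v" if "u \<in> S" "v \<in> S" for u v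
      by (rule frobenius_orbit[OF PP P(2) k3(1) perm[OF \<phi>(1)] \<phi>(2) SI \<phi>S cardS _ that]) (auto simp: S_def)
    have moved: "\<phi> u \<noteq> u" if uv: "u \<in> S" "v \<in> S" "u \<noteq> v" for u v
    proof
      assume fx: "\<phi> u = u"
      have "(\<phi> ^^ k) u = u" for k using fx by (induction k) auto
      then show False using orb[OF uv(1,2)] uv(3) by auto
    qed
    have "\<phi> i = j" using \<phi>S[of i] moved[of i j] Sij by auto
    moreover have "\<phi> j = i" using \<phi>S[of j] moved[of j i] Sij by auto
    moreover have "\<phi> k = k" if "k \<noteq> i" "k \<noteq> j" for k
      using fixed[of k] permutes_not_in[OF perm[OF \<phi>(1)], of k] that Sij by blast
    ultimately have "\<phi> = transpose i j" by (auto simp: fun_eq_iff transpose_def)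
    then have "transpose i j \<in> galois_perms" using \<phi>(1) by simp
    moreover have "i \<in> {1..n}" "j \<in> {1..n}" using Sij(1) SI by blast+
    ultimately show ?thesis using Sij(2) by blast
  qed
  then obtain a b where ab: "a \<in> {1..n}" "b \<in> {1..n}" "a \<noteq> b" "transpose a b \<in> galois_perms" by blast
  have all_transp: "transpose k l \<in> galois_perms" if kl: "k \<in> {1..n}" "l \<in> {1..n}" "k \<noteq> l" for k l
  proof -
    obtain \<sigma> where \<sigma>: "\<sigma> \<in> galois_perms" "\<sigma> a = k" "\<sigma> b = l" using trans2[OF ab(1-3) kl] by blast
    have "\<sigma> \<circ> (transpose a b \<circ> inv' \<sigma>) = transpose k l"
    proof
      fix x
      have bj: "bij \<sigma>" using permutes_bij[OF perm[OF \<sigma>(1)]] .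
      have "(\<sigma> \<circ> (transpose a b \<circ> inv' \<sigma>)) x = transpose (\<sigma> a) (\<sigma> b) (\<sigma> (inv' \<sigma> x))"
        using bij_is_inj[OF bj] by (auto simp: transpose_def dest: injD)
      also have "\<sigma> (inv' \<sigma> x) = x" using permutes_inverses(1)[OF perm[OF \<sigma>(1)]] .
      finally show "(\<sigma> \<circ> (transpose a b \<circ> inv' \<sigma>)) x = transpose k l x" using \<sigma> by simp
    qed
    moreover have "\<sigma> \<circ> (transpose a b \<circ> inv' \<sigma>) \<in> galois_perms"
      by (intro galois_perms_compose galois_perms_inv \<sigma> ab)
    ultimately show ?thesis by simp
  qed
  have "\<pi> \<in> galois_perms" if "\<pi> permutes {1..n}" for \<pi>
    using that finite_atLeastAtMost[of 1 n]
  proof (induction rule: permutes_induct)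
    case id
    then show ?case by (rule galois_perms_id)
  next
    case (swap a b p)
    then have "transpose a b \<circ> p \<in> galois_perms" if "a \<noteq> b"
      using galois_perms_compose[OF all_transp[of a b]] that by blast
    then show ?case using swap by (cases "a = b") (simp_all add: o_def)
  qed
  then show ?thesis using galois_perms_subset by blast
qed

end

section \<open>Kummer primes\<close>

text \<open>The product runs over the Galois group, not over all permutations, so that only true
  conjugates of the chosen root occur. For X^m - 1 this keeps the nonprimitive roots of unity out
  when the chosen one is primitive.\<close>

lemma (in monic_split) galois_norm_Ints:
  assumes i: "i \<in> {1..n}"
  shows "(\<Prod>\<sigma>\<in>galois_perms. of_int x - \<alpha> (\<sigma> i)) \<in> \<int>"
proof (rule rational_algebraic_int_is_int)
  have im: "\<sigma> i \<in> {1..n}" if "\<sigma> \<in> galois_perms" for \<sigma>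
    using that galois_perms_subset permutes_in_image[of \<sigma> "{1..n}" i] i by auto
  have fin: "finite galois_perms" using finite_subset[OF galois_perms_subset finite_perms] .
  show "algebraic_int (\<Prod>\<sigma>\<in>galois_perms. of_int x - \<alpha> (\<sigma> i))"
    by (intro algebraic_int_prod algebraic_int_diff algebraic_int_of_int alg_int_root im)
  define b where "b = (\<lambda>\<rho>. \<Prod>\<sigma>\<in>galois_perms. of_int x - \<alpha> (\<rho> (\<sigma> i)))"
  have "b id \<in> \<rat>"
  proof (rule root_fun_galois_invariant_rat)
    show "b \<in> root_fun n \<alpha> \<rat>" unfolding b_def
      by (intro root_fun_prod root_fun_diff root_fun.const root_fun.root im) auto
    fix \<tau> assume \<tau>: "\<tau> \<in> galois_perms"
    have "inj_on (\<lambda>\<sigma>. \<tau> \<circ> \<sigma>) galois_perms"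
      using permutes_inj[of \<tau> "{1..n}"] \<tau> galois_perms_subset by (auto simp: inj_on_def fun_eq_iff dest: injD)
    moreover have "(\<lambda>\<sigma>. \<tau> \<circ> \<sigma>) ` galois_perms = galois_perms"
      using galois_perms_compose[OF \<tau>] by (intro endo_inj_surj fin calculation) auto
    ultimately have "bij_betw (\<lambda>\<sigma>. \<tau> \<circ> \<sigma>) galois_perms galois_perms" by (simp add: bij_betw_def)
    from prod.reindex_bij_betw[OF this, of "\<lambda>\<sigma>. of_int x - \<alpha> (\<sigma> i)"] show "b \<tau> = b id" by (simp add: b_def)
  qed
  then show "(\<Prod>\<sigma>\<in>galois_perms. of_int x - \<alpha> (\<sigma> i)) \<in> \<rat>" by (simp add: b_def)
qed

text \<open>\<open>q\<close> is a prime factor of the norm of \<open>x - \<zeta>\<close>, where \<open>\<zeta>\<close> is a primitive \<open>m\<close>-th root of unity.\<close>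
lemma prime_with_element_of_order:
  assumes m: "m > 0"
  shows "\<exists>q x. prime q \<and> q > N \<and> int q dvd x ^ m - 1 \<and> (\<forall>d. 0 < d \<longrightarrow> d < m \<longrightarrow> \<not> int q dvd x ^ d - 1)"
proof -
  define F where "F = monom 1 m - [:1::int:]"
  have dF: "degree F = m" 
  proof -
    have "F = monom 1 m + [:- 1:]" by (simp add: F_def)
    then show ?thesis using m by (simp only: degree_add_eq_left degree_monom_eq degree_pCons_0 one_neq_zero not_False_eq_True)
  qed
  have "lead_coeff F = 1" using m unfolding dF by (simp add: F_def coeff_monom coeff_pCons split: nat.splits)
  then obtain \<alpha> where "monic_split F m \<alpha>" using monic_split_exists[of F] dF by metis
  then interpret monic_split F m \<alpha> .
  have evalF: "poly (map_poly of_int F) z = z ^ m - 1" for z :: complex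
    by (simp add: F_def of_int_poly_hom.hom_minus of_int_hom.map_poly_hom_monom poly_monom)
  have unity: "\<alpha> i ^ m = 1" if "i \<in> {1..m}" for i
  proof -
    have "poly (map_poly of_int F) (\<alpha> i) = 0" unfolding poly_F by (rule prod_zero) (use that in \<open>auto intro!: bexI[of _ i]\<close>)
    then show ?thesis by (simp add: evalF)
  qed
  define \<zeta> where "\<zeta> = cis (2 * pi / real m)"
  have \<zeta>m: "\<zeta> ^ m = 1" using m by (simp add: \<zeta>_def DeMoivre)
  have \<zeta>d: "\<zeta> ^ d \<noteq> 1" if d: "0 < d" "d < m" for d
  proof
    assume "\<zeta> ^ d = 1"
    then have "cis (real d * (2 * pi / real m)) = 1" by (simp add: \<zeta>_def DeMoivre)
    then have "Re (cis (real d * (2 * pi / real m))) = 1" by simp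
    then have "cos (real d * (2 * pi / real m)) = 1" by simp
    then obtain k :: int where "real d * (2 * pi / real m) = k * 2 * pi" using cos_one_2pi_int by auto
    then have "real d = real_of_int k * real m" using m by (simp add: field_simps)
    then have e: "int d = k * int m" by (metis of_int_eq_iff of_int_mult of_int_of_nat_eq)
    have "k > 0"
    proof (rule ccontr)
      assume "\<not> k > 0"
      then have "k * int m \<le> 0" by (intro mult_nonpos_nonneg) auto
      then show False using e d by simp
    qed
    then have "1 * int m \<le> k * int m" by (intro mult_right_mono) auto
    then have "int m \<le> int d" unfolding e by simp
    then show False using d by simp
  qed
  have "(\<Prod>j\<in>{1..m}. \<zeta> - \<alpha> j) = 0" using poly_F[of \<zeta>] evalF[of \<zeta>] \<zeta>m by simp
  then obtain i0 where i0: "i0 \<in> {1..m}" "\<alpha> i0 = \<zeta>" by auto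
  \<comment> \<open>Being killed by X^d - 1 is a rational relation, so the inverse of \<sigma> would
    carry it back to \<zeta>.\<close>
  have primitive: "\<alpha> (\<sigma> i0) ^ d \<noteq> 1" if \<sigma>: "\<sigma> \<in> galois_perms" and d: "0 < d" "d < m" for \<sigma> d
  proof
    assume 1: "\<alpha> (\<sigma> i0) ^ d = 1"
    define b where "b = (\<lambda>\<rho>. \<alpha> (\<rho> (\<sigma> i0)) ^ d - 1)"
    have p: "\<sigma> permutes {1..m}" using \<sigma> galois_perms_subset by auto
    have "b \<in> root_fun m \<alpha> \<rat>" unfolding b_def
      using permutes_in_image[OF p, of i0] i0(1) by (intro root_fun_diff root_fun_power root_fun.const root_fun.root) auto
    moreover have "b id = 0" using 1 by (simp add: b_def)
    ultimately have "b (inv' \<sigma>) = 0" by (rule galois_permsD[OF galois_perms_inv[OF \<sigma>]])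
    then show False using \<zeta>d[OF d] permutes_inverses(2)[OF p] i0(2) by (simp add: b_def)
  qed
  \<comment> \<open>A prime dividing x^m - 1 is prime to \<open>x\<close>. The factor N! therefore
    makes it exceed \<open>N\<close>, and the factor \<open>m\<close> keeps it from dividing
    \<open>m\<close>. As x is at least 3, each factor of the norm has absolute value at least 2, so
    the norm does have a prime factor.\<close>
  define x where "x = 3 * int m * fact N"
  have x3: "x \<ge> 3"
  proof -
    have "1 * 1 \<le> int m * fact N" using m by (intro mult_mono) (auto simp: fact_ge_1)
    then show ?thesis by (simp add: x_def)
  qed
  have fin: "finite galois_perms" using finite_subset[OF galois_perms_subset finite_perms] .
  obtain k where k: "(\<Prod>\<sigma>\<in>galois_perms. of_int x - \<alpha> (\<sigma> i0)) = of_int k" using galois_norm_Ints[OF i0(1)] by (auto simp: Ints_def)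
  have big: "cmod (of_int x - \<alpha> (\<sigma> i0)) \<ge> 2" if \<sigma>: "\<sigma> \<in> galois_perms" for \<sigma>
  proof -
    have "\<sigma> i0 \<in> {1..m}" using \<sigma> galois_perms_subset permutes_in_image[of \<sigma> "{1..m}" i0] i0(1) by auto
    then have "cmod (\<alpha> (\<sigma> i0)) = 1" using power_eq_1_iff[OF unity] m by blast
    moreover have "cmod (of_int x) \<ge> 3" using x3 by simp
    ultimately show ?thesis using norm_triangle_ineq2[of "of_int x" "\<alpha> (\<sigma> i0)"] by linarith
  qed
  have "real_of_int \<bar>k\<bar> = (\<Prod>\<sigma>\<in>galois_perms. cmod (of_int x - \<alpha> (\<sigma> i0)))"
    using arg_cong[OF k, of cmod] by (simp add: prod_norm)
  also have "\<dots> \<ge> (\<Prod>\<sigma>\<in>galois_perms. 2)" using big by (intro prod_mono) auto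
  also have "(\<Prod>\<sigma>\<in>galois_perms. 2::real) = 2 ^ card galois_perms" by simp
  finally have "real_of_int \<bar>k\<bar> \<ge> 2 ^ card galois_perms" .
  moreover have "card galois_perms \<noteq> 0" using fin galois_perms_id by (metis card_0_eq empty_iff)
  then have "(2::real) ^ card galois_perms \<ge> 2 ^ 1" by (intro power_increasing) auto
  ultimately have "\<bar>k\<bar> \<noteq> 1" by auto
  then obtain q' where q': "prime q'" "q' dvd k" by (rule prime_factor_int)
  define q where "q = nat q'"
  have q: "prime q" "int q dvd k" using q' prime_ge_0_int by (auto simp: q_def)
  obtain P where P: "prime_ideal_of all_integers P" "of_nat q \<in> P"
    by (rule prime_ideal_exists[OF int_subring_all_integers q(1)])
  have PP: "prime_ideal_in all_integers P" using P(1) int_subring_all_integers by unfold_locales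
  interpret prime_ideal_in all_integers P by fact
  have im: "\<sigma> i0 \<in> {1..m}" if "\<sigma> \<in> galois_perms" for \<sigma>
    using that galois_perms_subset permutes_in_image[of \<sigma> "{1..m}" i0] i0(1) by auto
  have "(\<Prod>\<sigma>\<in>galois_perms. of_int x - \<alpha> (\<sigma> i0)) \<in> P" unfolding k by (rule P_of_int_dvd[OF P(2) q(2)])
  then have "\<exists>\<sigma>\<in>galois_perms. of_int x - \<alpha> (\<sigma> i0) \<in> P"
    by (rule P_prod[OF fin, rotated]) (simp only: mem_Collect_eq, intro algebraic_int_diff algebraic_int_of_int alg_int_root im)
  then obtain \<sigma> where \<sigma>: "\<sigma> \<in> galois_perms" "of_int x - \<alpha> (\<sigma> i0) \<in> P" by blast
  define z where "z = \<alpha> (\<sigma> i0)"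
  have z: "algebraic_int z" "z ^ m = 1" using alg_int_root[OF im[OF \<sigma>(1)]] unity[OF im[OF \<sigma>(1)]] by (auto simp: z_def)
  have pw: "of_int x ^ d - z ^ d \<in> P" for d
  proof -
    have "of_int x ^ d - z ^ d = (of_int x - z) * (\<Sum>i<d. z ^ (d - Suc i) * of_int x ^ i)" by (rule power_diff_sumr2)
    also have "\<dots> \<in> P" using \<sigma>(2) z(1)
      by (intro P_mult2) (auto simp: z_def[symmetric] intro!: algebraic_int_sum algebraic_int_mult algebraic_int_power)
    finally show ?thesis .
  qed
  have qx: "\<not> int q dvd x"
  proof
    assume "int q dvd x"
    then have "of_int x * of_int x ^ (m - 1) \<in> P" by (intro P_mult2 P_of_int_dvd[OF P(2)]) (auto intro!: algebraic_int_power)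
    then have "of_int x ^ m \<in> P" using m by (cases m) auto
    from P_diff[OF this pw[of m]] show False using z(2) P_one by simp
  qed
  have "int q dvd x ^ m - 1"
    using pw[of m] z(2) by (intro P_int[OF q(1) P(2)]) simp
  moreover have "q > N"
  proof (rule ccontr)
    assume "\<not> q > N"
    then have "q dvd fact N" using prime_gt_0_nat[OF q(1)] by (intro dvd_fact) auto
    then have "int q dvd fact N" by (metis of_nat_dvd_iff of_nat_fact)
    then show False using qx by (simp add: x_def)
  qed
  moreover have "\<not> int q dvd x ^ d - 1" if d: "0 < d" "d < m" for d
  proof
    assume "int q dvd x ^ d - 1"
    then have "of_int (x ^ d - 1) \<in> P" by (rule P_of_int_dvd[OF P(2)])
    then have "of_int (x ^ d - 1) - (of_int x ^ d - z ^ d) \<in> P" using pw by (rule P_diff)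
    then have zd: "z ^ d - 1 \<in> P" by simp
    \<comment> \<open>Both z^d and 1 are zeros of X^m - 1. They are distinct by primitivity and stay
      distinct modulo \<open>P\<close>, since \<open>q\<close> does not divide
      \<open>m\<close>.\<close>
    have "poly (map_poly of_int F) (z ^ d) = 0" using z(2) by (simp add: evalF power_mult[symmetric] mult.commute[of d]) (simp add: power_mult)
    then obtain a where a: "a \<in> {1..m}" "\<alpha> a = z ^ d" unfolding poly_F by auto
    have "poly (map_poly of_int F) (1::complex) = 0" unfolding evalF by simp
    then obtain b where b: "b \<in> {1..m}" "\<alpha> b = 1" unfolding poly_F by auto
    have "a \<noteq> b" using a b primitive[OF \<sigma>(1) d] by (auto simp: z_def)
    moreover have "\<not> q dvd m" using qx by (auto simp: x_def)
    then have "\<alpha> a - \<alpha> b \<notin> P"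
      using root_diff_not_in_prime[OF PP P(2), of F a b] separable_binomial[OF PP q(1) P(2), of m 1]
        m a(1) b(1) \<open>a \<noteq> b\<close> prime_gt_1_nat[OF q(1)] by (auto simp: F_def)
    ultimately show False using zd a b by simp
  qed
  ultimately show ?thesis using q(1) by blast
qed

text \<open>An element of order \<open>m\<close> modulo \<open>q\<close> forces \<open>m\<close> to
  divide q - 1. A primitive root can then serve as \<open>a\<close>: raised to the power (q - 1)/m
  it has order exactly \<open>m\<close>.\<close>

lemma kummer_prime_exists:
  assumes m: "m > 0"
  shows "\<exists>q a. kummer_prime q m a \<and> q > N"
proof -
  obtain q x where q: "prime q" "q > N" and x: "int q dvd x ^ m - 1"
    "\<And>d. 0 < d \<Longrightarrow> d < m \<Longrightarrow> \<not> int q dvd x ^ d - 1"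
    using prime_with_element_of_order[OF m, of N] by blast
  have q1: "q > 1" using prime_gt_1_nat[OF q(1)] .
  define y where "y = nat (x mod int q)"
  have y: "[int y = x] (mod int q)" using q1 by (simp add: y_def cong_def)
  have dvd: "[y ^ d = 1] (mod q) \<longleftrightarrow> int q dvd x ^ d - 1" for d
  proof -
    have "[y ^ d = 1] (mod q) \<longleftrightarrow> [int y ^ d = 1] (mod int q)"
      by (metis cong_int_iff of_nat_1 of_nat_power)
    also have "\<dots> \<longleftrightarrow> [x ^ d = 1] (mod int q)"
      using cong_pow[OF y, of d] by (meson cong_sym cong_trans)
    finally show ?thesis by (simp add: cong_iff_dvd_diff)
  qed
  have om: "ord q y dvd m" using x(1) dvd ord_divides by blast
  then have o0: "ord q y > 0" using m by (metis dvd_0_left_iff neq0_conv)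
  have "\<not> ord q y < m" using x(2)[OF o0] dvd[of "ord q y"] ord_works[of y q] by blast
  then have "ord q y = m" using om m by (meson dvd_imp_le le_neq_implies_less)
  moreover have "coprime q y" using o0 by (auto simp: ord_def split: if_splits)
  ultimately have "m dvd totient q" using order_divides_totient by blast
  then have mq: "m dvd q - 1" using q(1) by (simp add: totient_prime)
  then obtain c where c: "q - 1 = m * c" by blast
  obtain g where g: "residue_primroot q g" using prime_primitive_root_exists[OF q1 q(1)] by blast
  then have og: "ord q g = q - 1" "coprime q g" using q(1) by (auto simp: residue_primroot_def totient_prime)
  have c': "(q - 1) div m = c" using c m by simp
  have "\<not> int q dvd frobenius_scalar q m (int g) ^ d - 1" if d: "0 < d" "d < m" for d
  proof
    assume "int q dvd frobenius_scalar q m (int g) ^ d - 1"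
    then have "[int (g ^ (c * d)) = int 1] (mod int q)"
      unfolding frobenius_scalar_def c' by (simp add: power_mult cong_iff_dvd_diff)
    then have "[g ^ (c * d) = 1] (mod q)" by (simp only: cong_int_iff)
    then have "q - 1 dvd c * d" using ord_divides og by metis
    then have "c * m dvd c * d" by (metis c mult.commute)
    moreover have "c \<noteq> 0"
    proof
      assume "c = 0"
      then have "q - 1 = 0" using c by simp
      then show False using q1 by simp
    qed
    ultimately have "m dvd d" by simp
    then show False using d by (auto dest: dvd_imp_le)
  qed
  moreover have "\<not> int q dvd int g"
  proof
    assume "int q dvd int g"
    then have "q dvd g" by simp
    then have "q dvd 1" by (rule coprime_common_divisor[OF og(2) dvd_refl])
    then show False using q1 by simp
  qed
  ultimately have "kummer_prime q m (int g)" using q(1) m mq by (auto simp: kummer_prime_def)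
  then show ?thesis using q(2) by blast
qed

section \<open>Chinese remaindering of polynomials\<close>

lemma chinese_remainder_int:
  fixes M u :: "'i \<Rightarrow> int"
  assumes "finite A" "\<And>i j. i \<in> A \<Longrightarrow> j \<in> A \<Longrightarrow> i \<noteq> j \<Longrightarrow> coprime (M i) (M j)"
  shows "\<exists>x. \<forall>i\<in>A. M i dvd x - u i"
  using assms
proof (induction A rule: finite_induct)
  case (insert i A)
  then obtain x where x: "\<forall>j\<in>A. M j dvd x - u j" by auto
  have "coprime (M i) (\<Prod>j\<in>A. M j)"
    using insert by (intro prod_coprime_right) auto
  then obtain r s where rs: "r * M i + s * (\<Prod>j\<in>A. M j) = 1" by (metis bezout_int coprime_iff_gcd_eq_1)
  define y where "y = x + (\<Prod>j\<in>A. M j) * (s * (u i - x))"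
  have "y - u i = (x - u i) * (1 - s * (\<Prod>j\<in>A. M j))" by (simp add: y_def algebra_simps)
  also have "1 - s * (\<Prod>j\<in>A. M j) = r * M i" using rs by simp
  finally have "M i dvd y - u i" by simp
  moreover have "M j dvd y - u j" if j: "j \<in> A" for j
  proof -
    have "M j dvd (\<Prod>j\<in>A. M j)" using insert.hyps(1) j by (simp add: dvd_prodI)
    then have "M j dvd (x - u j) + (\<Prod>j\<in>A. M j) * (s * (u i - x))" using x j by auto
    then show ?thesis by (simp add: y_def algebra_simps)
  qed
  ultimately show ?case by (intro exI[of _ y]) auto
qed simp

lemma chinese_remainder_poly:
  fixes M :: "'i \<Rightarrow> int" and U :: "'i \<Rightarrow> int poly"
  assumes "finite A" "\<And>i j. i \<in> A \<Longrightarrow> j \<in> A \<Longrightarrow> i \<noteq> j \<Longrightarrow> coprime (M i) (M j)"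
    and "\<And>i k. i \<in> A \<Longrightarrow> k \<ge> n \<Longrightarrow> coeff (U i) k = 0"
  shows "\<exists>h. (\<forall>k\<ge>n. coeff h k = 0) \<and> (\<forall>i\<in>A. \<forall>k. M i dvd coeff h k - coeff (U i) k)"
proof -
  have "\<forall>k. \<exists>x. \<forall>i\<in>A. M i dvd x - coeff (U i) k"
    by (intro allI chinese_remainder_int assms(1,2))
  then obtain x where x: "\<And>k i. i \<in> A \<Longrightarrow> M i dvd x k - coeff (U i) k" by metis
  define h where "h = (\<Sum>k<n. monom (x k) k)"
  have c: "coeff h k = (if k < n then x k else 0)" for k
    by (simp add: h_def coeff_sum coeff_monom)
  show ?thesis
    by (rule exI[of _ h]) (use x assms(3) in \<open>auto simp: c\<close>)
qed

section \<open>Discriminants in a linear family\<close>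

text \<open>The discriminant is a polynomial in the coefficients, so it can be formed over the
  polynomials in s and specialised afterwards. The bound on \<open>k\<close> keeps the degree, and
  hence the size of the Hankel matrix, constant. Integer arguments serve the arithmetic, complex
  ones locate the zeros of \<open>D\<close>.\<close>

lemma discr_linear_family:
  fixes h k :: "int poly"
  assumes h: "degree h = n" and k: "\<And>i. i \<ge> n \<Longrightarrow> coeff k i = 0"
    and lh: "lead_coeff h = 1" and n: "n > 0"
  obtains D :: "int poly"
  where "\<And>s. poly D s = discr (h + smult s k)"
    "\<And>z::complex. poly (map_poly of_int D) z = discr (map_poly of_int h + smult z (map_poly of_int k))"
proof -
  define c where "c = (\<lambda>i. if i \<le> n then [:coeff h (n - i), coeff k (n - i):] else 0)"
  define D where "D = disc_coeffs n c"
  have dk: "degree k < n" using k n by (metis degree_0 leading_coeff_0_iff not_less)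
  have deg: "degree (h + smult s k) = n" for s
  proof -
    have "degree (smult s k) < n" using dk degree_smult_le[of s k] by linarith
    then show ?thesis using h by (simp add: degree_add_eq_left)
  qed
  have degc: "degree (map_poly of_int h + smult z (map_poly of_int k) :: complex poly) = n" for z
  proof -
    have "degree (smult z (map_poly of_int k)) < n" using dk degree_smult_le[of z "map_poly of_int k"] by simp
    then show ?thesis using h by (simp add: degree_add_eq_left)
  qed
  show ?thesis
  proof (rule that[of D])
    fix s
    have "poly D s = disc_coeffs n (\<lambda>i. poly (c i) s)"
      unfolding D_def by (rule poly_hom.hom_disc_coeffs)
    also have "(\<lambda>i. poly (c i) s) = coeff (reflect_poly (h + smult s k))"
      by (auto simp: c_def fun_eq_iff coeff_reflect_poly deg)
    finally show "poly D s = discr (h + smult s k)" by (simp add: discr_def deg)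
  next
    fix z :: complex
    have "map_poly of_int D = disc_coeffs n (\<lambda>i. map_poly of_int (c i) :: complex poly)"
      unfolding D_def by (rule of_int_poly_hom.hom_disc_coeffs)
    then have "poly (map_poly of_int D) z = disc_coeffs n (\<lambda>i. poly (map_poly of_int (c i)) z)"
      by (simp add: poly_hom.hom_disc_coeffs)
    also have "(\<lambda>i. poly (map_poly of_int (c i)) z) = coeff (reflect_poly (map_poly of_int h + smult z (map_poly of_int k)))"
      by (auto simp: c_def fun_eq_iff coeff_reflect_poly degc of_int_hom.map_poly_pCons_hom)
    finally show "poly (map_poly of_int D) z = discr (map_poly of_int h + smult z (map_poly of_int k))"
      by (simp add: discr_def degc)
  qed
qed

text \<open>Write f = g + m u. The discriminant of g + s u is an integer polynomial in s, and its
  values at \<open>m\<close> and at 0 are congruent modulo \<open>m\<close>.\<close>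

lemma discr_cong:
  fixes f g :: "int poly"
  assumes "degree f = n" "lead_coeff f = 1" "degree g = n" "lead_coeff g = 1" "n > 0"
    and cong: "\<And>i. m dvd coeff f i - coeff g i"
  shows "m dvd discr f - discr g"
proof -
  define u where "u = map_poly (\<lambda>c. c div m) (f - g)"
  have cu: "coeff u i = (coeff f i - coeff g i) div m" for i by (simp add: u_def coeff_map_poly)
  have fg: "f = g + smult m u"
    using cong by (intro poly_eqI) (simp add: cu)
  have "coeff u i = 0" if "i \<ge> n" for i
    using that assms(1-4) by (cases "i = n") (auto simp: cu coeff_eq_0)
  then obtain D where D: "\<And>s. poly D s = discr (g + smult s u)"
    using discr_linear_family[OF assms(3) _ assms(4,5), of u] by blast
  have "m dvd poly D m - poly D 0" by (cases D) simp
  then show ?thesis unfolding D fg by simp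
qed

lemma complex_discr_eq_0_iff:
  fixes G :: "complex poly"
  assumes "lead_coeff G = 1"
  shows "discr G = 0 \<longleftrightarrow> (\<exists>w. poly G w = 0 \<and> poly (pderiv G) w = 0)"
proof -
  define n where "n = degree G"
  obtain A where A: "size A = n" "G = smult (lead_coeff G) (\<Prod>x\<in>#A. [:-x, 1:])"
    using alg_closed_imp_factorization[of G] assms unfolding n_def by fastforce
  obtain xs where xs: "mset xs = A" using ex_mset by blast
  define a where "a = (\<lambda>i. xs ! i)"
  have "G = (\<Prod>x\<leftarrow>xs. [:-x, 1:])"
    using A(2) assms unfolding xs[symmetric] by (simp add: prod_mset_prod_list[symmetric])
  also have "\<dots> = (\<Prod>i<n. [:- a i, 1:])"
    using A(1) xs by (auto simp: prod.list_conv_set_nth atLeast0LessThan a_def)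
  finally have G: "G = (\<Prod>i<n. [:- a i, 1:])" .
  have pd: "poly (pderiv G) (a i) = (\<Prod>j\<in>{..<n}-{i}. a i - a j)" if i: "i < n" for i
  proof -
    have "G = [:- a i, 1:] * (\<Prod>j\<in>{..<n}-{i}. [:- a j, 1:])"
      unfolding G using i by (simp add: prod.remove)
    then have "pderiv G = [:- a i, 1:] * pderiv (\<Prod>j\<in>{..<n}-{i}. [:- a j, 1:]) + (\<Prod>j\<in>{..<n}-{i}. [:- a j, 1:]) * [:1:]"
      by (simp only: pderiv_mult) (simp add: pderiv_pCons)
    then show ?thesis by (simp add: poly_prod)
  qed
  have d: "discr G = (\<Prod>j<n. \<Prod>i<j. a j - a i)\<^sup>2" unfolding G by (rule discr_roots)
  show ?thesis
  proof
    assume "discr G = 0"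
    then have "(\<Prod>j<n. \<Prod>i<j. a j - a i) = 0" unfolding d by simp
    then obtain j where j: "j \<in> {..<n}" "(\<Prod>i<j. a j - a i) = 0" by (auto simp only: prod_zero_iff finite_lessThan)
    then obtain i where "i \<in> {..<j}" "a j - a i = 0" by (auto simp only: prod_zero_iff finite_lessThan)
    with j have ij: "j < n" "i < j" "a j = a i" by auto
    then have "poly (pderiv G) (a j) = 0" unfolding pd[OF ij(1)]
      by (intro prod_zero) (use ij in \<open>auto intro!: bexI[of _ i]\<close>)
    moreover have "poly G (a j) = 0" unfolding G poly_prod by (rule prod_zero) (use ij in \<open>auto intro!: bexI[of _ j]\<close>)
    ultimately show "\<exists>w. poly G w = 0 \<and> poly (pderiv G) w = 0" by blast
  next
    assume "\<exists>w. poly G w = 0 \<and> poly (pderiv G) w = 0"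
    then obtain w where w: "poly G w = 0" "poly (pderiv G) w = 0" by blast
    from w(1) obtain j where j: "j < n" "w = a j" unfolding G poly_prod by auto
    then obtain i where i: "i < n" "i \<noteq> j" "a j = a i" using w(2) pd[OF j(1)] by auto
    have "(\<Prod>j<n. \<Prod>i<j. a j - a i) = 0"
    proof (cases "i < j")
      case True
      then have "(\<Prod>i<j. a j - a i) = 0" using i by (intro prod_zero) (auto intro!: bexI[of _ i])
      with j(1) have "\<exists>j\<in>{..<n}. (\<Prod>i<j. a j - a i) = 0" by blast
      then show ?thesis by (rule prod_zero[OF finite_lessThan])
    next
      case False
      then have "(\<Prod>j<i. a i - a j) = 0" using i by (intro prod_zero) (auto intro!: bexI[of _ j])
      with i(1) have "\<exists>j\<in>{..<n}. (\<Prod>i<j. a j - a i) = 0" by blast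
      then show ?thesis by (rule prod_zero[OF finite_lessThan])
    qed
    then show "discr G = 0" unfolding d by simp
  qed
qed

lemma discr_not_dvd_if_separable:
  fixes F E :: "int poly"
  assumes F: "lead_coeff F = 1" and q: "prime q"
    and cong: "\<And>i. int q dvd coeff F i - coeff E i"
    and sep: "\<And>P x. prime_ideal_in all_integers P \<Longrightarrow> of_nat q \<in> P \<Longrightarrow> algebraic_int x \<Longrightarrow>
       poly (map_poly of_int E) x \<in> P \<Longrightarrow> poly (map_poly of_int (pderiv E)) x \<notin> P"
  shows "\<not> int q dvd discr F"
proof
  assume d: "int q dvd discr F"
  obtain \<alpha> where "monic_split F (degree F) \<alpha>" using monic_split_exists[OF F] .
  then interpret monic_split F "degree F" \<alpha> .
  obtain P where P: "prime_ideal_of all_integers P" "of_nat q \<in> P"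
    by (rule prime_ideal_exists[OF int_subring_all_integers q])
  have PP: "prime_ideal_in all_integers P" using P(1) int_subring_all_integers by unfold_locales
  have "of_int (discr F) \<in> P" by (rule prime_ideal_in.P_of_int_dvd[OF PP P(2) d])
  from roots_congruent_if_discr_in_prime[OF PP this]
  show False using root_diff_not_in_prime[OF PP P(2) cong sep[OF PP P(2)]] by blast
qed

text \<open>The zeros are the two square roots of \<open>r\<close> and 1, ..., n - 2. Modulo a prime
  ideal above \<open>r\<close> only the two square roots coincide, since r > n. Their difference
  contributes the factor 4 r to the discriminant, and the rest is the square of an element outside
  the ideal.\<close>

lemma discr_quadratic_times_linear:
  assumes n: "n \<ge> 2" and r: "prime r" "r > n" "r > 2"
  shows "int r dvd discr (quadratic_times_linear n (int r))" "\<not> (int r)\<^sup>2 dvd discr (quadratic_times_linear n (int r))"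
proof -
  let ?F = "quadratic_times_linear n (int r)"
  define s where "s = csqrt (of_nat r)"
  have s2: "s\<^sup>2 = of_nat r" unfolding s_def by (rule power2_csqrt)
  define \<alpha> where "\<alpha> = (\<lambda>i::nat. if i = 1 then s else if i = 2 then - s else of_nat (i - 2))"
  interpret monic_split ?F n \<alpha>
  proof
    have "(\<Prod>c\<in>{1..int n - 2}. [:- of_int c, 1:]) = (\<Prod>i\<in>{3..n}. [:- \<alpha> i, 1:])"
      by (rule prod.reindex_bij_witness[of _ "\<lambda>i. int i - 2" "\<lambda>c. nat (c + 2)"]) (auto simp: \<alpha>_def nat_add_distrib of_nat_diff)
    moreover have "map_poly of_int [:- int r, 0, 1:] = [:- s, 1:] * [:s, 1:]"
      using s2 by (simp add: of_int_hom.map_poly_pCons_hom power2_eq_square)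
    moreover have "{1..n} = insert 1 (insert 2 {3..n})" using n by auto
    ultimately show "map_poly of_int ?F = (\<Prod>i\<in>{1..n}. [:- \<alpha> i, 1:])"
      unfolding quadratic_times_linear_def of_int_poly_hom.hom_mult of_int_poly_hom.hom_prod
      by (simp add: of_int_hom.map_poly_pCons_hom \<alpha>_def mult.assoc del: mult_pCons_left mult_pCons_right)
  qed
  obtain P where P: "prime_ideal_of all_integers P" "of_nat r \<in> P"
    by (rule prime_ideal_exists[OF int_subring_all_integers r(1)])
  have PP: "prime_ideal_in all_integers P" using P(1) int_subring_all_integers by unfold_locales
  interpret prime_ideal_in all_integers P by fact
  have sint: "algebraic_int s" using alg_int_root[of 1] n by (simp add: \<alpha>_def)
  have sP: "s \<in> P" using P_power[of s 2] sint P(2) s2 by simp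
  let ?f = "\<lambda>j i. \<alpha> (Suc j) - \<alpha> (Suc i)"
  \<comment> \<open>With indices starting at 0, the factor at j = 1 is the difference of the two
    square roots alone; \<open>u\<close> collects all other differences.\<close>
  define u where "u = (\<Prod>j\<in>{..<n}-{1}. \<Prod>i<j. ?f j i)"
  have fint: "algebraic_int (?f j i)" if "j < n" "i < j" for i j
    using that alg_int_root[of "Suc j"] alg_int_root[of "Suc i"] by (intro algebraic_int_diff) auto
  have uint: "algebraic_int u" unfolding u_def by (intro algebraic_int_prod fint) auto
  have small: "\<not> int r dvd c" if "c \<noteq> 0" "\<bar>c\<bar> < int r" for c
    using that zdvd_imp_le[of "int r" "\<bar>c\<bar>"] by auto
  have "u \<notin> P"
  proof
    assume "u \<in> P"
    then have "\<exists>j\<in>{..<n}-{1}. (\<Prod>i<j. ?f j i) \<in> P" unfolding u_def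
      by (rule P_prod[rotated 2]) (auto intro!: algebraic_int_prod fint)
    then obtain j where j: "j < n" "j \<noteq> 1" "(\<Prod>i<j. ?f j i) \<in> P" by auto
    from j(3) have "\<exists>i\<in>{..<j}. ?f j i \<in> P"
      by (rule P_prod[rotated 2]) (use j(1) fint in auto)
    then obtain i where i: "i < j" "?f j i \<in> P" by auto
    then have j2: "j \<ge> 2" using j(2) by auto
    have aj: "\<alpha> (Suc j) = of_int (int j - 1)" using j2 by (simp add: \<alpha>_def of_nat_diff)
    show False
    proof (cases "i \<ge> 2")
      case True
      then have "\<alpha> (Suc i) = of_int (int i - 1)" by (simp add: \<alpha>_def of_nat_diff)
      then have "of_int (int j - int i) \<in> P" using i(2) aj by (simp add: algebra_simps)
      then have "int r dvd int j - int i" by (rule P_int[OF r(1) P(2)])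
      then show False using small[of "int j - int i"] i(1) j(1) r(2) by auto
    next
      case False
      then have "i = 0 \<or> i = 1" by auto
      then have "\<alpha> (Suc i) \<in> P" using sP P_minus[OF sP] by (auto simp: \<alpha>_def)
      from P_add[OF i(2) this] have "of_int (int j - 1) \<in> P" using aj by simp
      then have "int r dvd int j - 1" by (rule P_int[OF r(1) P(2)])
      then show False using small[of "int j - 1"] j2 j(1) r(2) by auto
    qed
  qed
  have "(\<Prod>j<n. \<Prod>i<j. ?f j i) = (\<Prod>i<1. ?f 1 i) * u"
    unfolding u_def using n by (intro prod.remove) auto
  then have "of_int (discr ?F) = ((- s - s) * u)\<^sup>2" unfolding discr_F by (simp add: \<alpha>_def numeral_2_eq_2)
  also have "\<dots> = 4 * s\<^sup>2 * u\<^sup>2" by (simp add: power2_eq_square algebra_simps)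
  finally have du: "of_int (discr ?F) = 4 * of_nat r * u\<^sup>2" unfolding s2 .
  have r0: "r \<noteq> 0" using r by auto
  have "u\<^sup>2 = of_int (discr ?F) / (4 * of_nat r)" using du r0 by simp
  then have "u\<^sup>2 \<in> \<rat>" by simp
  then have "u\<^sup>2 \<in> \<int>" using rational_algebraic_int_is_int algebraic_int_power[OF uint] by blast
  then obtain w where w: "u\<^sup>2 = of_int w" by (auto simp: Ints_def)
  have "of_int (discr ?F) = (of_int (4 * int r * w) :: complex)" using du w by simp
  then have D: "discr ?F = 4 * int r * w" by (simp only: of_int_eq_iff)
  then show "int r dvd discr ?F" by simp
  have "\<not> int r dvd w"
  proof
    assume "int r dvd w"
    then have "u\<^sup>2 \<in> P" unfolding w by (rule P_of_int_dvd[OF P(2)])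
    then show False using P_power[of u 2] uint \<open>u \<notin> P\<close> by simp
  qed
  moreover have "\<not> int r dvd 4"
  proof
    assume "int r dvd 4"
    then have "int r dvd 2 * 2" by simp
    then have "int r dvd 2" using r(1) by (metis prime_dvd_mult_iff prime_nat_int_transfer)
    then show False using small[of 2] r(3) by simp
  qed
  ultimately have "\<not> int r dvd 4 * w" using r(1) by (metis prime_dvd_mult_iff prime_nat_int_transfer)
  moreover have "(int r)\<^sup>2 dvd discr ?F \<longleftrightarrow> int r dvd 4 * w"
  proof -
    have "discr ?F = int r * (4 * w)" using D by simp
    then show ?thesis using r0 by (simp only: power2_eq_square dvd_mult_cancel_left) simp
  qed
  ultimately show "\<not> (int r)\<^sup>2 dvd discr ?F" by simp
qed

section \<open>Irreducibility\<close>

lemma poly_of_int_smult_dvd_root: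
  fixes W A :: "int poly" and w :: complex
  assumes "c \<noteq> 0" "W dvd smult c A" "poly (map_poly of_int W) w = 0"
  shows "poly (map_poly of_int A) w = 0"
proof -
  obtain t where "smult c A = W * t" using assms(2) by blast
  then have "poly (map_poly of_int (smult c A)) w = poly (map_poly of_int (W * t)) w" by simp
  then show ?thesis using assms(1,3) by (simp add: of_int_hom.map_poly_hom_smult of_int_poly_hom.hom_mult)
qed

text \<open>Let \<open>m\<close> have least degree among the nonzero integer polynomials vanishing
  at \<open>w\<close>. Pseudo-division shows that \<open>m\<close> divides a constant multiple of
  every such polynomial, and Gauss's lemma on contents makes \<open>W\<close> a constant times the
  primitive part of \<open>m\<close>. Contents are unrestricted, hence the constant
  \<open>c\<close>.\<close>

lemma dvd_smult_if_common_root: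
  fixes W A :: "int poly" and w :: complex
  assumes irr: "\<And>u v. W = u * v \<Longrightarrow> degree u = 0 \<or> degree v = 0"
    and W0: "W \<noteq> 0" and Ww: "poly (map_poly of_int W) w = 0" and Aw: "poly (map_poly of_int A) w = 0"
  shows "\<exists>c. c \<noteq> 0 \<and> W dvd smult c A"
proof -
  define Q where "Q = (\<lambda>B::int poly. B \<noteq> 0 \<and> poly (map_poly of_int B) w = 0)"
  obtain m where m: "Q m" "\<And>B. Q B \<Longrightarrow> degree m \<le> degree B"
    using ex_has_least_nat[of Q W degree] W0 Ww by (auto simp: Q_def)
  have m0: "m \<noteq> 0" and mw: "poly (map_poly of_int m) w = 0" using m(1) by (auto simp: Q_def)
  have pd: "\<exists>c t. c \<noteq> 0 \<and> smult c B = m * t" if B: "poly (map_poly of_int B) w = 0" for B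
  proof -
    obtain c t where ct: "c \<noteq> 0" "smult c B = m * t + pseudo_mod B m" using pseudo_mod(1)[OF m0, of B] by blast
    have "poly (map_poly of_int (smult c B)) w = poly (map_poly of_int (m * t + pseudo_mod B m)) w" using ct(2) by simp
    then have "poly (map_poly of_int (pseudo_mod B m)) w = 0"
      using B mw by (simp add: of_int_hom.map_poly_hom_smult of_int_poly_hom.hom_mult of_int_poly_hom.hom_add)
    then have "pseudo_mod B m \<noteq> 0 \<Longrightarrow> degree m \<le> degree (pseudo_mod B m)"
      by (intro m(2)) (simp add: Q_def)
    then have "pseudo_mod B m = 0" using pseudo_mod(2)[OF m0, of B] by linarith
    then show ?thesis using ct by auto
  qed
  define m' where "m' = primitive_part m"
  have mm': "m = smult (content m) m'" by (simp add: m'_def)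
  have cm0: "content m \<noteq> 0" using m0 by simp
  have cm': "content m' = 1" using m0 by (simp add: m'_def)
  obtain c t where ct: "c \<noteq> 0" "smult c W = m * t" using pd[OF Ww] by blast
  then have W1: "smult c W = m' * smult (content m) t" by (metis mm' mult_smult_left mult_smult_right)
  have "content (smult c W) = content (smult (content m) t)"
    unfolding W1 content_mult cm' by simp
  then have "c dvd content (smult (content m) t)" by (metis content_smult dvd_mult2 dvd_normalize_iff dvd_refl)
  then have "[:c:] dvd smult (content m) t" by (rule iffD2[OF const_poly_dvd_iff_dvd_content])
  then obtain e where "smult (content m) t = [:c:] * e" by blast
  then have e: "smult (content m) t = smult c e" by simp
  have "smult c W = smult c (m' * e)" unfolding W1 e by simp
  then have We: "W = m' * e" using ct(1) by (simp add: poly_eq_iff)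
  have "degree m' \<noteq> 0"
  proof
    assume "degree m' = 0"
    then obtain a where a: "m' = [:a:]" by (rule degree_eq_zeroE)
    then have "a \<noteq> 0" using cm' by auto
    moreover define b where "b = content m * a"
    have "m = [:b:]" using mm' a by (simp add: b_def)
    then have "b = 0" using mw by (simp add: of_int_hom.map_poly_pCons_hom)
    ultimately show False using cm0 by (simp add: b_def)
  qed
  with irr[OF We] have "degree e = 0" by simp
  then obtain a where a: "e = [:a:]" by (rule degree_eq_zeroE)
  have a0: "a \<noteq> 0" using W0 We a by auto
  have W2: "W = smult a m'" using We a by simp
  obtain d u where du: "d \<noteq> 0" "smult d A = m * u" using pd[OF Aw] by blast
  have "smult (a * d) A = smult a (m * u)" using du(2) by (metis smult_smult)
  also have "\<dots> = smult a (smult (content m) m' * u)" using mm' by simp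
  also have "\<dots> = W * smult (content m) u" unfolding W2 by (simp add: mult.commute)
  finally have eq: "smult (a * d) A = W * smult (content m) u" .
  have "W dvd smult (a * d) A" unfolding eq by (rule dvd_triv_left)
  then show ?thesis using a0 du(1) by (intro exI[of _ "a * d"]) simp
qed

lemma eisenstein:
  fixes W :: "int poly"
  assumes p: "prime p" and low: "\<And>i. i < degree W \<Longrightarrow> p dvd coeff W i"
    and lead: "\<not> p dvd lead_coeff W" and const: "\<not> p\<^sup>2 dvd coeff W 0" and W: "W = u * v"
  shows "degree u = 0 \<or> degree v = 0"
proof (rule ccontr)
  assume "\<not> ?thesis"
  then have du: "degree u > 0" and dv: "degree v > 0" by auto
  have W0: "W \<noteq> 0" using lead by auto
  then have uv0: "u \<noteq> 0" "v \<noteq> 0" using W by auto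
  have lc: "\<not> p dvd lead_coeff u" "\<not> p dvd lead_coeff v" using lead unfolding W lead_coeff_mult by auto
  define i where "i = (LEAST i. \<not> p dvd coeff u i)"
  define j where "j = (LEAST j. \<not> p dvd coeff v j)"
  have i: "\<not> p dvd coeff u i" "i \<le> degree u" "\<And>k. k < i \<Longrightarrow> p dvd coeff u k"
    using LeastI[where P = "\<lambda>k. \<not> p dvd coeff u k", OF lc(1)] Least_le[where P = "\<lambda>k. \<not> p dvd coeff u k", OF lc(1)]
      not_less_Least[where P = "\<lambda>k. \<not> p dvd coeff u k"]
    unfolding i_def by blast+
  have j: "\<not> p dvd coeff v j" "j \<le> degree v" "\<And>k. k < j \<Longrightarrow> p dvd coeff v k"
    using LeastI[where P = "\<lambda>k. \<not> p dvd coeff v k", OF lc(2)] Least_le[where P = "\<lambda>k. \<not> p dvd coeff v k", OF lc(2)]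
      not_less_Least[where P = "\<lambda>k. \<not> p dvd coeff v k"]
    unfolding j_def by blast+
  have "coeff W (i + j) = (\<Sum>k\<le>i+j. coeff u k * coeff v (i + j - k))" unfolding W by (rule coeff_mult)
  also have "\<dots> = coeff u i * coeff v j + (\<Sum>k\<in>{..i+j}-{i}. coeff u k * coeff v (i + j - k))"
    by (subst sum.remove[of _ i]) auto
  finally have e: "coeff W (i + j) = coeff u i * coeff v j + (\<Sum>k\<in>{..i+j}-{i}. coeff u k * coeff v (i + j - k))" .
  have "p dvd (\<Sum>k\<in>{..i+j}-{i}. coeff u k * coeff v (i + j - k))"
  proof (rule dvd_sum)
    fix k assume k: "k \<in> {..i+j}-{i}"
    show "p dvd coeff u k * coeff v (i + j - k)"
    proof (cases "k < i")
      case True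
      then show ?thesis using i(3) by simp
    next
      case False
      then have "i + j - k < j" using k by auto
      then show ?thesis using j(3) by simp
    qed
  qed
  moreover have "\<not> p dvd coeff u i * coeff v j" using i(1) j(1) p by (simp add: prime_dvd_mult_iff)
  ultimately have "\<not> p dvd coeff W (i + j)" unfolding e by (simp add: dvd_add_left_iff)
  then have "i + j \<ge> degree W" using low not_less by blast
  then have "i = degree u" "j = degree v" using i(2) j(2) degree_mult_eq[OF uv0] W by auto
  then have "p dvd coeff u 0" "p dvd coeff v 0" using i(3) j(3) du dv by auto
  then have "p * p dvd coeff u 0 * coeff v 0" by (rule mult_dvd_mono)
  then show False using const unfolding W coeff_mult_0 power2_eq_square by simp
qed

text \<open>This is A(-h/k) with denominators cleared by k^(deg A). It translates vanishing of
  \<open>A\<close> at a critical value into vanishing at the corresponding zero of the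
  Wronskian.\<close>

definition homogenize :: "int poly \<Rightarrow> int poly \<Rightarrow> int poly \<Rightarrow> int poly" where
  "homogenize A h k = (\<Sum>i\<le>degree A. smult (coeff A i) ((- h) ^ i * k ^ (degree A - i)))"

lemma poly_homogenize:
  fixes w z :: complex
  assumes "poly (map_poly of_int h) w + z * poly (map_poly of_int k) w = 0"
  shows "poly (map_poly of_int (homogenize A h k)) w = poly (map_poly of_int k) w ^ degree A * poly (map_poly of_int A) z"
proof -
  let ?h = "poly (map_poly of_int h) w" and ?k = "poly (map_poly of_int k) w"
  have h: "- ?h = z * ?k" using assms by (simp add: add_eq_0_iff)
  have "poly (map_poly of_int (homogenize A h k)) w = (\<Sum>i\<le>degree A. of_int (coeff A i) * ((- ?h) ^ i * ?k ^ (degree A - i)))"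
    by (simp add: homogenize_def of_int_poly_hom.hom_sum of_int_poly_hom.hom_mult of_int_poly_hom.hom_power
        of_int_poly_hom.hom_uminus of_int_hom.map_poly_hom_smult poly_sum)
  also have "\<dots> = (\<Sum>i\<le>degree A. ?k ^ degree A * (of_int (coeff A i) * z ^ i))"
  proof (intro sum.cong refl)
    fix i assume "i \<in> {..degree A}"
    then have "?k ^ degree A = ?k ^ i * ?k ^ (degree A - i)" by (simp add: power_add[symmetric])
    then show "of_int (coeff A i) * ((- ?h) ^ i * ?k ^ (degree A - i)) = ?k ^ degree A * (of_int (coeff A i) * z ^ i)"
      unfolding h by (simp add: power_mult_distrib mult_ac)
  qed
  also have "\<dots> = ?k ^ degree A * poly (map_poly of_int A) z"
    by (simp add: poly_altdef degree_map_poly coeff_map_poly sum_distrib_left)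
  finally show ?thesis .
qed

lemma int_poly_has_root:
  fixes A :: "int poly"
  assumes "degree A > 0"
  shows "\<exists>z::complex. poly (map_poly of_int A) z = 0"
proof -
  have "\<not> constant (poly (map_poly of_int A :: complex poly))" using assms by (simp add: constant_degree)
  then show ?thesis by (rule fundamental_theorem_of_algebra)
qed

text \<open>The zeros of \<open>D\<close> are the critical values \<open>-h(w)/k(w)\<close> with \<open>w\<close> a zero of the Wronskian. The Wronskian
  being irreducible, they are all conjugate, so \<open>D\<close> is a power of an irreducible polynomial up to sign;
  as \<open>r\<close> divides \<open>D(0)\<close> exactly once, the exponent is one.\<close>
lemma irreducible_discr_family:
  fixes h k D :: "int poly"
  defines "W \<equiv> h * pderiv k - pderiv h * k"
  assumes h: "lead_coeff h = 1" "degree h = n" and k: "degree k < n" "k \<noteq> 0"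
    and irr: "\<And>u v. W = u * v \<Longrightarrow> degree u = 0 \<or> degree v = 0" and Wdeg: "degree W > degree k"
    and D: "\<And>z::complex. poly (map_poly of_int D) z = discr (map_poly of_int h + smult z (map_poly of_int k))"
    and nofix: "\<And>q. prime q \<Longrightarrow> \<exists>s::int. \<not> int q dvd poly D s"
    and r: "prime r" "int r dvd poly D 0" "\<not> (int r)\<^sup>2 dvd poly D 0"
  shows "irreducible D"
proof -
  let ?e = "\<lambda>A z. poly (map_poly of_int (A :: int poly)) (z :: complex)"
  have W0: "W \<noteq> 0" using Wdeg by auto
  have crit: "\<exists>w. ?e W w = 0 \<and> ?e k w \<noteq> 0 \<and> ?e h w + z * ?e k w = 0" if z: "?e D z = 0" for z
  proof -
    let ?G = "map_poly of_int h + smult z (map_poly of_int k) :: complex poly"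
    have "degree (smult z (map_poly of_int k)) < degree (map_poly of_int h :: complex poly)"
      using k(1) h(2) degree_smult_le[of z "map_poly of_int k"] by simp
    moreover have "coeff k n = 0" using k(1) by (simp add: coeff_eq_0)
    ultimately have "lead_coeff ?G = 1" using h by (simp add: degree_add_eq_left)
    then obtain w where w: "poly ?G w = 0" "poly (pderiv ?G) w = 0"
      using complex_discr_eq_0_iff[of ?G] z D by auto
    have 1: "?e h w + z * ?e k w = 0" using w(1) by simp
    have pd: "pderiv (map_poly of_int A) = (map_poly of_int (pderiv A) :: complex poly)" for A :: "int poly"
      by (intro poly_eqI) (simp add: coeff_pderiv coeff_map_poly)
    have 2: "?e (pderiv h) w + z * ?e (pderiv k) w = 0" using w(2) by (simp add: pderiv_add pderiv_smult pd)
    have "?e W w = ?e h w * ?e (pderiv k) w - ?e (pderiv h) w * ?e k w"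
      by (simp add: W_def of_int_poly_hom.hom_minus of_int_poly_hom.hom_mult)
    also have "?e h w = - (z * ?e k w)" using 1 by (simp add: eq_neg_iff_add_eq_0)
    also have "?e (pderiv h) w = - (z * ?e (pderiv k) w)" using 2 by (simp add: eq_neg_iff_add_eq_0)
    finally have 3: "?e W w = 0" by simp
    \<comment> \<open>Otherwise \<open>W\<close>, which is minimal for \<open>w\<close> up to
      constants, would divide a constant multiple of \<open>k\<close>, whose degree is
      smaller.\<close>
    have "?e k w \<noteq> 0"
    proof
      assume "?e k w = 0"
      then obtain c where c: "c \<noteq> 0" "W dvd smult c k" using dvd_smult_if_common_root[OF irr W0 3] by blast
      then have "degree W \<le> degree (smult c k)" using k(2) by (intro dvd_imp_degree_le) auto
      then show False using Wdeg c(1) by simp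
    qed
    then show ?thesis using 1 3 by blast
  qed
  \<comment> \<open>Pulled back by \<open>homogenize\<close>, the polynomial \<open>A\<close>
    vanishes at one zero of \<open>W\<close>, hence at all of them, hence at every critical value.
    No polynomial can thus distinguish the zeros of \<open>D\<close>.\<close>
  have conj: "?e A z' = 0" if Az: "?e A z = 0" and z: "?e D z = 0" and z': "?e D z' = 0" for A z z'
  proof -
    obtain w where w: "?e W w = 0" "?e h w + z * ?e k w = 0" using crit[OF z] by blast
    obtain w' where w': "?e W w' = 0" "?e k w' \<noteq> 0" "?e h w' + z' * ?e k w' = 0" using crit[OF z'] by blast
    have "?e (homogenize A h k) w = 0" using poly_homogenize[OF w(2), of A] Az by simp
    then obtain c where "c \<noteq> 0" "W dvd smult c (homogenize A h k)"
      using dvd_smult_if_common_root[OF irr W0 w(1)] by blast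
    then have "?e (homogenize A h k) w' = 0" using poly_of_int_smult_dvd_root w'(1) by blast
    then show ?thesis using poly_homogenize[OF w'(3), of A] w'(2) by simp
  qed
  have D0: "D \<noteq> 0" using r(3) by auto
  have rp: "prime_elem (int r)" using r(1) by simp
  \<comment> \<open>A nonunit constant factor would make some prime divide all values of
    \<open>D\<close>.\<close>
  have degm: "degree m > 0" if m: "m dvd D" "\<not> is_unit m" for m
  proof (rule ccontr)
    assume "\<not> degree m > 0"
    then obtain a where a: "m = [:a:]" by (metis degree_eq_zeroE gr0I)
    then have "\<bar>a\<bar> \<noteq> 1" using m(2) by (auto simp: is_unit_const_poly_iff)
    then obtain q' where q': "prime q'" "q' dvd a" by (rule prime_factor_int)
    have "prime (nat q')" "int (nat q') dvd a" using q' prime_ge_0_int[OF q'(1)] by auto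
    moreover obtain E where "D = m * E" using m(1) by blast
    then have "a dvd poly D s" for s by (simp add: a)
    ultimately show False using nofix by (meson dvd_trans)
  qed
  have "\<exists>m. prime_elem m \<and> m dvd D \<and> int r dvd poly m 0"
  proof -
    have "D dvd prod_mset (prime_factorization D)"
      by (rule associatedD2[OF prod_mset_prime_factorization_weak[OF D0]])
    then obtain t where t: "prod_mset (prime_factorization D) = D * t" by blast
    have dvd: "int r dvd poly (prod_mset (prime_factorization D)) 0" unfolding t poly_mult using r(2) by (rule dvd_mult2)
    have ev: "poly (prod_mset M) 0 = prod_mset (image_mset (\<lambda>m. poly m 0) M)" for M :: "int poly multiset"
      by (induction M) auto
    from dvd[unfolded ev] obtain c where "c \<in># image_mset (\<lambda>m. poly m 0) (prime_factorization D)" "int r dvd c"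
      by (rule prime_elem_dvd_prod_msetE[OF rp])
    then obtain m where "m \<in># prime_factorization D" "int r dvd poly m 0" by auto
    moreover from this(1) have "prime_elem m" "m dvd D"
      using in_prime_factors_imp_prime[of m D] in_prime_factors_imp_dvd[of m D] by blast+
    ultimately show ?thesis by blast
  qed
  then obtain m where m: "prime_elem m" "m dvd D" "int r dvd poly m 0" by blast
  then obtain E where E: "D = m * E" by blast
  have m_unit: "\<not> is_unit m" using m(1) by (simp add: prime_elem_def)
  have "is_unit E"
  \<comment> \<open>A prime factor \<open>m'\<close> of the cofactor has its zeros among those of
    \<open>D\<close>, where \<open>m\<close> vanishes too, so \<open>m\<close> divides
    \<open>m'\<close> and its square divides \<open>D\<close>. Evaluating at 0 gives the square of
    \<open>r\<close>, a contradiction.\<close>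
  proof (rule ccontr)
    assume nu: "\<not> is_unit E"
    have "E \<noteq> 0" using D0 E by auto
    then obtain m' where m': "prime m'" "m' dvd E" using prime_divisor_exists[OF _ nu] by blast
    have "m' dvd D" using m'(2) E by simp
    moreover have "\<not> is_unit m'" using m'(1) by auto
    ultimately have "degree m' > 0" by (rule degm)
    then obtain z' where z': "?e m' z' = 0" using int_poly_has_root by blast
    obtain z where z: "?e m z = 0" using int_poly_has_root[OF degm[OF m(2) m_unit]] by blast
    have Dz: "?e D z = 0" using z by (simp add: E of_int_poly_hom.hom_mult)
    have Dz': "?e D z' = 0" using z' \<open>m' dvd D\<close> by (auto simp: of_int_poly_hom.hom_mult elim!: dvdE)
    have mz': "?e m z' = 0" by (rule conj[OF z Dz Dz'])
    have "irreducible m" using m(1) by (rule prime_elem_imp_irreducible)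
    then have irrm: "\<And>u v. m = u * v \<Longrightarrow> degree u = 0 \<or> degree v = 0"
      by (metis irreducibleD is_unit_polyE degree_pCons_0)
    have "m \<noteq> 0" using m(1) by auto
    then obtain c where c: "c \<noteq> 0" "m dvd smult c m'" using dvd_smult_if_common_root[OF irrm _ mz' z'] by blast
    then have "m dvd [:c:] * m'" by simp
    moreover have "\<not> m dvd [:c:]"
    proof
      assume "m dvd [:c:]"
      then have "degree m \<le> degree [:c:]" using c(1) by (intro dvd_imp_degree_le) auto
      then show False using degm[OF m(2) m_unit] by simp
    qed
    ultimately have "m dvd m'" using m(1) by (simp only: prime_elem_dvd_mult_iff) blast
    then have "m * m dvd D" unfolding E using m'(2) by (intro mult_dvd_mono) (auto intro: dvd_trans)
    then obtain t where "D = m * m * t" by blast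
    then have "poly D 0 = poly m 0 * poly m 0 * poly t 0" by simp
    then have "int r * int r dvd poly D 0" using m(3) by (simp add: mult_dvd_mono)
    then show False using r(3) by (simp add: power2_eq_square)
  qed
  then have "irreducible D \<longleftrightarrow> irreducible m" unfolding E by (simp add: irreducible_mult_unit_right)
  then show ?thesis using m(1) prime_elem_imp_irreducible by blast
qed

section \<open>Totally real members of a linear family\<close>

text \<open>Beyond the sum of the ratios |h|/|k| at the nodes, s k dominates h at each node. The
  signs of h + s k then alternate like those of \<open>k\<close>, whatever the sign of s, and the
  intermediate value theorem applies in each gap.\<close>

lemma pencil_real_roots:
  fixes h k :: "real poly" and x :: "nat \<Rightarrow> real"
  assumes alt: "\<And>j. Suc j < n \<Longrightarrow> x j < x (Suc j) \<and> poly k (x j) * poly k (x (Suc j)) < 0"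
    and nz: "\<And>j. j < n \<Longrightarrow> poly k (x j) \<noteq> 0"
  shows "\<exists>B. \<forall>s. \<bar>s\<bar> > B \<longrightarrow> (\<forall>j. Suc j < n \<longrightarrow> (\<exists>y. x j < y \<and> y < x (Suc j) \<and> poly (h + smult s k) y = 0))"
proof -
  define B where "B = (\<Sum>j<n. \<bar>poly h (x j)\<bar> / \<bar>poly k (x j)\<bar>)"
  have "\<exists>y. x j < y \<and> y < x (Suc j) \<and> poly (h + smult s k) y = 0" if s: "\<bar>s\<bar> > B" and j: "Suc j < n" for s j
  proof -
    have sgn: "poly (h + smult s k) (x i) * (s * poly k (x i)) > 0" if i: "i < n" for i
    proof -
      have "\<bar>poly h (x i)\<bar> / \<bar>poly k (x i)\<bar> \<le> B" unfolding B_def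
        by (rule member_le_sum) (use i in auto)
      then have "\<bar>poly h (x i)\<bar> < \<bar>s\<bar> * \<bar>poly k (x i)\<bar>" using s nz[OF i] by (simp add: pos_divide_less_eq[symmetric])
      then have "\<bar>poly h (x i)\<bar> < \<bar>s * poly k (x i)\<bar>" by (simp add: abs_mult)
      then have "(poly h (x i) + s * poly k (x i)) * (s * poly k (x i)) > 0"
        by (cases "s * poly k (x i) > 0") (auto simp: zero_less_mult_iff)
      then show ?thesis by simp
    qed
    let ?f = "\<lambda>i. poly (h + smult s k) (x i)"
    have "(?f j * (s * poly k (x j))) * (?f (Suc j) * (s * poly k (x (Suc j)))) > 0"
      by (intro mult_pos_pos sgn) (use j in auto)
    moreover have "\<dots> = (?f j * ?f (Suc j)) * (s\<^sup>2 * (poly k (x j) * poly k (x (Suc j))))"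
      by (simp add: power2_eq_square mult_ac)
    moreover have "s\<^sup>2 * (poly k (x j) * poly k (x (Suc j))) \<le> 0"
      by (rule mult_nonneg_nonpos) (use alt[OF j] in auto)
    ultimately have "?f j * ?f (Suc j) < 0"
      by (metis mult_nonneg_nonpos not_less)
    then show ?thesis using poly_IVT[of "x j" "x (Suc j)" "h + smult s k"] alt[OF j] by blast
  qed
  then show ?thesis by blast
qed

text \<open>A nonreal root brings its conjugate along; together with n - 1 real zeros this makes n +
  1 zeros.\<close>

lemma (in monic_split) roots_real:
  assumes inj: "inj_on \<alpha> {1..n}" and n: "n \<ge> 1"
    and y: "inj_on y {..<n-1}" "\<And>j. j < n - 1 \<Longrightarrow> poly (map_poly of_int F) (y j :: real) = 0"
    and i: "i \<in> {1..n}"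
  shows "\<alpha> i \<in> \<real>"
proof (rule ccontr)
  assume nr: "\<alpha> i \<notin> \<real>"
  have root_iff: "z \<in> \<alpha> ` {1..n} \<longleftrightarrow> poly (map_poly of_int F) z = 0" for z
    unfolding poly_F by auto
  have "poly (map_poly of_int F) (cnj (\<alpha> i)) = cnj (poly (map_poly of_int F) (\<alpha> i))"
    by (simp add: poly_altdef degree_map_poly coeff_map_poly)
  also have "\<dots> = 0" using root_iff[of "\<alpha> i"] i by simp
  finally have c: "cnj (\<alpha> i) \<in> \<alpha> ` {1..n}" unfolding root_iff .
  have ne: "cnj (\<alpha> i) \<noteq> \<alpha> i" using nr Reals_cnj_iff by blast
  have "of_real (y j) \<in> \<alpha> ` {1..n}" if "j < n - 1" for j
  proof -
    have "poly (map_poly of_int F) (of_real (y j)) = (of_real (poly (map_poly of_int F) (y j)) :: complex)"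
      by (simp add: poly_altdef degree_map_poly coeff_map_poly)
    then show ?thesis unfolding root_iff using y(2)[OF that] by simp
  qed
  then have sub: "insert (\<alpha> i) (insert (cnj (\<alpha> i)) ((\<lambda>j. complex_of_real (y j)) ` {..<n-1})) \<subseteq> \<alpha> ` {1..n}"
    using c i by auto
  have nR: "\<alpha> i \<notin> (\<lambda>j. complex_of_real (y j)) ` {..<n-1}" using nr by auto
  have nR': "cnj (\<alpha> i) \<notin> (\<lambda>j. complex_of_real (y j)) ` {..<n-1}"
  proof
    assume "cnj (\<alpha> i) \<in> (\<lambda>j. complex_of_real (y j)) ` {..<n-1}"
    then obtain j where j: "cnj (\<alpha> i) = complex_of_real (y j)" by blast
    have "cnj (cnj (\<alpha> i)) \<in> \<real>" unfolding j by (simp only: complex_cnj_complex_of_real Reals_of_real)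
    then show False using nr by simp
  qed
  have "card ((\<lambda>j. complex_of_real (y j)) ` {..<n-1}) = n - 1"
    using y(1) by (subst card_image) (auto simp: inj_on_def)
  then have "card (insert (\<alpha> i) (insert (cnj (\<alpha> i)) ((\<lambda>j. complex_of_real (y j)) ` {..<n-1}))) = n + 1"
    using nR nR' ne n by simp
  moreover have "card (insert (\<alpha> i) (insert (cnj (\<alpha> i)) ((\<lambda>j. complex_of_real (y j)) ` {..<n-1}))) \<le> card (\<alpha> ` {1..n})"
    using sub by (intro card_mono) auto
  moreover have "card (\<alpha> ` {1..n}) = n" using card_image[OF inj] by simp
  ultimately show False by simp
qed

text \<open>Exactly one zero, j + 1, lies between the two half-integers, so exactly one factor
  changes sign.\<close>

lemma linear_product_alternates:
  fixes j n :: nat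
  defines "K \<equiv> \<lambda>x::real. \<Prod>i=1..n-1. x - real i"
  assumes "Suc j < n"
  shows "K (real j + 1/2) * K (real (Suc j) + 1/2) < 0"
proof -
  let ?f = "\<lambda>i. (real j + 1/2 - real i) * (real (Suc j) + 1/2 - real i)"
  have "K (real j + 1/2) * K (real (Suc j) + 1/2) = (\<Prod>i=1..n-1. ?f i)"
    unfolding K_def by (rule prod.distrib[symmetric])
  also have "\<dots> = ?f (Suc j) * (\<Prod>i\<in>{1..n-1} - {Suc j}. ?f i)"
    using assms(2) by (intro prod.remove) auto
  also have "\<dots> < 0"
  proof (rule mult_neg_pos)
    show "?f (Suc j) < 0" by simp
    show "(\<Prod>i\<in>{1..n-1} - {Suc j}. ?f i) > 0"
    proof (rule prod_pos)
      fix i assume i: "i \<in> {1..n-1} - {Suc j}"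
      show "?f i > 0"
      proof (cases "i \<le> j")
        case True
        then have "real i \<le> real j" by simp
        then show ?thesis by (intro mult_pos_pos) auto
      next
        case False
        then have "i \<ge> Suc (Suc j)" using i by auto
        then have "real i \<ge> real j + 2" by linarith
        then show ?thesis by (intro mult_neg_neg) auto
      qed
    qed
  qed
  finally show ?thesis .
qed

text \<open>For \<open>q\<close> dividing \<open>n\<close> the derivative is -X^(n-2) modulo
  \<open>q\<close>, and the constant term 1 excludes the zero 0. This is the reduction of the member
  at s = 1 modulo the Eisenstein prime.\<close>

lemma separable_trinomial:
  assumes P: "prime_ideal_in all_integers P" and q: "prime q" "of_nat q \<in> P"
    and n: "q dvd n" "n \<ge> 2"
    and x: "algebraic_int x" "poly (map_poly of_int (monom 1 n + monom 1 (n - 1) + 1)) x \<in> P"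
  shows "poly (map_poly of_int (pderiv (monom 1 n + monom 1 (n - 1) + 1))) x \<notin> P"
proof
  interpret prime_ideal_in all_integers P by fact
  assume "poly (map_poly of_int (pderiv (monom 1 n + monom 1 (n - 1) + 1))) x \<in> P"
  then have d: "of_nat n * x ^ (n - 1) + of_nat (n - 1) * x ^ (n - 2) \<in> P"
    by (simp add: pderiv_add pderiv_monom of_int_poly_hom.hom_add of_int_hom.map_poly_hom_monom poly_monom numeral_2_eq_2 diff_diff_left)
  have nP: "of_nat n \<in> P" using P_of_int_dvd[OF q(2), of "int n"] n(1) by simp
  have xk: "x ^ k \<in> all_integers" for k using x(1) by (auto intro: algebraic_int_power)
  have v: "x ^ n + x ^ (n - 1) + 1 \<in> P"
    using x(2) by (simp add: of_int_poly_hom.hom_add of_int_hom.map_poly_hom_monom poly_monom)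
  have e1: "x ^ (n - 1) = x * x ^ (n - 2)" using n(2) by (simp flip: power_Suc add: Suc_diff_Suc numeral_2_eq_2)
  have e2: "x ^ n = x * x ^ (n - 1)" using n(2) by (cases n) auto
  have "of_nat n * (x ^ (n - 1) + x ^ (n - 2)) \<in> P" using xk by (intro P_mult2 nP) (auto intro: algebraic_int_add)
  from P_diff[OF this d] have "x ^ (n - 2) \<in> P" using n(2) by (simp add: of_nat_diff algebra_simps)
  then have "x ^ (n - 1) \<in> P" "x ^ n \<in> P" unfolding e2 e1 using x(1) by (auto intro!: P_mult)
  then have "(x ^ n + x ^ (n - 1) + 1) - (x ^ n + x ^ (n - 1)) \<in> P" using v by (intro P_diff[OF v] P_add)
  then show False using P_one by simp
qed

section \<open>Construction of the family\<close>

lemma wronskian_cong: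
  fixes h k H K :: "int poly"
  assumes "\<And>i. m dvd coeff h i - coeff H i" "\<And>i. m dvd coeff k i - coeff K i"
  shows "m dvd coeff (h * pderiv k - pderiv h * k) i - coeff (H * pderiv K - pderiv H * K) i"
proof -
  have ex: "\<exists>u. f = g + smult m u" if "\<And>i. m dvd coeff f i - coeff g i" for f g :: "int poly"
  proof (rule exI)
    show "f = g + smult m (map_poly (\<lambda>c. c div m) (f - g))"
      using that by (intro poly_eqI) (simp add: coeff_map_poly)
  qed
  obtain u v where "h = H + smult m u" "k = K + smult m v" using ex assms by meson
  then have "h * pderiv k - pderiv h * k = (H * pderiv K - pderiv H * K)
     + smult m (H * pderiv v + u * pderiv K + smult m (u * pderiv v) - pderiv H * v - pderiv u * K - smult m (pderiv u * v))"
    by (simp add: pderiv_add pderiv_smult algebra_simps smult_add_right smult_diff_right)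
  then show ?thesis by simp
qed

text \<open>The templates have Wronskian -X^(2n-2) + (p (n - 1) - n - p) X^(n-1) - p. The leading
  coefficient is (n - 1) - n, the middle one is divisible by \<open>p\<close> because
  \<open>p\<close> divides \<open>n\<close>, and the congruence modulo the square of
  \<open>p\<close> protects the constant term -p.\<close>

lemma wronskian_eisenstein:
  fixes h k :: "int poly"
  defines "W \<equiv> h * pderiv k - pderiv h * k"
  assumes n: "n \<ge> 2" and p: "prime p" "p dvd n"
    and h: "degree h = n" "\<And>i. (int p)\<^sup>2 dvd coeff h i - coeff (monom 1 n + monom (int p) 1) i"
    and k: "degree k < n" "\<And>i. (int p)\<^sup>2 dvd coeff k i - coeff (monom 1 (n - 1) + 1) i"
  shows "degree W = 2 * n - 2" "\<And>u v. W = u * v \<Longrightarrow> degree u = 0 \<or> degree v = 0"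
proof -
  let ?p = "int p"
  let ?H = "monom 1 n + monom ?p 1 :: int poly" and ?K = "monom 1 (n - 1) + 1 :: int poly"
  obtain l where l: "n = Suc (Suc l)" using n by (metis One_nat_def Suc_le_D numeral_2_eq_2 Suc_le_mono)
  have W0: "?H * pderiv ?K - pderiv ?H * ?K
     = monom (- 1) (2 * n - 2) + monom (?p * int (n - 1) - int n - ?p) (n - 1) - monom ?p 0"
    unfolding l by (simp add: pderiv_add pderiv_monom mult_monom algebra_simps add_monom diff_monom minus_monom one_poly_eq_simps(1)[symmetric] monom_0[symmetric] numeral_2_eq_2
      del: one_poly_eq_simps monom_0) (rule poly_eqI, auto simp: coeff_monom algebra_simps)
  have cW: "?p\<^sup>2 dvd coeff W i - coeff (monom (- 1) (2 * n - 2) + monom (?p * int (n - 1) - int n - ?p) (n - 1) - monom ?p 0) i" for i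
    using wronskian_cong[OF h(2) k(2), of i] unfolding W_def W0 .
  have pp: "?p dvd ?p\<^sup>2" by (simp add: power2_eq_square)
  have p1: "\<not> ?p dvd 1" using p(1) by (auto simp: prime_nat_iff)
  have degW: "degree W \<le> 2 * n - 2"
  proof -
    have "degree (h * pderiv k) \<le> n + (n - 2)"
      using h(1) k(1) by (intro order.trans[OF degree_mult_le]) (simp add: degree_pderiv)
    moreover have "degree (pderiv h * k) \<le> (n - 1) + (n - 1)"
      using h(1) k(1) by (intro order.trans[OF degree_mult_le]) (simp add: degree_pderiv)
    ultimately show ?thesis unfolding W_def using n by (intro degree_diff_le) auto
  qed
  have lead: "\<not> ?p dvd coeff W (2 * n - 2)"
  proof
    assume a: "?p dvd coeff W (2 * n - 2)"
    have "?p\<^sup>2 dvd coeff W (2 * n - 2) + 1" using cW[of "2 * n - 2"] n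
      by (simp add: coeff_monom split: if_splits)
    then have "?p dvd coeff W (2 * n - 2) + 1" using pp by (rule dvd_trans[rotated])
    then have "?p dvd 1" using a by (simp add: dvd_add_right_iff)
    then show False using p1 by simp
  qed
  then have "coeff W (2 * n - 2) \<noteq> 0" by auto
  then show deg: "degree W = 2 * n - 2" using degW by (simp add: le_antisym le_degree)
  have low: "?p dvd coeff W i" if i: "i < degree W" for i
  proof -
    have "?p dvd coeff (monom (- 1) (2 * n - 2) + monom (?p * int (n - 1) - int n - ?p) (n - 1) - monom ?p 0) i"
    proof -
      have "?p dvd int n" using p(2) by simp
      then have "?p dvd ?p * int (n - 1) - int n - ?p" by (intro dvd_diff) auto
      then show ?thesis using i deg by (simp add: coeff_monom)
    qed
    moreover have "?p dvd coeff W i - coeff (monom (- 1) (2 * n - 2) + monom (?p * int (n - 1) - int n - ?p) (n - 1) - monom ?p 0) i"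
      using pp cW by (rule dvd_trans)
    ultimately have "?p dvd coeff (monom (- 1) (2 * n - 2) + monom (?p * int (n - 1) - int n - ?p) (n - 1) - monom ?p 0) i
      + (coeff W i - coeff (monom (- 1) (2 * n - 2) + monom (?p * int (n - 1) - int n - ?p) (n - 1) - monom ?p 0) i)"
      by (rule dvd_add)
    then show ?thesis by (simp only: add_diff_cancel_left' add_diff_eq)
  qed
  have const: "\<not> ?p\<^sup>2 dvd coeff W 0"
  proof
    assume a: "?p\<^sup>2 dvd coeff W 0"
    have "?p\<^sup>2 dvd coeff W 0 + ?p" using cW[of 0] n by (simp add: coeff_monom)
    then have "?p\<^sup>2 dvd ?p" using a by (simp add: dvd_add_right_iff)
    then have "?p * ?p dvd ?p * 1" by (simp add: power2_eq_square)
    then have "?p dvd 1" using p(1) by (subst (asm) dvd_mult_cancel_left) (auto simp: prime_nat_iff)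
    then show False using p1 by simp
  qed
  show "degree u = 0 \<or> degree v = 0" if "W = u * v" for u v
    by (rule eisenstein[of ?p W]) (use p low lead const that deg in auto)
qed

text \<open>Here \<open>f\<close> carries the residues prescribed for k. Adding a multiple of
  \<open>M\<close> times the product with zeros 1, ..., n - 1 preserves residues modulo
  \<open>M\<close>, and a large multiple imposes the alternating signs of that product at the
  half-integers.\<close>

lemma real_root_multiplier:
  fixes n :: nat and f :: "int poly" and M :: int
  assumes M: "M > 0"
  shows "\<exists>N::int. \<forall>j. Suc j < n \<longrightarrow>
     poly (map_poly of_int (f + smult (N * M) (\<Prod>i=1..int n - 1. [:- i, 1:]))) (real j + 1/2)
     * poly (map_poly of_int (f + smult (N * M) (\<Prod>i=1..int n - 1. [:- i, 1:]))) (real (Suc j) + 1/2) < 0"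
proof -
  let ?K = "\<lambda>x::real. \<Prod>i=1..n-1. x - real i"
  have evK: "poly (map_poly of_int (\<Prod>i=1..int n - 1. [:- i, 1:])) x = ?K x" for x
    unfolding of_int_poly_hom.hom_prod poly_prod
    by (rule prod.reindex_bij_witness[of _ int nat]) (auto simp: of_int_hom.map_poly_pCons_hom)
  have Knz: "?K (real j + 1/2) \<noteq> 0" for j
  proof -
    have "real j + 1/2 - real i \<noteq> 0" for i
    proof
      assume "real j + 1/2 - real i = 0"
      then have "real (2 * j + 1) = real (2 * i)" by simp
      then have "2 * j + 1 = 2 * i" by (simp only: of_nat_eq_iff)
      then show False by presburger
    qed
    then show ?thesis by simp
  qed
  obtain N :: nat where N: "(\<Sum>j<n. \<bar>poly (map_poly of_int f) (real j + 1/2)\<bar> / \<bar>?K (real j + 1/2)\<bar>) < real N"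
    using reals_Archimedean2 by blast
  let ?k = "\<lambda>x. poly (map_poly of_int (f + smult (int N * M) (\<Prod>i=1..int n - 1. [:- i, 1:]))) x :: real"
  have ev: "?k x = poly (map_poly of_int f) x + real N * of_int M * ?K x" for x
    by (simp add: of_int_poly_hom.hom_add of_int_hom.map_poly_hom_smult evK)
  have pos: "?k (real j + 1/2) * ?K (real j + 1/2) > 0" if j: "j < n" for j
  proof -
    let ?x = "real j + 1/2"
    have "\<bar>poly (map_poly of_int f) ?x\<bar> / \<bar>?K ?x\<bar> \<le> (\<Sum>j<n. \<bar>poly (map_poly of_int f) (real j + 1/2)\<bar> / \<bar>?K (real j + 1/2)\<bar>)"
      using j by (intro member_le_sum[of j]) auto
    also have "\<dots> < real N" by (rule N)
    also have "\<dots> \<le> real N * of_int M" using M by (simp add: mult_le_cancel_left1)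
    finally have "\<bar>poly (map_poly of_int f) ?x\<bar> < real N * of_int M * \<bar>?K ?x\<bar>" using Knz[of j] by (simp add: pos_divide_less_eq)
    then have A: "\<bar>a\<bar> < t * \<bar>K\<bar>" if "a = poly (map_poly of_int f) ?x" "t = real N * of_int M" "K = ?K ?x" for a t K
      using that by simp
    have "(a + t * K) * K > 0" if "\<bar>a\<bar> < t * \<bar>K\<bar>" "K \<noteq> 0" for a t K :: real
    proof (cases "K > 0")
      case True
      then have "a + t * K > 0" using that(1) by simp
      then show ?thesis using True by (rule mult_pos_pos)
    next
      case False
      then have "K < 0" using that(2) by simp
      then have "a + t * K < 0" using that(1) by simp
      then show ?thesis using \<open>K < 0\<close> by (rule mult_neg_neg)
    qed
    from this[OF A[OF refl refl refl] Knz[of j]] show ?thesis unfolding ev .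
  qed
  have "?k (real j + 1/2) * ?k (real (Suc j) + 1/2) < 0" if j: "Suc j < n" for j
  proof -
    have "(?k (real j + 1/2) * ?K (real j + 1/2)) * (?k (real (Suc j) + 1/2) * ?K (real (Suc j) + 1/2)) > 0"
      by (rule mult_pos_pos[OF pos pos]) (use j in auto)
    then have "(?k (real j + 1/2) * ?k (real (Suc j) + 1/2)) * (?K (real j + 1/2) * ?K (real (Suc j) + 1/2)) > 0"
      by (simp only: mult_ac)
    moreover have "?K (real j + 1/2) * ?K (real (Suc j) + 1/2) < 0" by (rule linear_product_alternates[OF j])
    ultimately have "?k (real j + 1/2) * ?k (real (Suc j) + 1/2) < 0"
      by (metis mult_nonneg_nonpos not_less less_imp_le)
    then show ?thesis .
  qed
  then show "\<exists>N::int. \<forall>j. Suc j < n \<longrightarrow>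
     poly (map_poly of_int (f + smult (N * M) (\<Prod>i=1..int n - 1. [:- i, 1:]))) (real j + 1/2)
     * poly (map_poly of_int (f + smult (N * M) (\<Prod>i=1..int n - 1. [:- i, 1:]))) (real (Suc j) + 1/2) < 0"
    by (intro exI[of _ "int N"]) blast
qed

text \<open>A separable polynomial modulo \<open>q\<close>, whether or not \<open>q\<close> divides \<open>n\<close>: a member of the family
  congruent to it shows that \<open>q\<close> is not a fixed divisor of the discriminant.\<close>
definition separable_template :: "nat \<Rightarrow> nat \<Rightarrow> int poly" where
  "separable_template n q = monom 1 n - (if q dvd n then monom 1 1 else [:1:])"

lemma separable_template_separable:
  assumes P: "prime_ideal_in all_integers P" and q: "prime q" "of_nat q \<in> P" and n: "n \<ge> 2"
    and x: "algebraic_int x" "poly (map_poly of_int (separable_template n q)) x \<in> P"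
  shows "poly (map_poly of_int (pderiv (separable_template n q))) x \<notin> P"
proof -
  have q1: "\<not> int q dvd 1" using q(1) by (auto simp: prime_nat_iff)
  show ?thesis
  proof (cases "q dvd n")
    case True
    have "\<not> q dvd n - 1"
    proof
      assume "q dvd n - 1"
      with True have "q dvd n - (n - 1)" by (rule dvd_diff_nat)
      moreover have "n - (n - 1) = 1" using n by simp
      ultimately have "q dvd 1" by simp
      then show False using q(1) not_prime_unit by blast
    qed
    then show ?thesis using separable_binomial_X[OF P q, of n 1 x] q1 n x True by (simp add: separable_template_def)
  next
    case False
    then show ?thesis using separable_binomial[OF P q, of n 1 x] q1 n x by (simp add: separable_template_def)
  qed
qed

lemma quadratic_times_linear_monic:
  assumes "n \<ge> 2"
  shows "degree (quadratic_times_linear n a) = n" "lead_coeff (quadratic_times_linear n a) = 1"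
proof -
  have d: "degree (\<Prod>c=1..int n - 2. [:- c, 1:]) = n - 2"
    by (subst degree_prod_eq_sum_degree) (use assms in auto)
  have l: "lead_coeff (\<Prod>c=1..int n - 2. [:- c, 1:]) = 1" by (subst lead_coeff_prod) auto
  have nz: "(\<Prod>c=1..int n - 2. [:- c, 1:]) \<noteq> 0" using l by auto
  show "degree (quadratic_times_linear n a) = n"
    unfolding quadratic_times_linear_def by (subst degree_mult_eq) (use nz d assms in auto)
  show "lead_coeff (quadratic_times_linear n a) = 1"
    unfolding quadratic_times_linear_def lead_coeff_mult l by simp
qed

text \<open>Fixed divisors of \<open>D\<close> must divide D(0), the discriminant of
  \<open>h\<close>, so \<open>h\<close> is settled first. Then \<open>k\<close> is prescribed modulo
  these finitely many primes to make the member at s = 1 separable there, and is made divisible by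
  \<open>q1\<close>, \<open>q2\<close>, \<open>q3\<close> so that the Frobenius templates hold for
  every s.\<close>

lemma good_family_exists:
  assumes n: "n \<ge> 2"
  obtains h k :: "int poly" and D :: "int poly" and B :: real and q1 q2 q3 :: nat and a1 a2 a3 :: int
  where "degree h = n" "lead_coeff h = 1" "degree k < n" "irreducible D"
    "\<And>q. prime q \<Longrightarrow> \<exists>s::int. \<not> int q dvd poly D s"
    "\<And>s. poly D s = discr (h + smult s k)"
    "kummer_prime q1 n a1" "\<And>s i. int q1 dvd coeff (h + smult s k) i - coeff (monom 1 n - [:a1:]) i"
    "kummer_prime q2 (n - 1) a2" "\<And>s i. int q2 dvd coeff (h + smult s k) i - coeff (monom 1 n - monom a2 1) i"
    "kummer_prime q3 2 a3" "q3 > n" "q3 > 2"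
    "\<And>s i. int q3 dvd coeff (h + smult s k) i - coeff (quadratic_times_linear n a3) i"
    "\<And>s j. \<bar>real_of_int s\<bar> > B \<Longrightarrow> Suc j < n \<Longrightarrow>
       \<exists>y::real. real j + 1/2 < y \<and> y < real (Suc j) + 1/2 \<and> poly (map_poly of_int (h + smult s k)) y = 0"
proof -
  obtain p where p: "prime p" "p dvd n" using prime_factor_nat[of n] n by auto
  have pn: "p \<le> n" using p(2) n by (intro dvd_imp_le) auto
  \<comment> \<open>Each prime is chosen above the previous one, starting above \<open>n\<close> and
    thus above \<open>p\<close>, so that all five moduli are pairwise coprime.\<close>
  obtain q1 a1 where q1: "kummer_prime q1 n a1" "q1 > n" using kummer_prime_exists[of n n] n by auto
  obtain q2 a2 where q2: "kummer_prime q2 (n - 1) a2" "q2 > q1" using kummer_prime_exists[of "n - 1" q1] n by auto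
  obtain q3 a3 where q3: "kummer_prime q3 2 a3" "q3 > q2" using kummer_prime_exists[of 2 q2] by auto
  obtain r where r: "prime r" "r > q3" using bigger_prime by blast
  have P: "prime q1" "prime q2" "prime q3" using q1 q2 q3 by (auto simp: kummer_prime_def)
  have na: "\<not> int q1 dvd a1" "\<not> int q2 dvd a2" "\<not> int q3 dvd a3" using q1 q2 q3 by (auto simp: kummer_prime_def)
  \<comment> \<open>The modulus \<open>p\<^sup>2\<close> makes the Wronskian Eisenstein, \<open>r\<^sup>2\<close> makes \<open>r\<close> divide the discriminant of \<open>h\<close> exactly once.\<close>
  define b where "b = (\<lambda>i::nat. if i = 0 then p else if i = 1 then q1 else if i = 2 then q2 else if i = 3 then q3 else r)"
  define e where "e = (\<lambda>i::nat. if i = 0 \<or> i = 4 then 2 else 1::nat)"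
  define U where "U = (\<lambda>i::nat. if i = 0 then monom 1 n + monom (int p) 1 else if i = 1 then monom 1 n - [:a1:]
     else if i = 2 then monom 1 n - monom a2 1 else if i = 3 then quadratic_times_linear n a3 else quadratic_times_linear n (int r))"
  have Utop: "coeff (U i - monom 1 n) j = 0" if "j \<ge> n" for i j
  proof -
    have "coeff (quadratic_times_linear n a - monom 1 n) j = 0" for a
      using quadratic_times_linear_monic[OF n, of a] that by (cases "j = n") (auto simp: coeff_eq_0 coeff_monom)
    then show ?thesis using that n by (auto simp: U_def coeff_monom coeff_pCons split: nat.splits)
  qed
  have bprime: "prime (b i)" for i using p r P by (simp add: b_def)
  have binj: "b i \<noteq> b j" if "i \<in> {0..4}" "j \<in> {0..4}" "i \<noteq> j" for i j
    using that pn q1(2) q2(2) q3(2) r(2) by (auto simp: b_def)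
  \<comment> \<open>The templates are monic of degree \<open>n\<close>; splitting off X^n leaves
    remainders below degree \<open>n\<close> and keeps \<open>h\<close> exactly monic.\<close>
  have "\<exists>h0. (\<forall>j\<ge>n. coeff h0 j = 0) \<and> (\<forall>i\<in>{0..4}. \<forall>j. int (b i ^ e i) dvd coeff h0 j - coeff (U i - monom 1 n) j)"
  proof (rule chinese_remainder_poly)
    fix i j :: nat assume ij: "i \<in> {0..4}" "j \<in> {0..4}" "i \<noteq> j"
    have "coprime (b i ^ e i) (b j ^ e j)"
      by (intro coprime_power_left_iff[THEN iffD2] coprime_power_right_iff[THEN iffD2] disjI1 primes_coprime bprime binj ij)
    then show "coprime (int (b i ^ e i)) (int (b j ^ e j))" by (simp only: coprime_int_iff)
  qed (use Utop in auto)
  then obtain h0 where h0: "\<And>j. j \<ge> n \<Longrightarrow> coeff h0 j = 0"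
    "\<And>i j. i \<in> {0..4} \<Longrightarrow> int (b i ^ e i) dvd coeff h0 j - coeff (U i - monom 1 n) j" by blast
  define h where "h = monom 1 n + h0"
  have hU: "int (b i ^ e i) dvd coeff h j - coeff (U i) j" if "i \<in> {0..4}" for i j
    using h0(2)[OF that, of j] by (simp add: h_def algebra_simps)
  have degh0: "degree h0 < n" using h0(1) n by (metis degree_0 leading_coeff_0_iff not_less zero_less_numeral le_less_trans not_le)
  have degh: "degree h = n" unfolding h_def using degh0 by (simp add: degree_add_eq_left degree_monom_eq)
  have lch: "lead_coeff h = 1" unfolding degh using h0(1)[of n] by (simp add: h_def coeff_monom)
  have h_p: "(int p)\<^sup>2 dvd coeff h j - coeff (monom 1 n + monom (int p) 1) j" for j
    using hU[of 0 j] by (simp add: b_def e_def U_def)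
  have h_q1: "int q1 dvd coeff h j - coeff (monom 1 n - [:a1:]) j" for j
    using hU[of 1 j] by (simp add: b_def e_def U_def)
  have h_q2: "int q2 dvd coeff h j - coeff (monom 1 n - monom a2 1) j" for j
    using hU[of 2 j] by (simp add: b_def e_def U_def)
  have h_q3: "int q3 dvd coeff h j - coeff (quadratic_times_linear n a3) j" for j
    using hU[of 3 j] by (simp add: b_def e_def U_def)
  have h_r: "(int r)\<^sup>2 dvd coeff h j - coeff (quadratic_times_linear n (int r)) j" for j
    using hU[of 4 j] by (simp add: b_def e_def U_def)
  have big: "q3 > n" "q3 > 2" "r > n" "r > 2" using q1(2) q2(2) q3(2) r(2) n by linarith+
  have disc_r: "int r dvd discr h" "\<not> (int r)\<^sup>2 dvd discr h"
  proof -
    have "(int r)\<^sup>2 dvd discr h - discr (quadratic_times_linear n (int r))"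
      using quadratic_times_linear_monic[OF n, of "int r"] degh lch n h_r by (intro discr_cong[of _ n]) auto
    moreover have "int r dvd (int r)\<^sup>2" by (simp add: power2_eq_square)
    moreover note discr_quadratic_times_linear[OF n r(1) big(3,4)]
    ultimately show "int r dvd discr h" "\<not> (int r)\<^sup>2 dvd discr h"
      by (meson dvd_diff_right_iff dvd_trans dvd_diff_left_iff)+
  qed
  then have dh0: "discr h \<noteq> 0" by auto
  have nq1: "\<not> int q1 dvd discr h"
    using separable_binomial[OF _ P(1) _ kummer_prime_not_dvd[OF q1(1)] na(1)] n
    by (intro discr_not_dvd_if_separable[OF lch P(1) h_q1]) auto
  have nq2: "\<not> int q2 dvd discr h"
    using separable_binomial_X[OF _ P(2) _ kummer_prime_not_dvd[OF q2(1)] na(2) n]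
    by (intro discr_not_dvd_if_separable[OF lch P(2) h_q2]) auto
  have nq3: "\<not> int q3 dvd discr h"
    using separable_quadratic_times_linear[OF _ P(3) _ big(1,2) na(3) kummer_prime_nonresidue[OF q3(1)]]
    by (intro discr_not_dvd_if_separable[OF lch P(3) h_q3]) auto
  \<comment> \<open>The remaining candidates for fixed divisors, including \<open>r\<close>. The
    prime \<open>p\<close> is set apart because \<open>k\<close> is already prescribed modulo its
    square.\<close>
  define S where "S = {q. prime q \<and> int q dvd discr h \<and> q \<noteq> p}"
  have finS: "finite S"
  proof (rule finite_subset)
    show "S \<subseteq> {..nat \<bar>discr h\<bar>}"
    proof
      fix q assume "q \<in> S"
      then have "int q \<le> \<bar>discr h\<bar>" using dh0 by (intro zdvd_imp_le) (auto simp: S_def)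
      then show "q \<in> {..nat \<bar>discr h\<bar>}" by simp
    qed
  qed simp
  define A where "A = {p, q1, q2, q3} \<union> S"
  have finA: "finite A" using finS by (simp add: A_def)
  define M where "M = (\<lambda>q. int (q ^ (if q = p then 2 else 1)))"
  \<comment> \<open>Residues for \<open>k\<close>: the Wronskian template at \<open>p\<close>, zero
    at the three Frobenius primes, and elsewhere the difference that turns \<open>h + k\<close> into
    a separable template.\<close>
  define V where "V = (\<lambda>q. if q = p then monom 1 (n - 1) + 1 else if q \<in> {q1, q2, q3} then 0 else separable_template n q - h)"
  have Aprime: "prime q" if "q \<in> A" for q using that p P by (auto simp: A_def S_def)
  have "\<exists>f. (\<forall>j\<ge>n. coeff f j = 0) \<and> (\<forall>q\<in>A. \<forall>j. M q dvd coeff f j - coeff (V q) j)"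
  proof (rule chinese_remainder_poly[OF finA])
    fix x y assume xy: "x \<in> A" "y \<in> A" "x \<noteq> y"
    have "coprime (x ^ i) (y ^ j)" for i j :: nat
      by (intro coprime_power_left_iff[THEN iffD2] coprime_power_right_iff[THEN iffD2] disjI1 primes_coprime Aprime xy)
    then show "coprime (M x) (M y)" unfolding M_def coprime_int_iff .
  next
    fix q j assume "q \<in> A" "n \<le> j"
    then show "coeff (V q) j = 0"
      using n degh lch by (cases "j = n") (auto simp: V_def separable_template_def coeff_monom coeff_pCons coeff_eq_0 split: nat.splits)
  qed
  then obtain f where f: "\<And>j. j \<ge> n \<Longrightarrow> coeff f j = 0" "\<And>q j. q \<in> A \<Longrightarrow> M q dvd coeff f j - coeff (V q) j" by blast
  define T where "T = (\<Prod>q\<in>A. M q)"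
  have Mpos: "M q > 0" if "q \<in> A" for q using Aprime[OF that] prime_gt_0_nat by (auto simp: M_def)
  have T0: "T > 0" unfolding T_def using Mpos by (intro prod_pos)
  define K where "K = (\<Prod>i=1..int n - 1. [:- i, 1:])"
  obtain N :: int where N: "\<And>j. Suc j < n \<Longrightarrow>
     poly (map_poly of_int (f + smult (N * T) K)) (real j + 1/2) * poly (map_poly of_int (f + smult (N * T) K)) (real (Suc j) + 1/2) < 0"
    using real_root_multiplier[OF T0, of n f] unfolding K_def by blast
  define k where "k = f + smult (N * T) K"
  have degK: "degree K = n - 1" unfolding K_def
    by (subst degree_prod_eq_sum_degree) (use n in auto)
  have ktop: "coeff k j = 0" if "j \<ge> n" for j
    using that n f(1) degK by (simp add: k_def coeff_eq_0)
  have degk: "degree k < n" using ktop n by (metis degree_0 leading_coeff_0_iff not_less zero_less_numeral le_less_trans not_le)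
  have kV: "M q dvd coeff k j - coeff (V q) j" if q: "q \<in> A" for q j
  proof -
    have "M q dvd T" unfolding T_def using finA q by (rule dvd_prodI)
    then have "M q dvd (coeff f j - coeff (V q) j) + N * T * coeff K j" using f(2)[OF q, of j] by (intro dvd_add) auto
    then show ?thesis by (simp add: k_def algebra_simps)
  qed
  have k_p: "(int p)\<^sup>2 dvd coeff k j - coeff (monom 1 (n - 1) + 1) j" for j
    using kV[of p j] by (simp add: A_def M_def V_def)
  have k_q: "int q dvd coeff k j" if "q \<in> {q1, q2, q3}" for q j
    using kV[of q j] that pn q1(2) q2(2) q3(2) by (auto simp: A_def M_def V_def)
  have k_S: "int q dvd coeff k j - coeff (separable_template n q - h) j" if "q \<in> S" for q j
  proof -
    have "q \<noteq> p" "q \<notin> {q1, q2, q3}" using that nq1 nq2 nq3 by (auto simp: S_def)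
    then show ?thesis using kV[of q j] that by (simp add: A_def M_def V_def)
  qed
  obtain D :: "int poly" where D: "\<And>s. poly D s = discr (h + smult s k)"
    "\<And>z::complex. poly (map_poly of_int D) z = discr (map_poly of_int h + smult z (map_poly of_int k))"
    using discr_linear_family[OF degh ktop lch] n by auto
  have nofix: "\<exists>s. \<not> int q dvd poly D s" if q: "prime q" for q
  proof (cases "int q dvd discr h")
    case False
    then have "\<not> int q dvd poly D 0" by (simp add: D(1))
    then show ?thesis by blast
  next
    case True
    have deg1: "degree (h + k) = n" using degh degk by (simp add: degree_add_eq_left)
    have lc1: "lead_coeff (h + k) = 1" unfolding deg1 using lch degh ktop[of n] by simp
    have "\<not> int q dvd discr (h + k)"
    proof (cases "q = p")
      case True
      have pp: "int p dvd (int p)\<^sup>2" by (simp add: power2_eq_square)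
      have "int p dvd coeff (h + k) j - coeff (monom 1 n + monom 1 (n - 1) + 1) j" for j
      proof -
        have "int p dvd (coeff h j - coeff (monom 1 n + monom (int p) 1) j) + (coeff k j - coeff (monom 1 (n - 1) + 1) j) + coeff (monom (int p) 1) j"
          using dvd_trans[OF pp h_p] dvd_trans[OF pp k_p] by (intro dvd_add) (auto simp: coeff_monom)
        then show ?thesis by (simp add: algebra_simps)
      qed
      then show ?thesis unfolding True
        using separable_trinomial[OF _ p(1) _ p(2) n] by (intro discr_not_dvd_if_separable[OF lc1 p(1)]) auto
    next
      case False
      then have qS: "q \<in> S" using q True by (simp add: S_def)
      have "int q dvd coeff (h + k) j - coeff (separable_template n q) j" for j
        using k_S[OF qS, of j] by (simp add: algebra_simps)
      then show ?thesis
        using separable_template_separable[OF _ q _ n] by (intro discr_not_dvd_if_separable[OF lc1 q]) auto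
    qed
    then have "\<not> int q dvd poly D 1" by (simp add: D(1))
    then show ?thesis by blast
  qed
  have k0: "k \<noteq> 0"
  proof
    assume k0: "k = 0"
    have "\<not> int p dvd 1" using p(1) by (auto simp: prime_nat_iff)
    moreover have "int p dvd 1"
    proof -
      have "(int p)\<^sup>2 dvd - 1" using k_p[of 0] k0 n by (simp add: coeff_monom)
      then show ?thesis by (metis dvd_minus_iff dvd_trans dvd_triv_left power2_eq_square)
    qed
    ultimately show False by blast
  qed
  have irrD: "irreducible D"
  proof (rule irreducible_discr_family[OF lch degh degk k0 _ _ D(2) nofix r(1)])
    show "degree u = 0 \<or> degree v = 0" if "h * pderiv k - pderiv h * k = u * v" for u v
      using wronskian_eisenstein(2)[OF n p degh h_p degk k_p that] .
    show "degree k < degree (h * pderiv k - pderiv h * k)"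
      using wronskian_eisenstein(1)[OF n p degh h_p degk k_p] degk n by linarith
    show "int r dvd poly D 0" "\<not> (int r)\<^sup>2 dvd poly D 0" using disc_r by (simp_all add: D(1))
  qed
  have cong: "int q dvd coeff (h + smult s k) i - coeff E i"
    if "q \<in> {q1, q2, q3}" "\<And>i. int q dvd coeff h i - coeff E i" for q s i E
  proof -
    have "int q dvd (coeff h i - coeff E i) + s * coeff k i" using that k_q by (intro dvd_add) auto
    then show ?thesis by (simp add: algebra_simps)
  qed
  have "\<exists>B. \<forall>s. \<bar>s\<bar> > B \<longrightarrow> (\<forall>j. Suc j < n \<longrightarrow> (\<exists>y. real j + 1/2 < y \<and> y < real (Suc j) + 1/2 \<and>
      poly (map_poly of_int h + smult s (map_poly of_int k)) y = 0))"
  proof (rule pencil_real_roots)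
    show "real j + 1/2 < real (Suc j) + 1/2 \<and> poly (map_poly of_int k) (real j + 1/2) * poly (map_poly of_int k) (real (Suc j) + 1/2) < 0"
      if "Suc j < n" for j using N[OF that] by (simp add: k_def)
    show "poly (map_poly of_int k) (real j + 1/2) \<noteq> 0" if j: "j < n" for j
    proof (cases "Suc j < n")
      case True
      then show ?thesis using N[OF True] by (auto simp: k_def)
    next
      case False
      then obtain i where "j = Suc i" "Suc i < n" using j n by (cases j) auto
      then show ?thesis using N[of i] by (auto simp: k_def)
    qed
  qed
  then obtain B where B: "\<And>s j. \<bar>s\<bar> > B \<Longrightarrow> Suc j < n \<Longrightarrow> \<exists>y. real j + 1/2 < y \<and> y < real (Suc j) + 1/2 \<and>
      poly (map_poly of_int h + smult s (map_poly of_int k)) y = 0" by blast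
  show ?thesis
  proof (rule that[OF degh lch degk irrD nofix D(1) q1(1) cong[OF _ h_q1] q2(1) cong[OF _ h_q2] q3(1) big(1,2) cong[OF _ h_q3]])
    fix s :: int and j
    assume "\<bar>real_of_int s\<bar> > B" "Suc j < n"
    from B[OF this] show "\<exists>y::real. real j + 1/2 < y \<and> y < real (Suc j) + 1/2 \<and> poly (map_poly of_int (h + smult s k)) y = 0"
      by (simp add: of_int_poly_hom.hom_add of_int_hom.map_poly_hom_smult)
  qed auto
qed

text \<open>Each nontrivial automorphism moves some root, and the resulting difference of roots
  divides the discriminant. The product of one such difference per automorphism therefore divides a
  power of the discriminant, as the unramifiedness criterion requires.\<close>

lemma (in full_galois) unramified_outside_discr:
  assumes p: "prime p" "\<not> int p dvd discr F"
  shows "\<not> ramified_at p splitting_field"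
proof -
  interpret finite_galois splitting_field
    using galois_splitting_field symmetric_galois_finite[OF galois_group_splitting_field] by unfold_locales
  have "\<forall>\<tau>\<in>Aut splitting_field - {id}. \<exists>x. (x \<in> \<O> \<and> \<tau> x \<in> \<O>) \<and> (\<exists>z. z \<in> \<O> \<and> of_int (discr F) = (\<tau> x - x) * z)"
  proof
    fix \<tau> assume \<tau>: "\<tau> \<in> Aut splitting_field - {id}"
    then obtain \<rho> where \<rho>: "\<rho> \<in> perms" "\<tau> = act \<rho>" using Aut_eq_act by blast
    have "\<rho> \<noteq> id" using \<tau> \<rho> act_id by auto
    then obtain i where i: "\<rho> i \<noteq> i" by (auto simp: fun_eq_iff)
    then have iI: "i \<in> {1..n}" "\<rho> i \<in> {1..n}"
      using \<rho>(1) permutes_not_in[of \<rho> "{1..n}" i] permutes_in_image[of \<rho> "{1..n}" i] by auto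
    obtain z where z: "algebraic_int z" "of_int (discr F) = (\<alpha> (\<rho> i) - \<alpha> i) * z"
      using discr_dvd_root_diff[OF iI(2,1) i] by blast
    have ne: "\<alpha> (\<rho> i) - \<alpha> i \<noteq> 0" using inj_roots i iI by (auto dest: inj_onD)
    then have "z = of_int (discr F) / (\<alpha> (\<rho> i) - \<alpha> i)" using z(2) by simp
    also have "\<dots> \<in> splitting_field"
      by (intro subfield_C_divide[OF L] subfield_C_of_int[OF L] subfield_C_diff[OF L] root_in_splitting_field iI)
    finally have "z \<in> \<O>" using z(1) by (simp add: O_iff)
    moreover have "\<alpha> j \<in> \<O>" if "j \<in> {1..n}" for j
      using alg_int_root[OF that] root_in_splitting_field[OF that] by (simp add: O_iff)
    moreover have "\<tau> (\<alpha> i) = \<alpha> (\<rho> i)" unfolding \<rho>(2) by (rule act_root[OF \<rho>(1) iI(1)])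
    ultimately show "\<exists>x. (x \<in> \<O> \<and> \<tau> x \<in> \<O>) \<and> (\<exists>z. z \<in> \<O> \<and> of_int (discr F) = (\<tau> x - x) * z)"
      using iI z(2) by (intro exI[of _ "\<alpha> i"]) auto
  qed
  from bchoice[OF this] obtain x where x: "\<forall>\<tau>\<in>Aut splitting_field - {id}. (x \<tau> \<in> \<O> \<and> \<tau> (x \<tau>) \<in> \<O>) \<and>
     (\<exists>z. z \<in> \<O> \<and> of_int (discr F) = (\<tau> (x \<tau>) - x \<tau>) * z)" ..
  then have "\<forall>\<tau>\<in>Aut splitting_field - {id}. \<exists>z. z \<in> \<O> \<and> of_int (discr F) = (\<tau> (x \<tau>) - x \<tau>) * z" by blast
  from bchoice[OF this] obtain z where z: "\<forall>\<tau>\<in>Aut splitting_field - {id}. z \<tau> \<in> \<O> \<and>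
     of_int (discr F) = (\<tau> (x \<tau>) - x \<tau>) * z \<tau>" ..
  let ?A = "Aut splitting_field - {id}"
  show ?thesis
  proof (rule unramified_criterion[of p x "discr F ^ card ?A" "\<Prod>\<tau>\<in>?A. z \<tau>"])
    show "x \<tau> \<in> \<O>" if "\<tau> \<in> ?A" for \<tau> using x that by blast
    have "of_int (discr F ^ card ?A) = (\<Prod>\<tau>\<in>?A. of_int (discr F))" by simp
    also have "\<dots> = (\<Prod>\<tau>\<in>?A. (\<tau> (x \<tau>) - x \<tau>) * z \<tau>)" by (rule prod.cong[OF refl]) (use z in blast)
    finally show "of_int (discr F ^ card ?A) = (\<Prod>\<tau>\<in>?A. \<tau> (x \<tau>) - x \<tau>) * (\<Prod>\<tau>\<in>?A. z \<tau>)"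
      by (simp only: prod.distrib)
    show "(\<Prod>\<tau>\<in>?A. z \<tau>) \<in> \<O>" by (rule int_subring_prod[OF int_subring_O]) (use z in blast)
    have "prime (int p)" using p(1) by simp
    then show "\<not> int p dvd discr F ^ card ?A" using p(2) prime_dvd_power by blast
  qed (rule p(1))
qed

section \<open>Specialising the family at a prime value of the discriminant\<close>

theorem mainTheorem4:
  fixes n :: nat
  assumes "schinzel_H"
    and "n \<ge> 2"
  shows "r_Q (sym_group n) = 1 \<and>
         (\<exists>L. galois_over_Q L \<and> galois_group L \<cong> sym_group n \<and> totally_real L \<and>
              (\<exists>!p::nat. prime p \<and> ramified_at p L))"
proof -
  have n: "n \<ge> 2" by fact
  obtain h k D :: "int poly" and B :: real and q1 q2 q3 :: nat and a1 a2 a3 :: int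
  where deg: "degree h = n" "lead_coeff h = 1" "degree k < n" and irr: "irreducible D"
    and nofix: "\<And>q. prime q \<Longrightarrow> \<exists>s::int. \<not> int q dvd poly D s"
    and D: "\<And>s. poly D s = discr (h + smult s k)"
    and c1: "kummer_prime q1 n a1" "\<And>s i. int q1 dvd coeff (h + smult s k) i - coeff (monom 1 n - [:a1:]) i"
    and c2: "kummer_prime q2 (n - 1) a2" "\<And>s i. int q2 dvd coeff (h + smult s k) i - coeff (monom 1 n - monom a2 1) i"
    and c3: "kummer_prime q3 2 a3" "q3 > n" "q3 > 2"
    "\<And>s i. int q3 dvd coeff (h + smult s k) i - coeff (quadratic_times_linear n a3) i"
    and B: "\<And>s j. \<bar>real_of_int s\<bar> > B \<Longrightarrow> Suc j < n \<Longrightarrow>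
       \<exists>y::real. real j + 1/2 < y \<and> y < real (Suc j) + 1/2 \<and> poly (map_poly of_int (h + smult s k)) y = 0"
    using good_family_exists[OF n] by metis
  have "\<exists>s::int. \<not> q dvd poly D s" if "prime q" for q :: int
  proof -
    have "prime (nat q)" "int (nat q) = q" using that prime_ge_0_int[OF that] by auto
    then show ?thesis using nofix[of "nat q"] by simp
  qed
  then have "infinite {s::int. \<forall>f\<in>set [D]. prime_elem (poly f s)}"
    using assms(1) irr unfolding schinzel_H_def by (elim allE[of _ "[D]"]) simp
  \<comment> \<open>An infinite set of integers is unbounded in absolute value. The sign of s stays
    open, which the bound \<open>B\<close> allows.\<close>
  then obtain s where s: "\<bar>s\<bar> > \<lceil>B\<rceil>" "prime_elem (poly D s)"
    unfolding infinite_int_iff_unbounded by auto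
  have sB: "\<bar>real_of_int s\<bar> > B" using s(1) by linarith
  define F where "F = h + smult s k"
  have "degree (smult s k) < n" using deg(3) degree_smult_le[of s k] by linarith
  then have degF: "degree F = n" and lcF: "lead_coeff F = 1"
    using deg by (simp_all add: F_def degree_add_eq_left coeff_eq_0)
  obtain \<alpha> where "monic_split F n \<alpha>" using monic_split_exists[OF lcF] degF by metis
  then interpret monic_split F n \<alpha> .
  \<comment> \<open>Primality is used twice: a nonzero discriminant makes the roots distinct, and
    its single prime factor is the only prime number that can ramify.\<close>
  have pe: "prime_elem (discr F)" using s(2) by (simp add: D F_def)
  then have inj: "inj_on \<alpha> {1..n}" using discr_eq_0_iff by auto
  have full: "galois_perms = perms"
    by (rule galois_perms_full[OF n c1(1) c1(2)[of s, folded F_def] c2(1) c2(2)[of s, folded F_def] c3(1-3) c3(4)[of s, folded F_def]])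
  interpret full_galois F n \<alpha> using inj full by unfold_locales
  let ?L = splitting_field
  \<comment> \<open>The n - 1 disjoint gaps between the half-integers give n - 1 distinct real
    zeros; \<open>roots_real\<close> takes care of the last root.\<close>
  have "\<forall>j. \<exists>x::real. Suc j < n \<longrightarrow> real j + 1/2 < x \<and> x < real (Suc j) + 1/2 \<and> poly (map_poly of_int F) x = 0"
    using B[OF sB, folded F_def] by blast
  from choice[OF this]
  have "\<exists>y. \<forall>j. Suc j < n \<longrightarrow> real j + 1/2 < y j \<and> y j < real (Suc j) + 1/2 \<and> poly (map_poly of_int F) (y j :: real) = 0" .
  then obtain y where y: "\<And>j. Suc j < n \<Longrightarrow> real j + 1/2 < y j" "\<And>j. Suc j < n \<Longrightarrow> y j < real (Suc j) + 1/2"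
    "\<And>j. Suc j < n \<Longrightarrow> poly (map_poly of_int F) (y j :: real) = 0" by blast
  have yinj: "inj_on y {..<n - 1}"
  proof (rule linorder_inj_onI)
    fix i j assume ij: "i < j" "i \<in> {..<n - 1}" "j \<in> {..<n - 1}"
    then have "y i < real (Suc i) + 1/2" "real j + 1/2 < y j" "real (Suc i) \<le> real j" using y by auto
    then show "y i \<noteq> y j" by linarith
  qed auto
  have tr: "totally_real ?L"
    by (rule totally_real_splitting_field, rule roots_real[OF inj _ yinj]) (use n y(3) in auto)
  have G: "galois_over_Q ?L" "galois_group ?L \<cong> sym_group n"
    by (rule galois_splitting_field, rule galois_group_splitting_field)
  define q0 where "q0 = nat \<bar>discr F\<bar>"
  have "prime \<bar>discr F\<bar>" using pe by (rule prime_elem_iff_prime_abs[THEN iffD1])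
  then have q0: "prime q0" unfolding q0_def by (simp only: prime_nat_iff_prime abs_ge_zero nat_0_le simp_thms)
  have only: "p = q0" if "prime p" "ramified_at p ?L" for p
  proof -
    have "int p dvd discr F" using unramified_outside_discr that by blast
    then have "p dvd q0" by (simp add: q0_def nat_abs_dvd_iff[symmetric] dvd_nat_abs_iff)
    then show ?thesis using that(1) q0 by (simp add: primes_dvd_imp_eq)
  qed
  \<comment> \<open>That some prime number ramifies comes from the quadratic subfield, not from a
    local study at \<open>q0\<close>; combined with \<open>only\<close> it identifies the ramified
    prime as \<open>q0\<close>.\<close>
  obtain p where p: "prime p" "ramified_at p ?L"
    using symmetric_galois_some_prime_ramifies[OF G n tr] by blast
  have uniq: "\<exists>!p::nat. prime p \<and> ramified_at p ?L" using p only by blast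
  have "{p::nat. prime p \<and> ramified_at p ?L} = {p}" using p only by blast
  then have "num_ramified ?L = 1" using tr by (simp add: num_ramified_def)
  then have "r_Q (sym_group n) = 1"
    unfolding r_Q_def
    by (intro Least_equality) (use G symmetric_galois_num_ramified_pos[OF _ _ n] in blast)+
  then show ?thesis using G tr uniq by blast
qed

end
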